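(* Let $R\subseteq I\times J\times K$ be a ternary relation between sets $I,J,K$. In the sense of realization made precise in the context: (i) The map $|\mathcal{D}(R)|\to|\mathcal{D}(R_{IJ})|$ is realized by each of these simplicial maps: - $\mathrm{Cuboid}(R)\to\mathrm{Rect}(R_{IJ})$, induced by the projection $I\times J\times K\to I\times J$; - $\mathrm{Dowker}_{/K}(R)\to\mathrm{Rect}(R_{IJ})$, a subcomplex inclusion. (ii) The map $|\mathcal{D}(R)|\to|\mathcal{D}(R)/(J,K)|$ is realized by each of these simplicial maps: - $\mathrm{Cuboid}(R)\to\mathrm{Rect}(R_{(JK)})$, a subcomplex inclusion; - $\mathrm{Cuboid}(R)\to\mathrm{Dowker}_I(R_{(JK)})$, induced by the projection $I\times J\times K\to I$; - $\mathrm{Cuboid}(R)\to\mathrm{Dowker}_{J\times K}(R_{(JK)})$, induced by the projection $I\times J\times K\to J\times K$; - $\mathrm{Dowker}_{/I}(R)\to\mathrm{Dowker}_{J\times K}(R_{(JK)})$, a subcomplex inclusion. (iii) The map $|\mathcal{D}(R)/(J,K)|\to|\mathcal{D}(R_{IJ})|$ is realized by the simplicial map - $\mathrm{Dowker}_I(R_{(JK)})\to\mathrm{Dowker}_I(R_{IJ})$, a subcomplex inclusion.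
   Context: Basic conventions. $\Delta I$ is the set of non-empty finite subsets of $I$ ordered by inclusion. A prod-complex on $I_1,\dots,I_m$ is a down-set $P\le\Delta I_1\times\dots\times\Delta I_m$; simplicial complexes on $I$ are the case $m=1$. A simplicial map $S\to T$ is a function on the underlying sets carrying simplices to simplices; $|\cdot|$ on simplicial complexes and maps is the usual geometric realization, with $|\sigma|=\mathrm{conv}\{\varepsilon(i)\mid i\in\sigma\}$, $\varepsilon(i)$ being standard basis vectors of the space $\mathbb{R}_I$ of finitely supported real families. For a prod-complex, $|P|=\bigcup_{\sigma\in P}|\sigma_1|\times\dots\times|\sigma_m|$, a subcomplex of the product CW-complex $|\Delta I_1|\times\dots\times|\Delta I_m|$ (compactly generated product topology). Complexes. For a relation $Q\subseteq I_1\times\dots\times I_m$: the Dowker relational product is $\mathcal{D}(Q)=\{(\sigma_1,\dots,\sigma_m)\mid\sigma_1\times\dots\times\sigma_m\subseteq Q\}$; the cuboid complex is $\mathrm{Cuboid}(Q)=\{\rho\in\Delta(I_1\times\dots\times I_m)\mid\rho_1\times\dots\times\rho_m\subseteq Q\}$ where $\rho_k$ is the projection of $\rho$ to $I_k$, written $\mathrm{Rect}(Q)$ when $m=2$. For a binary relation $Q\subseteq A\times B$, $\mathrm{Dowker}_A(Q)=\{\sigma\in\Delta A\mid\exists b\in B,\ \sigma\times\{b\}\subseteq Q\}$ and $\mathrm{Dowker}_B(Q)=\{\tau\in\Delta B\mid\exists a\in A,\ \{a\}\times\tau\subseteq Q\}$. For the ternary relation $R$: $\mathrm{Dowker}_{/K}(R)$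 is the simplicial complex on $I\times J$ of those $\zeta$ with $\zeta_I\times\zeta_J\times\{k\}\subseteq R$ for some $k\in K$, and similarly $\mathrm{Dowker}_{/I}(R)$ on $J\times K$. $R_{IJ}=\{(i,j)\mid\exists k,\ (i,j,k)\in R\}$. $R_{(JK)}=\{(i,(j,k))\mid(i,j,k)\in R\}\subseteq I\times(J\times K)$; $\mathrm{Rect}(R_{(JK)})$ is regarded as a simplicial complex on $I\times J\times K=I\times(J\times K)$. Dowkerian quotients of a prod-complex, such as $\mathcal{D}(R)/K$, $\mathcal{D}(R)/(J,K)$, $\mathcal{D}(R_{IJ})/J$, are obtained by deleting the factors indexed by the named sets from every prod-simplex; the geometric quotient maps ($|\psi_K|:|\mathcal{D}(R)|\to|\mathcal{D}(R)/K|$, etc.) are restrictions of the coordinate projections. One has $\mathcal{D}(R)/(J,K)=\mathrm{Dowker}_I(R_{(JK)})$ and $\mathcal{D}(R_{IJ})/J=\mathrm{Dowker}_I(R_{IJ})$. The three maps to be realized (in the homotopy category). The map $|\mathcal{D}(R)|\to|\mathcal{D}(R)/(J,K)|$ is the iterated Dowkerian quotient map. The map $|\mathcal{D}(R)|\to|\mathcal{D}(R_{IJ})|$ is the composite of $|\psi_K|:|\mathcal{D}(R)|\to|\mathcal{D}(R)/K|$ with the inclusion $|\mathcal{D}(R)/K|\subseteq|\mathcal{D}(R_{IJ})|$. The map $|\mathcal{D}(R)/(J,K)|\to|\mathcal{D}(R_{IJ})|$ is the composite of the inclusion $|\mathcal{D}(R)/(J,K)|\subseteq|\mathcal{D}(R_{IJ})/J|$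 with a homotopy inverse of the homotopy equivalence $|\psi_J|:|\mathcal{D}(R_{IJ})|\to|\mathcal{D}(R_{IJ})/J|$. Canonical identifications in the homotopy category. The squashing map $\xi:|\mathrm{Cuboid}(Q)|\to|\mathcal{D}(Q)|$ is the restriction of the linear map $\varepsilon((i_1,\dots,i_m))\mapsto(\varepsilon(i_1),\dots,\varepsilon(i_m))$; it is a homotopy equivalence and identifies $|\mathrm{Cuboid}(R)|$ with $|\mathcal{D}(R)|$ and $|\mathrm{Rect}(R_{IJ})|$ with $|\mathcal{D}(R_{IJ})|$. The simplicial maps $\mathrm{Cuboid}(R)\to\mathrm{Dowker}_{/K}(R)$ and $\mathrm{Cuboid}(R)\to\mathrm{Dowker}_{/I}(R)$ induced by projection are homotopy equivalences on realizations, and identify $|\mathrm{Dowker}_{/K}(R)|$ and $|\mathrm{Dowker}_{/I}(R)|$ with $|\mathrm{Cuboid}(R)|$, hence with $|\mathcal{D}(R)|$. The simplicial maps $\mathrm{Rect}(R_{(JK)})\to\mathrm{Dowker}_I(R_{(JK)})$ and $\mathrm{Rect}(R_{(JK)})\to\mathrm{Dowker}_{J\times K}(R_{(JK)})$ induced by projection are homotopy equivalences on realizations, and identify $|\mathrm{Rect}(R_{(JK)})|$ and $|\mathrm{Dowker}_{J\times K}(R_{(JK)})|$ with $|\mathrm{Dowker}_I(R_{(JK)})|=|\mathcal{D}(R)/(J,K)|$. The homotopy equivalence $|\psi_J|:|\mathcal{D}(R_{IJ})|\to|\mathcal{D}(R_{IJ})/J|=|\mathrm{Dowker}_I(R_{IJ})|$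 identifies $|\mathrm{Dowker}_I(R_{IJ})|$ with $|\mathcal{D}(R_{IJ})|$. A map $X\to Y$ is said to be realized by a simplicial map $g:S\to T$ if $g$ is a well-defined simplicial map and, under the canonical identifications of $|S|$ with $X$ and $|T|$ with $Y$ in the homotopy category (namely: $|\mathrm{Cuboid}(R)|$ with $|\mathcal{D}(R)|$ and $|\mathrm{Rect}(R_{IJ})|$ with $|\mathcal{D}(R_{IJ})|$ via the squashing maps $\xi$; $|\mathrm{Dowker}_{/K}(R)|$ and $|\mathrm{Dowker}_{/I}(R)|$ with $|\mathcal{D}(R)|$ via the projection-induced maps from $|\mathrm{Cuboid}(R)|$ followed by the identification $\xi$ of $|\mathrm{Cuboid}(R)|$ with $|\mathcal{D}(R)|$; $|\mathrm{Dowker}_I(R_{(JK)})|$ with $|\mathcal{D}(R)/(J,K)|$ by equality; $|\mathrm{Rect}(R_{(JK)})|$ and $|\mathrm{Dowker}_{J\times K}(R_{(JK)})|$ with $|\mathcal{D}(R)/(J,K)|$ via the projection-induced maps from $|\mathrm{Rect}(R_{(JK)})|$ to $|\mathrm{Dowker}_I(R_{(JK)})|$ and to $|\mathrm{Dowker}_{J\times K}(R_{(JK)})|$; and $|\mathrm{Dowker}_I(R_{IJ})|$ with $|\mathcal{D}(R_{IJ})|$ via $|\psi_J|$), the map $|g|$ corresponds to $X\to Y$ in the homotopy category (i.e. the evident square commutes up to homotopy). *)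

theory Defs
  imports "HOL-Analysis.Analysis"
begin

section \<open>Simplicial complexes and geometric realization\<close>

definition Simp :: "'a set \<Rightarrow> 'a set set" where
  "Simp A = {\<sigma>. \<sigma> \<noteq> {} \<and> finite \<sigma> \<and> \<sigma> \<subseteq> A}"

definition simplicial_complex :: "'a set \<Rightarrow> 'a set set \<Rightarrow> bool" where
  "simplicial_complex A S \<longleftrightarrow>
     S \<subseteq> Simp A \<and> (\<forall>\<sigma>\<in>S. \<forall>\<tau>\<in>Simp A. \<tau> \<subseteq> \<sigma> \<longrightarrow> \<tau> \<in> S)"

definition simplicial_map ::
  "'a set \<Rightarrow> 'a set set \<Rightarrow> 'b set \<Rightarrow> 'b set set \<Rightarrow> ('a \<Rightarrow> 'b) \<Rightarrow> bool" where
  "simplicial_map A S B T g \<longleftrightarrow>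
     simplicial_complex A S \<and> simplicial_complex B T \<and>
     g ` A \<subseteq> B \<and> (\<forall>\<sigma>\<in>S. g ` \<sigma> \<in> T)"

definition vertex :: "'a \<Rightarrow> 'a \<Rightarrow> real" ("\<epsilon>") where
  "\<epsilon> i = (\<lambda>j. if j = i then 1 else 0)"

text \<open>The convex hull of the vertices of a finite set. It is written out because functions are
  not an instance of class \<open>real_vector\<close>.\<close>

definition geo_simplex :: "'a set \<Rightarrow> ('a \<Rightarrow> real) set" where
  "geo_simplex \<sigma> = {(\<lambda>j. \<Sum>i\<in>\<sigma>. t i * \<epsilon> i j) | t. (\<forall>i\<in>\<sigma>. 0 \<le> t i) \<and> (\<Sum>i\<in>\<sigma>. t i) = 1}"

text \<open>The weak topology: a set is open iff it meets every closed simplex in an open subset of that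
  simplex. The product topology of the type \<open>'a \<Rightarrow> real\<close> restricts to the Euclidean topology
  on each \<open>geo_simplex \<sigma>\<close> with \<open>\<sigma>\<close> finite.\<close>

definition realization :: "'a set set \<Rightarrow> ('a \<Rightarrow> real) topology" where
  "realization S = topology (\<lambda>U. U \<subseteq> (\<Union>\<sigma>\<in>S. geo_simplex \<sigma>) \<and>
     (\<forall>\<sigma>\<in>S. openin (top_of_set (geo_simplex \<sigma>)) (geo_simplex \<sigma> \<inter> U)))"

lemma openin_realization:
  "openin (realization S) U \<longleftrightarrow> U \<subseteq> (\<Union>\<sigma>\<in>S. geo_simplex \<sigma>) \<and>
     (\<forall>\<sigma>\<in>S. openin (top_of_set (geo_simplex \<sigma>)) (geo_simplex \<sigma> \<inter> U))"
proof -
  let ?P = "\<lambda>U. U \<subseteq> (\<Union>\<sigma>\<in>S. geo_simplex \<sigma>) \<and>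
     (\<forall>\<sigma>\<in>S. openin (top_of_set (geo_simplex \<sigma>)) (geo_simplex \<sigma> \<inter> U))"
  have "istopology ?P"
    unfolding istopology_def
  proof (intro conjI allI impI ballI)
    fix U V \<sigma> assume "?P U" "?P V" "\<sigma> \<in> S"
    moreover have "geo_simplex \<sigma> \<inter> (U \<inter> V) = (geo_simplex \<sigma> \<inter> U) \<inter> (geo_simplex \<sigma> \<inter> V)"
      by blast
    ultimately show "openin (top_of_set (geo_simplex \<sigma>)) (geo_simplex \<sigma> \<inter> (U \<inter> V))"
      by (simp add: openin_Int)
  next
    fix \<U> \<sigma> assume "\<forall>U\<in>\<U>. ?P U" "\<sigma> \<in> S"
    moreover have "geo_simplex \<sigma> \<inter> \<Union>\<U> = (\<Union>U\<in>\<U>. geo_simplex \<sigma> \<inter> U)"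
      by blast
    ultimately show "openin (top_of_set (geo_simplex \<sigma>)) (geo_simplex \<sigma> \<inter> \<Union>\<U>)"
      by (metis (no_types, lifting) openin_Union image_iff)
  qed blast+
  then show ?thesis
    by (simp add: realization_def)
qed

lemma topspace_realization [simp]: "topspace (realization S) = (\<Union>\<sigma>\<in>S. geo_simplex \<sigma>)"
proof -
  have "geo_simplex \<sigma> \<inter> (\<Union>\<sigma>\<in>S. geo_simplex \<sigma>) = geo_simplex \<sigma>" if "\<sigma> \<in> S" for \<sigma> :: "'a set"
    using that by blast
  then have "openin (realization S) (\<Union>\<sigma>\<in>S. geo_simplex \<sigma>)"
    by (simp add: openin_realization)
  then show ?thesis
    by (metis openin_realization openin_subset openin_topspace subset_antisym)
qed

text \<open>The linear map from finitely supported families on \<open>'a\<close> to families on \<open>'b\<close>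
  that sends \<open>\<epsilon> i\<close> to \<open>v i\<close>.\<close>

definition lin_ext :: "('a \<Rightarrow> 'b \<Rightarrow> real) \<Rightarrow> ('a \<Rightarrow> real) \<Rightarrow> ('b \<Rightarrow> real)" where
  "lin_ext v x = (\<lambda>j. \<Sum>i | x i \<noteq> 0. x i * v i j)"

definition realization_map :: "('a \<Rightarrow> 'b) \<Rightarrow> ('a \<Rightarrow> real) \<Rightarrow> ('b \<Rightarrow> real)" where
  "realization_map g = lin_ext (\<lambda>i. \<epsilon> (g i))"


section \<open>Realization of prod-complexes with two and three factors\<close>

text \<open>The ambient space is the compactly generated product of the full simplices; a prod-complex with
  one factor is a simplicial complex.\<close>

definition realization2 ::
  "'i set \<Rightarrow> 'j set \<Rightarrow> ('i set \<times> 'j set) set \<Rightarrow> (('i \<Rightarrow> real) \<times> ('j \<Rightarrow> real)) topology" where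
  "realization2 I J P =
     subtopology (kification (prod_topology (realization (Simp I)) (realization (Simp J))))
       (\<Union>(\<sigma>, \<tau>)\<in>P. geo_simplex \<sigma> \<times> geo_simplex \<tau>)"

definition realization3 ::
  "'i set \<Rightarrow> 'j set \<Rightarrow> 'k set \<Rightarrow> ('i set \<times> 'j set \<times> 'k set) set
     \<Rightarrow> (('i \<Rightarrow> real) \<times> ('j \<Rightarrow> real) \<times> ('k \<Rightarrow> real)) topology" where
  "realization3 I J K P =
     subtopology (kification (prod_topology (realization (Simp I))
         (prod_topology (realization (Simp J)) (realization (Simp K)))))
       (\<Union>(\<sigma>, \<tau>, \<upsilon>)\<in>P. geo_simplex \<sigma> \<times> geo_simplex \<tau> \<times> geo_simplex \<upsilon>)"

text \<open>Dowkerian quotients delete the last factor; the geometric quotient maps are the corresponding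
  coordinate projections.\<close>

definition del3 :: "('i set \<times> 'j set \<times> 'k set) set \<Rightarrow> ('i set \<times> 'j set) set" where
  "del3 P = (\<lambda>(\<sigma>, \<tau>, \<upsilon>). (\<sigma>, \<tau>)) ` P"

definition del2 :: "('i set \<times> 'j set) set \<Rightarrow> 'i set set" where
  "del2 P = (\<lambda>(\<sigma>, \<tau>). \<sigma>) ` P"

definition quot3 :: "('i \<Rightarrow> real) \<times> ('j \<Rightarrow> real) \<times> ('k \<Rightarrow> real) \<Rightarrow> ('i \<Rightarrow> real) \<times> ('j \<Rightarrow> real)" where
  "quot3 = (\<lambda>(x, y, z). (x, y))"

definition quot2 :: "('i \<Rightarrow> real) \<times> ('j \<Rightarrow> real) \<Rightarrow> ('i \<Rightarrow> real)" where
  "quot2 = (\<lambda>(x, y). x)"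


section \<open>Complexes of relations\<close>

definition dowker_prod2 :: "'i set \<Rightarrow> 'j set \<Rightarrow> ('i \<times> 'j) set \<Rightarrow> ('i set \<times> 'j set) set" where
  "dowker_prod2 I J Q = {(\<sigma>, \<tau>). \<sigma> \<in> Simp I \<and> \<tau> \<in> Simp J \<and> \<sigma> \<times> \<tau> \<subseteq> Q}"

definition dowker_prod3 ::
  "'i set \<Rightarrow> 'j set \<Rightarrow> 'k set \<Rightarrow> ('i \<times> 'j \<times> 'k) set \<Rightarrow> ('i set \<times> 'j set \<times> 'k set) set" where
  "dowker_prod3 I J K R =
     {(\<sigma>, \<tau>, \<upsilon>). \<sigma> \<in> Simp I \<and> \<tau> \<in> Simp J \<and> \<upsilon> \<in> Simp K \<and> \<sigma> \<times> \<tau> \<times> \<upsilon> \<subseteq> R}"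

definition rect :: "'i set \<Rightarrow> 'j set \<Rightarrow> ('i \<times> 'j) set \<Rightarrow> ('i \<times> 'j) set set" where
  "rect I J Q = {\<rho> \<in> Simp (I \<times> J). fst ` \<rho> \<times> snd ` \<rho> \<subseteq> Q}"

definition cuboid ::
  "'i set \<Rightarrow> 'j set \<Rightarrow> 'k set \<Rightarrow> ('i \<times> 'j \<times> 'k) set \<Rightarrow> ('i \<times> 'j \<times> 'k) set set" where
  "cuboid I J K R = {\<rho> \<in> Simp (I \<times> J \<times> K).
     (\<lambda>(i, j, k). i) ` \<rho> \<times> (\<lambda>(i, j, k). j) ` \<rho> \<times> (\<lambda>(i, j, k). k) ` \<rho> \<subseteq> R}"

definition dowker_left :: "'a set \<Rightarrow> 'b set \<Rightarrow> ('a \<times> 'b) set \<Rightarrow> 'a set set" where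
  "dowker_left A B Q = {\<sigma> \<in> Simp A. \<exists>b\<in>B. \<sigma> \<times> {b} \<subseteq> Q}"

definition dowker_right :: "'a set \<Rightarrow> 'b set \<Rightarrow> ('a \<times> 'b) set \<Rightarrow> 'b set set" where
  "dowker_right A B Q = {\<tau> \<in> Simp B. \<exists>a\<in>A. {a} \<times> \<tau> \<subseteq> Q}"

definition dowker_mod_K ::
  "'i set \<Rightarrow> 'j set \<Rightarrow> 'k set \<Rightarrow> ('i \<times> 'j \<times> 'k) set \<Rightarrow> ('i \<times> 'j) set set" where
  "dowker_mod_K I J K R = {\<zeta> \<in> Simp (I \<times> J). \<exists>k\<in>K. fst ` \<zeta> \<times> snd ` \<zeta> \<times> {k} \<subseteq> R}"

definition dowker_mod_I ::
  "'i set \<Rightarrow> 'j set \<Rightarrow> 'k set \<Rightarrow> ('i \<times> 'j \<times> 'k) set \<Rightarrow> ('j \<times> 'k) set set" where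
  "dowker_mod_I I J K R = {\<zeta> \<in> Simp (J \<times> K). \<exists>i\<in>I. {i} \<times> fst ` \<zeta> \<times> snd ` \<zeta> \<subseteq> R}"

definition rel_IJ :: "('i \<times> 'j \<times> 'k) set \<Rightarrow> ('i \<times> 'j) set" where
  "rel_IJ R = {(i, j). \<exists>k. (i, j, k) \<in> R}"

text \<open>Triples are pairs nested to the right, so this is \<open>R\<close> itself, read as a binary relation
  between \<open>I\<close> and \<open>J \<times> K\<close>.\<close>

definition rel_JK :: "('i \<times> 'j \<times> 'k) set \<Rightarrow> ('i \<times> ('j \<times> 'k)) set" where
  "rel_JK R = {(i, (j, k)) | i j k. (i, j, k) \<in> R}"

definition proj_I :: "'i \<times> 'j \<times> 'k \<Rightarrow> 'i" where
  "proj_I = (\<lambda>(i, j, k). i)"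

definition proj_IJ :: "'i \<times> 'j \<times> 'k \<Rightarrow> 'i \<times> 'j" where
  "proj_IJ = (\<lambda>(i, j, k). (i, j))"

definition proj_JK :: "'i \<times> 'j \<times> 'k \<Rightarrow> 'j \<times> 'k" where
  "proj_JK = (\<lambda>(i, j, k). (j, k))"

text \<open>The squashing maps, restricting the linear maps \<open>\<epsilon> (i, j) \<mapsto> (\<epsilon> i, \<epsilon> j)\<close> and
  \<open>\<epsilon> (i, j, k) \<mapsto> (\<epsilon> i, \<epsilon> j, \<epsilon> k)\<close>.\<close>

definition squash2 :: "('i \<times> 'j \<Rightarrow> real) \<Rightarrow> ('i \<Rightarrow> real) \<times> ('j \<Rightarrow> real)" where
  "squash2 x = (lin_ext (\<lambda>(i, j). \<epsilon> i) x, lin_ext (\<lambda>(i, j). \<epsilon> j) x)"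

definition squash3 ::
  "('i \<times> 'j \<times> 'k \<Rightarrow> real) \<Rightarrow> ('i \<Rightarrow> real) \<times> ('j \<Rightarrow> real) \<times> ('k \<Rightarrow> real)" where
  "squash3 x = (lin_ext (\<lambda>(i, j, k). \<epsilon> i) x, lin_ext (\<lambda>(i, j, k). \<epsilon> j) x,
                lin_ext (\<lambda>(i, j, k). \<epsilon> k) x)"


section \<open>The homotopy category\<close>

text \<open>A morphism is a triple of a source, a target and a homotopy class of continuous maps. The
  class of \<open>hclass X Y f\<close> is empty if \<open>f\<close> is not continuous from \<open>X\<close> to \<open>Y\<close>; such triples are not
  morphisms, and are excluded by \<open>hmorphism\<close> and \<open>hiso\<close>.\<close>

type_synonym ('a, 'b) hmor = "'a topology \<times> 'b topology \<times> ('a \<Rightarrow> 'b) set"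

definition hclass :: "'a topology \<Rightarrow> 'b topology \<Rightarrow> ('a \<Rightarrow> 'b) \<Rightarrow> ('a, 'b) hmor" where
  "hclass X Y f = (X, Y, {g. homotopic_with (\<lambda>_. True) X Y f g})"

definition hmorphism :: "'a topology \<Rightarrow> 'b topology \<Rightarrow> ('a, 'b) hmor \<Rightarrow> bool" where
  "hmorphism X Y m \<longleftrightarrow> (\<exists>f. continuous_map X Y f \<and> m = hclass X Y f)"

fun hcomp :: "('b, 'c) hmor \<Rightarrow> ('a, 'b) hmor \<Rightarrow> ('a, 'c) hmor" (infixr "\<circ>\<^sub>h" 70) where
  "(Y', Z, G) \<circ>\<^sub>h (X, Y, F) =
     (X, Z, {h. Y' = Y \<and> (\<exists>g\<in>G. \<exists>f\<in>F. homotopic_with (\<lambda>_. True) X Z (g \<circ> f) h)})"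

definition homotopy_inverse ::
  "'a topology \<Rightarrow> 'b topology \<Rightarrow> ('a \<Rightarrow> 'b) \<Rightarrow> ('b \<Rightarrow> 'a) \<Rightarrow> bool" where
  "homotopy_inverse X Y f g \<longleftrightarrow>
     continuous_map X Y f \<and> continuous_map Y X g \<and>
     homotopic_with (\<lambda>_. True) X X (g \<circ> f) id \<and>
     homotopic_with (\<lambda>_. True) Y Y (f \<circ> g) id"

definition hiso :: "'a topology \<Rightarrow> 'b topology \<Rightarrow> ('a, 'b) hmor \<Rightarrow> bool" where
  "hiso X Y m \<longleftrightarrow> (\<exists>f g. homotopy_inverse X Y f g \<and> m = hclass X Y f)"

fun hinv :: "('a, 'b) hmor \<Rightarrow> ('b, 'a) hmor" where
  "hinv (X, Y, F) = (Y, X, {g. \<exists>f\<in>F. homotopy_inverse X Y f g})"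

text \<open>The morphism \<open>m\<close> from \<open>X\<close> to \<open>Y\<close> is realized by \<open>g\<close> from \<open>S\<close> (on \<open>A\<close>) to \<open>T\<close> (on \<open>B\<close>), where
  \<open>\<phi>\<close> identifies the realization of \<open>S\<close> with \<open>X\<close> and \<open>\<psi>\<close> that of \<open>T\<close> with \<open>Y\<close>. For \<open>g = id\<close>, being
  a simplicial map means that \<open>S\<close> is a subcomplex of \<open>T\<close>.\<close>

definition realized_by ::
  "'x topology \<Rightarrow> 'y topology \<Rightarrow> ('x, 'y) hmor \<Rightarrow>
   'a set \<Rightarrow> 'a set set \<Rightarrow> ('a \<Rightarrow> real, 'x) hmor \<Rightarrow>
   'b set \<Rightarrow> 'b set set \<Rightarrow> ('b \<Rightarrow> real, 'y) hmor \<Rightarrow> ('a \<Rightarrow> 'b) \<Rightarrow> bool" where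
  "realized_by X Y m A S \<phi> B T \<psi> g \<longleftrightarrow>
     hmorphism X Y m \<and> simplicial_map A S B T g \<and>
     hiso (realization S) X \<phi> \<and> hiso (realization T) Y \<psi> \<and>
     m \<circ>\<^sub>h \<phi> = \<psi> \<circ>\<^sub>h hclass (realization S) (realization T) (realization_map g)"


section \<open>The spaces, maps and canonical identifications\<close>

context
  fixes I :: "'i set" and J :: "'j set" and K :: "'k set" and R :: "('i \<times> 'j \<times> 'k) set"
begin

definition sp_D :: "(('i \<Rightarrow> real) \<times> ('j \<Rightarrow> real) \<times> ('k \<Rightarrow> real)) topology" where
  "sp_D = realization3 I J K (dowker_prod3 I J K R)"

definition sp_D_K :: "(('i \<Rightarrow> real) \<times> ('j \<Rightarrow> real)) topology" where
  "sp_D_K = realization2 I J (del3 (dowker_prod3 I J K R))"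

definition sp_D_JK :: "('i \<Rightarrow> real) topology" where
  "sp_D_JK = realization (del2 (del3 (dowker_prod3 I J K R)))"

definition sp_DIJ :: "(('i \<Rightarrow> real) \<times> ('j \<Rightarrow> real)) topology" where
  "sp_DIJ = realization2 I J (dowker_prod2 I J (rel_IJ R))"

definition sp_DIJ_J :: "('i \<Rightarrow> real) topology" where
  "sp_DIJ_J = realization (del2 (dowker_prod2 I J (rel_IJ R)))"

definition map_D_DIJ ::
  "(('i \<Rightarrow> real) \<times> ('j \<Rightarrow> real) \<times> ('k \<Rightarrow> real), ('i \<Rightarrow> real) \<times> ('j \<Rightarrow> real)) hmor" where
  "map_D_DIJ = hclass sp_D_K sp_DIJ id \<circ>\<^sub>h hclass sp_D sp_D_K quot3"

definition map_D_D_JK ::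
  "(('i \<Rightarrow> real) \<times> ('j \<Rightarrow> real) \<times> ('k \<Rightarrow> real), 'i \<Rightarrow> real) hmor" where
  "map_D_D_JK = hclass sp_D_K sp_D_JK quot2 \<circ>\<^sub>h hclass sp_D sp_D_K quot3"

definition map_D_JK_DIJ :: "('i \<Rightarrow> real, ('i \<Rightarrow> real) \<times> ('j \<Rightarrow> real)) hmor" where
  "map_D_JK_DIJ = hinv (hclass sp_DIJ sp_DIJ_J quot2) \<circ>\<^sub>h hclass sp_D_JK sp_DIJ_J id"

definition ident_cuboid ::
  "('i \<times> 'j \<times> 'k \<Rightarrow> real, ('i \<Rightarrow> real) \<times> ('j \<Rightarrow> real) \<times> ('k \<Rightarrow> real)) hmor" where
  "ident_cuboid = hclass (realization (cuboid I J K R)) sp_D squash3"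

definition ident_rect_IJ :: "('i \<times> 'j \<Rightarrow> real, ('i \<Rightarrow> real) \<times> ('j \<Rightarrow> real)) hmor" where
  "ident_rect_IJ = hclass (realization (rect I J (rel_IJ R))) sp_DIJ squash2"

definition ident_dowker_mod_K ::
  "('i \<times> 'j \<Rightarrow> real, ('i \<Rightarrow> real) \<times> ('j \<Rightarrow> real) \<times> ('k \<Rightarrow> real)) hmor" where
  "ident_dowker_mod_K = ident_cuboid \<circ>\<^sub>h
     hinv (hclass (realization (cuboid I J K R)) (realization (dowker_mod_K I J K R))
            (realization_map proj_IJ))"

definition ident_dowker_mod_I ::
  "('j \<times> 'k \<Rightarrow> real, ('i \<Rightarrow> real) \<times> ('j \<Rightarrow> real) \<times> ('k \<Rightarrow> real)) hmor" where
  "ident_dowker_mod_I = ident_cuboid \<circ>\<^sub>h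
     hinv (hclass (realization (cuboid I J K R)) (realization (dowker_mod_I I J K R))
            (realization_map proj_JK))"

definition ident_dowker_I_JK :: "('i \<Rightarrow> real, 'i \<Rightarrow> real) hmor" where
  "ident_dowker_I_JK = hclass (realization (dowker_left I (J \<times> K) (rel_JK R))) sp_D_JK id"

definition ident_rect_JK :: "('i \<times> 'j \<times> 'k \<Rightarrow> real, 'i \<Rightarrow> real) hmor" where
  "ident_rect_JK = ident_dowker_I_JK \<circ>\<^sub>h
     hclass (realization (rect I (J \<times> K) (rel_JK R)))
       (realization (dowker_left I (J \<times> K) (rel_JK R))) (realization_map fst)"

definition ident_dowker_JK :: "('j \<times> 'k \<Rightarrow> real, 'i \<Rightarrow> real) hmor" where
  "ident_dowker_JK = ident_rect_JK \<circ>\<^sub>h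
     hinv (hclass (realization (rect I (J \<times> K) (rel_JK R)))
            (realization (dowker_right I (J \<times> K) (rel_JK R))) (realization_map snd))"

definition ident_dowker_I_IJ :: "('i \<Rightarrow> real, ('i \<Rightarrow> real) \<times> ('j \<Rightarrow> real)) hmor" where
  "ident_dowker_I_IJ =
     hinv (hclass sp_DIJ (realization (dowker_left I J (rel_IJ R))) quot2)"

end

end

theory Submission
  imports Defs
begin

text \<open>Everything rests on two kinds of homotopy equivalences, for which homotopy inverses can be written
  down in barycentric coordinates, also for infinite complexes.

  A squashing map sends a probability measure on a product to its marginals, and the product measure
  (\<open>tensor\<close>) of the marginals is a right inverse. It is a homotopy inverse since a measure and the
  product of its marginals span a common simplex of the rectangle or cuboid complex, so that a
  straight line joins them (\<open>squash2_homotopy_inverse\<close>, \<open>squash3_homotopy_inverse\<close>).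

  The second kind is Dowker duality. Let \<open>N \<sigma>\<close> be the set of all \<open>b\<close> that are related to every vertex of
  \<open>\<sigma>\<close>. Over a point \<open>x\<close> with support \<open>\<sigma>\<close>, a section of the projection to the Dowker complex has to
  choose a measure on \<open>N \<sigma>\<close>. There is in general no continuous choice, because \<open>N\<close> gets smaller when the
  support grows: all simplices around a vertex would impose their own choice at that vertex. The way
  out is to move \<open>x\<close> as well. All coordinates of \<open>x\<close> below a threshold are cut off (\<open>truncate\<close>), and the
  measure on the other side (\<open>select\<close>) is a weighted average of chosen elements \<open>\<beta> \<sigma> \<in> N \<sigma>\<close>, where a set
  \<open>\<sigma>\<close> has positive weight only if it lies between the support of the truncated point and the support
  of \<open>x\<close>. Antitonicity of \<open>N\<close> then makes the product of both measures a point of the total complex,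
  and straight lines give the homotopies (\<open>projection_homotopy_equivalence\<close>). All projections of
  rectangle and cuboid complexes to Dowker complexes are instances
  (\<open>dowker_projection_homotopy_equivalence\<close>), and the geometric quotient map follows by the two-out-of-three
  property (\<open>quot2_DIJ\<close>).

  Most of the squares commute strictly. Those whose identifications involve a homotopy inverse of a
  projection of a cuboid or rectangle complex follow by cancelling that projection
  (\<open>homotopic_compose_inverse\<close>).

  The topological groundwork is that all spaces carry the topology coherent with their closed cells,
  including the k-ified products, and that a homotopy on such a space is continuous as soon as it is
  continuous on each cell.\<close>


section \<open>Coherent topologies\<close>

text \<open>The common form of the topologies of realized simplicial complexes and prod-complexes: continuity is
  a matter of single cells, whatever the shape of the cells.\<close>

definition coherent_topology :: "'a::topological_space set set \<Rightarrow> 'a topology" where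
  "coherent_topology \<C> =
     topology (\<lambda>U. U \<subseteq> \<Union>\<C> \<and> (\<forall>C\<in>\<C>. openin (top_of_set C) (C \<inter> U)))"

lemma openin_coherent_topology:
  "openin (coherent_topology \<C>) U \<longleftrightarrow> U \<subseteq> \<Union>\<C> \<and> (\<forall>C\<in>\<C>. openin (top_of_set C) (C \<inter> U))"
proof -
  let ?P = "\<lambda>U. U \<subseteq> \<Union>\<C> \<and> (\<forall>C\<in>\<C>. openin (top_of_set C) (C \<inter> U))"
  have "istopology ?P"
    unfolding istopology_def
  proof (intro conjI allI impI ballI)
    fix U V C assume "?P U" "?P V" "C \<in> \<C>"
    moreover have "C \<inter> (U \<inter> V) = (C \<inter> U) \<inter> (C \<inter> V)"
      by blast
    ultimately show "openin (top_of_set C) (C \<inter> (U \<inter> V))"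
      by (simp add: openin_Int)
  next
    fix \<U> C assume "\<forall>U\<in>\<U>. ?P U" "C \<in> \<C>"
    moreover have "C \<inter> \<Union>\<U> = (\<Union>U\<in>\<U>. C \<inter> U)"
      by blast
    ultimately show "openin (top_of_set C) (C \<inter> \<Union>\<U>)"
      by (metis (no_types, lifting) openin_Union image_iff)
  qed blast+
  then show ?thesis
    by (simp add: coherent_topology_def)
qed

lemma topspace_coherent_topology [simp]: "topspace (coherent_topology \<C>) = \<Union>\<C>"
proof -
  have "C \<inter> \<Union>\<C> = C" if "C \<in> \<C>" for C
    using that by blast
  then have "openin (coherent_topology \<C>) (\<Union>\<C>)"
    by (simp add: openin_coherent_topology)
  then show ?thesis
    by (metis openin_coherent_topology openin_subset openin_topspace subset_antisym)
qed

lemma closedin_coherent_topology: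
  "closedin (coherent_topology \<C>) K \<longleftrightarrow> K \<subseteq> \<Union>\<C> \<and> (\<forall>C\<in>\<C>. closedin (top_of_set C) (C \<inter> K))"
proof -
  have "C \<inter> (\<Union>\<C> - K) = C - C \<inter> K" if "C \<in> \<C>" for C
    using that by blast
  then show ?thesis
    by (auto simp: closedin_def openin_coherent_topology)
qed

lemma realization_eq_coherent_topology:
  "realization S = coherent_topology (geo_simplex ` S)"
proof -
  have "openin (realization S) U \<longleftrightarrow> openin (coherent_topology (geo_simplex ` S)) U" for U
    unfolding openin_realization openin_coherent_topology by simp
  then show ?thesis
    unfolding topology_eq by blast
qed

lemma continuous_map_from_coherent:
  assumes "\<And>C. C \<in> \<C> \<Longrightarrow> continuous_map (top_of_set C) Y f"
  shows "continuous_map (coherent_topology \<C>) Y f"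
  unfolding continuous_map_def
proof (intro conjI allI impI)
  show "f \<in> topspace (coherent_topology \<C>) \<rightarrow> topspace Y"
    using assms by (fastforce simp: continuous_map_def)
next
  fix U assume "openin Y U"
  then have "openin (top_of_set C) {x \<in> C. f x \<in> U}" if "C \<in> \<C>" for C
    using assms[OF that] by (auto simp: continuous_map_def)
  moreover have "C \<inter> {x \<in> \<Union>\<C>. f x \<in> U} = {x \<in> C. f x \<in> U}" if "C \<in> \<C>" for C
    using that by blast
  ultimately show "openin (coherent_topology \<C>) {x \<in> topspace (coherent_topology \<C>). f x \<in> U}"
    by (auto simp: openin_coherent_topology)
qed

text \<open>A product with a coherent topology need not be coherent with the products of the cells; it is
  if the other factor is locally compact. The reason is the tube lemma: if \<open>M\<close> is compact, the
  points \<open>y\<close> with \<open>M \<times> {y}\<close> inside the preimage of an open set form a set that is open in each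
  cell.\<close>

lemma continuous_map_from_prod_coherent:
  assumes T: "neighbourhood_base_of (compactin T) T"
    and h: "\<And>C. C \<in> \<C> \<Longrightarrow> continuous_map (prod_topology T (top_of_set C)) Y h"
  shows "continuous_map (prod_topology T (coherent_topology \<C>)) Y h"
  unfolding continuous_map_def
proof (intro conjI allI impI)
  show "h \<in> topspace (prod_topology T (coherent_topology \<C>)) \<rightarrow> topspace Y"
    using h by (fastforce simp: continuous_map_def)
next
  fix W assume W: "openin Y W"
  define G where "G = {p \<in> topspace T \<times> \<Union>\<C>. h p \<in> W}"
  have G_cell: "openin (prod_topology T (top_of_set C)) {p \<in> topspace T \<times> C. h p \<in> W}"
    if "C \<in> \<C>" for C
    using h[OF that] W by (auto simp: continuous_map_def)
  have "\<exists>U V. openin T U \<and> openin (coherent_topology \<C>) V \<and> t \<in> U \<and> x \<in> V \<and> U \<times> V \<subseteq> G"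
    if tx: "(t, x) \<in> G" for t x
  proof -
    obtain C where C: "C \<in> \<C>" "x \<in> C" and t: "t \<in> topspace T" "h (t, x) \<in> W"
      using tx by (auto simp: G_def)
    then have "(t, x) \<in> {p \<in> topspace T \<times> C. h p \<in> W}"
      by simp
    then obtain U\<^sub>0 V\<^sub>0 where U\<^sub>0: "openin T U\<^sub>0" "t \<in> U\<^sub>0" "x \<in> V\<^sub>0"
      "U\<^sub>0 \<times> V\<^sub>0 \<subseteq> {p \<in> topspace T \<times> C. h p \<in> W}"
      using G_cell[OF C(1), unfolded openin_prod_topology_alt] by meson
    obtain U M where M: "openin T U" "compactin T M" "t \<in> U" "U \<subseteq> M" "M \<subseteq> U\<^sub>0"
      using T U\<^sub>0(1,2) unfolding neighbourhood_base_of by meson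
    (* The largest V with M \<times> V \<subseteq> G; that it is open is the content of the tube lemma. *)
    define V where "V = {y \<in> \<Union>\<C>. M \<times> {y} \<subseteq> G}"
    have "openin (top_of_set D) (D \<inter> V)" if D: "D \<in> \<C>" for D
    proof (subst openin_subopen, intro ballI)
      fix y assume y: "y \<in> D \<inter> V"
      then have "M \<times> {y} \<subseteq> {p \<in> topspace T \<times> D. h p \<in> W}"
        by (auto simp: V_def G_def)
      then obtain U' V' where *: "openin (top_of_set D) V'" "M \<subseteq> U'" "y \<in> V'"
        "U' \<times> V' \<subseteq> {p \<in> topspace T \<times> D. h p \<in> W}"
        using tube_lemma_left[OF G_cell[OF D] M(2), of y] y by auto
      have "M \<times> V' \<subseteq> {p \<in> topspace T \<times> D. h p \<in> W}" "V' \<subseteq> D"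
        using *(2,4) openin_imp_subset[OF *(1)] by blast+
      then have "V' \<subseteq> D \<inter> V"
        using D by (auto simp: V_def G_def)
      then show "\<exists>V'. openin (top_of_set D) V' \<and> y \<in> V' \<and> V' \<subseteq> D \<inter> V"
        using * by blast
    qed
    then have "openin (coherent_topology \<C>) V"
      by (auto simp: openin_coherent_topology V_def)
    moreover have "x \<in> V"
      using U\<^sub>0 M C by (fastforce simp: V_def G_def)
    moreover have "U \<times> V \<subseteq> G"
      using M by (auto simp: V_def)
    ultimately show ?thesis
      using M by blast
  qed
  then show "openin (prod_topology T (coherent_topology \<C>))
    {p \<in> topspace (prod_topology T (coherent_topology \<C>)). h p \<in> W}"
    by (auto simp: openin_prod_topology_alt G_def)
qed

text \<open>This makes the preceding lemma applicable to homotopies.\<close>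

lemma neighbourhood_base_compact_interval:
  "neighbourhood_base_of (compactin (top_of_set {a..b::real})) (top_of_set {a..b})"
proof -
  have "locally_compact_space (top_of_set {a..b})"
    by (simp add: compact_imp_locally_compact_space compact_space_subtopology)
  then show ?thesis
    by (simp add: locally_compact_Hausdorff_or_regular Hausdorff_space_subtopology
        locally_compact_space_neighbourhood_base)
qed

text \<open>The preimage of a closed set is a union of closed sets, one for each closed cell that the map
  meets; with infinitely many cells it could fail to be closed.\<close>

lemma continuous_map_into_coherent:
  assumes "\<And>D. D \<in> \<D> \<Longrightarrow> closed D" and f: "continuous_map Z euclidean f"
    and "\<F> \<subseteq> \<D>" "finite \<F>" "f ` topspace Z \<subseteq> \<Union>\<F>"
  shows "continuous_map Z (coherent_topology \<D>) f"
  unfolding continuous_map_closedin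
proof (intro conjI allI impI)
  show "f \<in> topspace Z \<rightarrow> topspace (coherent_topology \<D>)"
    using assms(3,5) by (simp add: image_subset_iff_funcset[symmetric]) blast
next
  fix K assume K: "closedin (coherent_topology \<D>) K"
  have "closedin Z {x \<in> topspace Z. f x \<in> D \<inter> K}" if "D \<in> \<F>" for D
  proof -
    have "closed (D \<inter> K)"
      using that assms(1,3) K by (meson closedin_closed_trans closedin_coherent_topology subsetD)
    then show ?thesis
      using f unfolding continuous_map_closedin by (metis closed_closedin)
  qed
  then have "closedin Z (\<Union>D\<in>\<F>. {x \<in> topspace Z. f x \<in> D \<inter> K})"
    using assms(4) by (intro closedin_Union) auto
  moreover have "{x \<in> topspace Z. f x \<in> K} = (\<Union>D\<in>\<F>. {x \<in> topspace Z. f x \<in> D \<inter> K})"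
    using assms(5) by blast
  ultimately show "closedin Z {x \<in> topspace Z. f x \<in> K}"
    by simp
qed

text \<open>A subspace of a coherent space need not be coherent with smaller cells. A closed subset of the
  subcomplex remains closed in the whole space if each big cell meets the subcomplex in finitely many
  small ones, again because finite unions of closed sets are closed.\<close>

lemma subtopology_coherent_topology:
  assumes "\<D> \<subseteq> \<C>"
    and closed: "\<And>D. D \<in> \<D> \<Longrightarrow> closed D"
    and cover: "\<And>C. C \<in> \<C> \<Longrightarrow> \<exists>\<F>\<subseteq>\<D>. finite \<F> \<and> C \<inter> \<Union>\<D> \<subseteq> \<Union>\<F>"
  shows "subtopology (coherent_topology \<C>) (\<Union>\<D>) = coherent_topology \<D>"
proof -
  have "closedin (subtopology (coherent_topology \<C>) (\<Union>\<D>)) K \<longleftrightarrow> closedin (coherent_topology \<D>) K" for K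
  proof
    assume "closedin (subtopology (coherent_topology \<C>) (\<Union>\<D>)) K"
    then obtain L where L: "closedin (coherent_topology \<C>) L" "K = L \<inter> \<Union>\<D>"
      by (auto simp: closedin_subtopology)
    have "closedin (top_of_set D) (D \<inter> K)" if "D \<in> \<D>" for D
    proof -
      have "D \<inter> K = D \<inter> L"
        using that L by blast
      then show ?thesis
        using that L assms(1) by (auto simp: closedin_coherent_topology)
    qed
    then show "closedin (coherent_topology \<D>) K"
      using L by (auto simp: closedin_coherent_topology)
  next
    assume K: "closedin (coherent_topology \<D>) K"
    then have KD: "K \<subseteq> \<Union>\<D>"
      by (simp add: closedin_coherent_topology)
    have "closedin (top_of_set C) (C \<inter> K)" if C: "C \<in> \<C>" for C
    proof -
      obtain \<F> where \<F>: "\<F> \<subseteq> \<D>" "finite \<F>" "C \<inter> \<Union>\<D> \<subseteq> \<Union>\<F>"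
        using cover[OF C] by meson
      have "closed (D \<inter> K)" if "D \<in> \<F>" for D
        using that \<F> K closed by (meson closedin_closed_trans closedin_coherent_topology subsetD)
      then have "closed (\<Union>D\<in>\<F>. D \<inter> K)"
        using \<F>(2) by (intro closed_UN) auto
      moreover have "(\<Union>D\<in>\<F>. D \<inter> K) = \<Union>\<F> \<inter> K"
        by (rule Int_Union2[symmetric])
      moreover have "C \<inter> K = C \<inter> (Q \<inter> K)" if "C \<inter> P \<subseteq> Q" "K \<subseteq> P" for P Q
        using that by blast
      then have "C \<inter> K = C \<inter> (\<Union>\<F> \<inter> K)"
        using \<F>(3) KD by metis
      ultimately show ?thesis
        using closedin_closed_Int[of "\<Union>\<F> \<inter> K" C] by (simp only:)
    qed
    then have "closedin (coherent_topology \<C>) K"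
      unfolding closedin_coherent_topology
      using subset_trans[OF KD Union_mono[OF assms(1)]] by (intro conjI ballI)
    then show "closedin (subtopology (coherent_topology \<C>) (\<Union>\<D>)) K"
      using KD unfolding closedin_subtopology by (metis Int_absorb2)
  qed
  moreover have "topspace (subtopology (coherent_topology \<C>) (\<Union>\<D>)) = topspace (coherent_topology \<D>)"
    using Union_mono[OF assms(1)]
    by (simp only: topspace_subtopology topspace_coherent_topology Int_absorb1)
  ultimately show ?thesis
    unfolding topology_eq openin_closedin_eq by (simp only: simp_thms)
qed

lemma subtopology_coherent_cell:
  assumes "C \<in> \<C>" "closed C"
  shows "subtopology (coherent_topology \<C>) C = top_of_set C"
proof -
  have "subtopology (coherent_topology \<C>) (\<Union>{C}) = coherent_topology {C}"
    using assms by (intro subtopology_coherent_topology) auto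
  moreover have "openin (coherent_topology {C}) U \<longleftrightarrow> openin (top_of_set C) U" for U
    using openin_imp_subset[of euclidean C U] by (auto simp: openin_coherent_topology Int_absorb1)
  ultimately show ?thesis
    by (simp add: topology_eq)
qed

text \<open>K-ification tests openness on all compact sets, and cofinally many of them suffice.\<close>

lemma kification_eq_coherent:
  assumes "\<And>C. C \<in> \<C> \<Longrightarrow> compactin X C"
    and "\<And>K. compactin X K \<Longrightarrow> K \<noteq> {} \<Longrightarrow> \<exists>C\<in>\<C>. K \<subseteq> C"
    and "\<And>C. C \<in> \<C> \<Longrightarrow> subtopology X C = top_of_set C"
  shows "kification X = coherent_topology \<C>"
  unfolding topology_eq
proof
  fix U
  have top: "topspace X = \<Union>\<C>"
  proof
    show "\<Union>\<C> \<subseteq> topspace X"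
      using assms(1) compactin_subset_topspace by blast
    show "topspace X \<subseteq> \<Union>\<C>"
    proof
      fix x assume "x \<in> topspace X"
      then have "compactin X {x}"
        by simp
      then obtain C where "C \<in> \<C>" "{x} \<subseteq> C"
        using assms(2)[of "{x}"] by blast
      then show "x \<in> \<Union>\<C>"
        by blast
    qed
  qed
  have "openin (subtopology X K) (K \<inter> U)"
    if U: "\<forall>C\<in>\<C>. openin (top_of_set C) (C \<inter> U)" and compact: "compactin X K" for K
  proof (cases "K = {}")
    case False
    obtain C where C: "C \<in> \<C>" "K \<subseteq> C"
      using assms(2)[OF compact False] by meson
    then have "openin (subtopology X C) (C \<inter> U)"
      using U assms(3) by auto
    then obtain V where "openin X V" "C \<inter> U = V \<inter> C"
      by (auto simp: openin_subtopology)
    then have "openin X V" "K \<inter> U = V \<inter> K"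
      using C(2) by blast+
    then show ?thesis
      by (auto simp: openin_subtopology)
  qed simp
  then show "openin (kification X) U = openin (coherent_topology \<C>) U"
    unfolding openin_kification openin_coherent_topology top
    using assms(1,3) by metis
qed


section \<open>Barycentric coordinates\<close>

definition supp :: "('a \<Rightarrow> real) \<Rightarrow> 'a set" where
  "supp x = {a. x a \<noteq> 0}"

definition barycentric :: "('a \<Rightarrow> real) \<Rightarrow> bool" where
  "barycentric x \<longleftrightarrow> (\<forall>a. 0 \<le> x a) \<and> finite (supp x) \<and> (\<Sum>a\<in>supp x. x a) = 1"

lemma not_in_supp: "a \<notin> supp x \<Longrightarrow> x a = 0"
  by (simp add: supp_def)

lemma barycentricD:
  assumes "barycentric x"
  shows "0 \<le> x a" "finite (supp x)" "supp x \<noteq> {}"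
  using assms by (auto simp: barycentric_def)

lemma sum_over_supp:
  assumes "finite F" "supp x \<subseteq> F" "\<And>a. x a = 0 \<Longrightarrow> f a = 0"
  shows "(\<Sum>a\<in>supp x. f a) = (\<Sum>a\<in>F. f a)"
  using assms by (intro sum.mono_neutral_left) (auto simp: supp_def)

lemma barycentric_sum:
  assumes "barycentric x" "finite F" "supp x \<subseteq> F"
  shows "(\<Sum>a\<in>F. x a) = 1"
  using assms sum_over_supp[of F x x] by (simp add: barycentric_def)

lemma barycentricI:
  assumes "\<And>a. 0 \<le> x a" "finite F" "supp x \<subseteq> F" "(\<Sum>a\<in>F. x a) = 1"
  shows "barycentric x"
  using assms sum_over_supp[of F x x] by (auto simp: barycentric_def intro: finite_subset)

lemma geo_simplex_iff:
  assumes "finite \<sigma>"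
  shows "x \<in> geo_simplex \<sigma> \<longleftrightarrow> barycentric x \<and> supp x \<subseteq> \<sigma>"
proof
  assume "x \<in> geo_simplex \<sigma>"
  then obtain t where t: "x = (\<lambda>j. \<Sum>i\<in>\<sigma>. t i * \<epsilon> i j)" "\<forall>i\<in>\<sigma>. 0 \<le> t i" "sum t \<sigma> = 1"
    by (auto simp: geo_simplex_def)
  have x: "x = (\<lambda>j. if j \<in> \<sigma> then t j else 0)"
    using assms by (simp add: t(1) vertex_def if_distrib cong: if_cong)
  have "sum x \<sigma> = 1"
    using t(3) by (simp add: x cong: sum.cong)
  moreover have "supp x \<subseteq> \<sigma>"
    by (auto simp: x supp_def)
  moreover have "0 \<le> x a" for a
    using t(2) by (simp add: x)
  ultimately show "barycentric x \<and> supp x \<subseteq> \<sigma>"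
    using assms barycentricI by metis
next
  assume x: "barycentric x \<and> supp x \<subseteq> \<sigma>"
  have "x = (\<lambda>j. \<Sum>i\<in>\<sigma>. x i * \<epsilon> i j)"
    using assms x by (auto simp: fun_eq_iff vertex_def if_distrib supp_def cong: if_cong)
  then show "x \<in> geo_simplex \<sigma>"
    unfolding geo_simplex_def using x assms barycentric_sum[of x \<sigma>] barycentricD(1)[of x] by blast
qed

lemma in_geo_simplex_supp: "barycentric x \<Longrightarrow> x \<in> geo_simplex (supp x)"
  by (simp add: geo_simplex_iff barycentricD(2))

lemma geo_simplexD:
  assumes "x \<in> geo_simplex \<sigma>" "\<sigma> \<in> Simp A"
  shows "barycentric x" "supp x \<subseteq> \<sigma>"
  using assms by (auto simp: Simp_def geo_simplex_iff)

lemma continuous_on_coordinate [continuous_intros]: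
  "continuous_on A (\<lambda>x :: 'a \<Rightarrow> real. x i)"
  by (rule continuous_on_subset[OF continuous_on_product_coordinates]) simp

lemma compact_geo_simplex:
  assumes "finite \<sigma>"
  shows "compact (geo_simplex \<sigma>)"
proof -
  let ?box = "\<Pi>\<^sub>E i\<in>UNIV. if i \<in> \<sigma> then {0..1::real} else {0}"
  have "compactin (product_topology (\<lambda>i. euclidean) UNIV) ?box"
    by (simp add: compactin_PiE)
  then have "compact ?box"
    by (simp add: euclidean_product_topology)
  moreover have "closed {x :: 'a \<Rightarrow> real. (\<Sum>a\<in>\<sigma>. x a) = 1}"
    by (intro closed_Collect_eq continuous_intros)
  moreover have "geo_simplex \<sigma> = ?box \<inter> {x. (\<Sum>a\<in>\<sigma>. x a) = 1}"
  proof (intro equalityI subsetI)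
    fix x assume "x \<in> geo_simplex \<sigma>"
    then have x: "barycentric x" "supp x \<subseteq> \<sigma>"
      using assms by (auto simp: geo_simplex_iff)
    then have "x a \<le> 1" if "a \<in> \<sigma>" for a
      using barycentric_sum[OF _ assms] member_le_sum[of a \<sigma> x] that assms barycentricD(1) by metis
    then show "x \<in> ?box \<inter> {x. (\<Sum>a\<in>\<sigma>. x a) = 1}"
      using x barycentric_sum[OF x(1) assms] barycentricD(1)[OF x(1)]
      by (auto simp: PiE_iff supp_def)
  next
    fix x assume x: "x \<in> ?box \<inter> {x. (\<Sum>a\<in>\<sigma>. x a) = 1}"
    then have "x a \<in> (if a \<in> \<sigma> then {0..1} else {0})" for a
      by (simp add: PiE_iff)
    then have "0 \<le> x a" "a \<notin> \<sigma> \<Longrightarrow> x a = 0" for a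
      by (metis atLeastAtMost_iff order_refl singletonD)+
    then show "x \<in> geo_simplex \<sigma>"
      using x assms by (auto simp: geo_simplex_iff supp_def intro!: barycentricI[of x \<sigma>]) metis
  qed
  ultimately show ?thesis
    by (simp add: compact_Int_closed)
qed

lemma closed_geo_simplex:
  assumes "finite \<sigma>"
  shows "closed (geo_simplex \<sigma>)"
proof -
  have "supp x \<subseteq> \<sigma> \<longleftrightarrow> (\<forall>a\<in>- \<sigma>. x a = 0)" for x :: "'a \<Rightarrow> real"
    by (auto simp: supp_def)
  then have "geo_simplex \<sigma> =
      (\<Inter>a. {x. 0 \<le> x a}) \<inter> (\<Inter>a\<in>- \<sigma>. {x. x a = 0}) \<inter> {x. (\<Sum>a\<in>\<sigma>. x a) = 1}"
    using assms barycentricI[of _ \<sigma>]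
    by (auto simp: geo_simplex_iff barycentricD(1) barycentric_sum simp del: Compl_iff)
  then show ?thesis
    by (auto intro!: closed_Int closed_INT closed_Collect_le closed_Collect_eq continuous_intros)
qed

lemma finite_in_Simp: "\<sigma> \<in> Simp A \<Longrightarrow> finite \<sigma>"
  by (simp add: Simp_def)

lemma finite_simplex: "simplicial_complex A S \<Longrightarrow> \<sigma> \<in> S \<Longrightarrow> finite \<sigma>"
  by (auto simp: simplicial_complex_def Simp_def)

lemma face_in_complex:
  "simplicial_complex A S \<Longrightarrow> \<sigma> \<in> S \<Longrightarrow> \<tau> \<subseteq> \<sigma> \<Longrightarrow> \<tau> \<noteq> {} \<Longrightarrow> \<tau> \<in> S"
  unfolding simplicial_complex_def Simp_def by (blast intro: finite_subset)

lemma simplicial_complex_Simp: "simplicial_complex A (Simp A)"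
  by (simp add: simplicial_complex_def)

lemma points_of_complex:
  assumes "simplicial_complex A S"
  shows "x \<in> \<Union>(geo_simplex ` S) \<longleftrightarrow> barycentric x \<and> supp x \<in> S"
proof
  assume "x \<in> \<Union>(geo_simplex ` S)"
  then show "barycentric x \<and> supp x \<in> S"
    using assms barycentricD(3)[of x]
    by (auto simp: geo_simplex_iff finite_simplex[OF assms] intro: face_in_complex)
next
  assume "barycentric x \<and> supp x \<in> S"
  then show "x \<in> \<Union>(geo_simplex ` S)"
    using in_geo_simplex_supp by blast
qed

text \<open>If a set contained points involving infinitely many vertices \<open>v 0, v 1, \<dots>\<close>, then a linear
  functional with sufficiently large coefficients at the \<open>v n\<close> would be unbounded on it; but every
  linear functional is continuous for the coherent topology.\<close>

lemma compactin_realization_finite_support: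
  assumes S: "simplicial_complex A S" and K: "compactin (realization S) K"
  shows "finite (\<Union>x\<in>K. supp x)"
proof (rule ccontr)
  assume "infinite (\<Union>x\<in>K. supp x)"
  then obtain v :: "nat \<Rightarrow> 'a" where v: "inj v" "range v \<subseteq> (\<Union>x\<in>K. supp x)"
    using infinite_countable_subset by blast
  then have "\<exists>x\<in>K. v n \<in> supp x" for n
    by blast
  then obtain x where x: "\<And>n. x n \<in> K" "\<And>n. v n \<in> supp (x n)"
    by metis
  have points: "barycentric y" "supp y \<in> S" if "y \<in> K" for y
    using that compactin_subset_topspace[OF K] points_of_complex[OF S, of y] by auto
  have pos: "0 < x n (v n)" for n
    using x(2)[of n] barycentricD(1)[OF points(1)[OF x(1)], of n "v n"] by (simp add: supp_def)
  (* Chosen so that the coordinate v n alone contributes n at the point x n. *)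
  define c where "c a = (if a \<in> range v then real (inv v a) / x (inv v a) a else 0)" for a
  have c_nonneg: "0 \<le> c a" for a
    using pos v(1) by (auto simp: c_def intro!: divide_nonneg_pos)
  define \<phi> where "\<phi> y = (\<Sum>a\<in>supp y. c a * y a)" for y
  have "continuous_map (realization S) euclideanreal \<phi>"
    unfolding realization_eq_coherent_topology
  proof (rule continuous_map_from_coherent)
    fix C assume "C \<in> geo_simplex ` S"
    then obtain \<sigma> where \<sigma>: "\<sigma> \<in> S" "C = geo_simplex \<sigma>" "finite \<sigma>"
      using finite_simplex[OF S] by blast
    have "continuous_on C (\<lambda>y. \<Sum>a\<in>\<sigma>. c a * y a)"
      by (intro continuous_intros)
    moreover have "\<phi> y = (\<Sum>a\<in>\<sigma>. c a * y a)" if "y \<in> C" for y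
      unfolding \<phi>_def using that \<sigma> by (intro sum_over_supp) (auto simp: geo_simplex_iff)
    ultimately show "continuous_map (top_of_set C) euclideanreal \<phi>"
      by (simp cong: continuous_on_cong)
  qed
  then have "compact (\<phi> ` K)"
    using image_compactin[OF K] compactin_euclidean_iff by blast
  then obtain b where b: "\<And>y. y \<in> K \<Longrightarrow> \<phi> y \<le> b"
    by (meson bounded_imp_bdd_above compact_imp_bounded bdd_above.E imageI)
  have "real n \<le> \<phi> (x n)" for n
  proof -
    have "real n = c (v n) * x n (v n)"
      using pos[of n] v(1) by (simp add: c_def)
    also have "\<dots> \<le> \<phi> (x n)"
      unfolding \<phi>_def using x(2)[of n] barycentricD(1,2)[OF points(1)[OF x(1)[of n]]] c_nonneg
      by (intro member_le_sum[of "v n" "supp (x n)" "\<lambda>a. c a * x n a"]) auto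
    finally show ?thesis .
  qed
  then have "real n \<le> b" for n
    using b x(1) order_trans by blast
  then show False
    using reals_Archimedean2[of b] by (metis not_le)
qed

lemma compactin_full_realization:
  assumes K: "compactin (realization (Simp A)) K" and "K \<noteq> {}"
  shows "\<exists>\<sigma>\<in>Simp A. K \<subseteq> geo_simplex \<sigma>"
proof
  let ?\<sigma> = "\<Union>x\<in>K. supp x"
  have fin: "finite ?\<sigma>"
    by (rule compactin_realization_finite_support[OF simplicial_complex_Simp K])
  have points: "barycentric x \<and> supp x \<in> Simp A" if "x \<in> K" for x
    using that compactin_subset_topspace[OF K] points_of_complex[OF simplicial_complex_Simp, of x A]
    by auto
  then show "?\<sigma> \<in> Simp A"
    using fin assms(2) by (auto simp: Simp_def)
  show "K \<subseteq> geo_simplex ?\<sigma>"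
    using points by (auto simp: geo_simplex_iff[OF fin])
qed

lemma geo_simplex_in_realization:
  assumes "simplicial_complex A S" "\<sigma> \<in> S"
  shows "compactin (realization S) (geo_simplex \<sigma>)"
    and "subtopology (realization S) (geo_simplex \<sigma>) = top_of_set (geo_simplex \<sigma>)"
proof -
  have "finite \<sigma>"
    using assms by (rule finite_simplex)
  show sub: "subtopology (realization S) (geo_simplex \<sigma>) = top_of_set (geo_simplex \<sigma>)"
    unfolding realization_eq_coherent_topology using assms(2) closed_geo_simplex[OF \<open>finite \<sigma>\<close>]
    by (intro subtopology_coherent_cell) auto
  show "compactin (realization S) (geo_simplex \<sigma>)"
    unfolding compactin_subspace sub
    using assms(2) compact_geo_simplex[OF \<open>finite \<sigma>\<close>]
    by (auto simp: compact_space_subtopology)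
qed


section \<open>Prod-complexes as coherent spaces\<close>

definition prod_complex2 :: "'i set \<Rightarrow> 'j set \<Rightarrow> ('i set \<times> 'j set) set \<Rightarrow> bool" where
  "prod_complex2 I J P \<longleftrightarrow> P \<subseteq> Simp I \<times> Simp J \<and>
     (\<forall>(\<sigma>, \<tau>)\<in>P. \<forall>\<sigma>'\<in>Simp I. \<forall>\<tau>'\<in>Simp J. \<sigma>' \<subseteq> \<sigma> \<and> \<tau>' \<subseteq> \<tau> \<longrightarrow> (\<sigma>', \<tau>') \<in> P)"

definition prod_complex3 :: "'i set \<Rightarrow> 'j set \<Rightarrow> 'k set \<Rightarrow> ('i set \<times> 'j set \<times> 'k set) set \<Rightarrow> bool"
  where
  "prod_complex3 I J K P \<longleftrightarrow> P \<subseteq> Simp I \<times> Simp J \<times> Simp K \<and>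
     (\<forall>(\<sigma>, \<tau>, \<upsilon>)\<in>P. \<forall>\<sigma>'\<in>Simp I. \<forall>\<tau>'\<in>Simp J. \<forall>\<upsilon>'\<in>Simp K.
        \<sigma>' \<subseteq> \<sigma> \<and> \<tau>' \<subseteq> \<tau> \<and> \<upsilon>' \<subseteq> \<upsilon> \<longrightarrow> (\<sigma>', \<tau>', \<upsilon>') \<in> P)"

definition cells2 :: "('i set \<times> 'j set) set \<Rightarrow> (('i \<Rightarrow> real) \<times> ('j \<Rightarrow> real)) set set" where
  "cells2 P = (\<lambda>(\<sigma>, \<tau>). geo_simplex \<sigma> \<times> geo_simplex \<tau>) ` P"

definition cells3 ::
  "('i set \<times> 'j set \<times> 'k set) set \<Rightarrow> (('i \<Rightarrow> real) \<times> ('j \<Rightarrow> real) \<times> ('k \<Rightarrow> real)) set set" where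
  "cells3 P = (\<lambda>(\<sigma>, \<tau>, \<upsilon>). geo_simplex \<sigma> \<times> geo_simplex \<tau> \<times> geo_simplex \<upsilon>) ` P"

lemma supp_in_Simp:
  assumes "barycentric x" "supp x \<subseteq> \<sigma>" "\<sigma> \<in> Simp A"
  shows "supp x \<in> Simp A"
  using assms barycentricD(2,3)[OF assms(1)] by (auto simp: Simp_def)

lemma face_in_prod_complex2:
  assumes "prod_complex2 I J P" "(\<sigma>, \<tau>) \<in> P"
    and "\<sigma>' \<in> Simp I" "\<tau>' \<in> Simp J" "\<sigma>' \<subseteq> \<sigma>" "\<tau>' \<subseteq> \<tau>"
  shows "(\<sigma>', \<tau>') \<in> P"
  using assms unfolding prod_complex2_def by fast

lemma face_in_prod_complex3:
  assumes "prod_complex3 I J K P" "(\<sigma>, \<tau>, \<upsilon>) \<in> P"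
    and "\<sigma>' \<in> Simp I" "\<tau>' \<in> Simp J" "\<upsilon>' \<in> Simp K" "\<sigma>' \<subseteq> \<sigma>" "\<tau>' \<subseteq> \<tau>" "\<upsilon>' \<subseteq> \<upsilon>"
  shows "(\<sigma>', \<tau>', \<upsilon>') \<in> P"
  using assms unfolding prod_complex3_def by fast

lemma points_of_cells2:
  assumes P: "prod_complex2 I J P"
  shows "(x, y) \<in> \<Union>(cells2 P) \<longleftrightarrow> barycentric x \<and> barycentric y \<and> (supp x, supp y) \<in> P"
proof
  assume "(x, y) \<in> \<Union>(cells2 P)"
  then obtain \<sigma> \<tau> where *: "(\<sigma>, \<tau>) \<in> P" "x \<in> geo_simplex \<sigma>" "y \<in> geo_simplex \<tau>"
    by (auto simp: cells2_def)
  then have "\<sigma> \<in> Simp I" "\<tau> \<in> Simp J"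
    using P by (auto simp: prod_complex2_def)
  moreover from this have
    "barycentric x" "barycentric y" "supp x \<subseteq> \<sigma>" "supp y \<subseteq> \<tau>"
    using * geo_simplexD by metis+
  ultimately show "barycentric x \<and> barycentric y \<and> (supp x, supp y) \<in> P"
    using face_in_prod_complex2[OF P *(1)] supp_in_Simp by metis
next
  assume "barycentric x \<and> barycentric y \<and> (supp x, supp y) \<in> P"
  then show "(x, y) \<in> \<Union>(cells2 P)"
    by (auto simp: cells2_def in_geo_simplex_supp intro!: bexI[of _ "(supp x, supp y)"])
qed

lemma points_of_cells3:
  assumes P: "prod_complex3 I J K P"
  shows "(x, y, z) \<in> \<Union>(cells3 P) \<longleftrightarrow>
    barycentric x \<and> barycentric y \<and> barycentric z \<and> (supp x, supp y, supp z) \<in> P"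
proof
  assume "(x, y, z) \<in> \<Union>(cells3 P)"
  then obtain \<sigma> \<tau> \<upsilon> where *: "(\<sigma>, \<tau>, \<upsilon>) \<in> P"
    "x \<in> geo_simplex \<sigma>" "y \<in> geo_simplex \<tau>" "z \<in> geo_simplex \<upsilon>"
    by (auto simp: cells3_def)
  then have "\<sigma> \<in> Simp I" "\<tau> \<in> Simp J" "\<upsilon> \<in> Simp K"
    using P by (auto simp: prod_complex3_def)
  moreover from this have
    "barycentric x" "barycentric y" "barycentric z" "supp x \<subseteq> \<sigma>" "supp y \<subseteq> \<tau>" "supp z \<subseteq> \<upsilon>"
    using * geo_simplexD by metis+
  ultimately show
    "barycentric x \<and> barycentric y \<and> barycentric z \<and> (supp x, supp y, supp z) \<in> P"
    using face_in_prod_complex3[OF P *(1)] supp_in_Simp by metis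
next
  assume "barycentric x \<and> barycentric y \<and> barycentric z \<and> (supp x, supp y, supp z) \<in> P"
  then show "(x, y, z) \<in> \<Union>(cells3 P)"
    by (auto simp: cells3_def in_geo_simplex_supp intro!: bexI[of _ "(supp x, supp y, supp z)"])
qed

lemma closed_cells2:
  assumes "P \<subseteq> Simp I \<times> Simp J" "C \<in> cells2 P"
  shows "closed C"
  using assms by (auto simp: cells2_def intro!: closed_Times closed_geo_simplex dest: finite_in_Simp)

lemma closed_cells3:
  assumes "P \<subseteq> Simp I \<times> Simp J \<times> Simp K" "C \<in> cells3 P"
  shows "closed C"
  using assms by (auto simp: cells3_def intro!: closed_Times closed_geo_simplex dest: finite_in_Simp)

text \<open>Compact subsets of a product have compact projections and hence lie in a product of finite
  simplices, so the products of simplices are cofinal among the compact sets.\<close>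

lemma kification_realization2:
  "kification (prod_topology (realization (Simp I)) (realization (Simp J))) =
     coherent_topology (cells2 (Simp I \<times> Simp J))" (is "kification ?X = _")
proof (rule kification_eq_coherent)
  fix C assume "C \<in> cells2 (Simp I \<times> Simp J)"
  then obtain \<sigma> \<tau> where C: "\<sigma> \<in> Simp I" "\<tau> \<in> Simp J" "C = geo_simplex \<sigma> \<times> geo_simplex \<tau>"
    by (auto simp: cells2_def)
  show "compactin ?X C"
    using C by (simp add: compactin_Times geo_simplex_in_realization[OF simplicial_complex_Simp])
  show "subtopology ?X C = top_of_set C"
    using C by (simp add: subtopology_Times
        geo_simplex_in_realization[OF simplicial_complex_Simp])
next
  fix K assume K: "compactin ?X K" "K \<noteq> {}"
  then obtain \<sigma> \<tau> where "\<sigma> \<in> Simp I" "fst ` K \<subseteq> geo_simplex \<sigma>" "\<tau> \<in> Simp J" "snd ` K \<subseteq> geo_simplex \<tau>"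
    using compactin_full_realization[OF image_compactin[OF K(1) continuous_map_fst]]
      compactin_full_realization[OF image_compactin[OF K(1) continuous_map_snd]] by auto
  then have "geo_simplex \<sigma> \<times> geo_simplex \<tau> \<in> cells2 (Simp I \<times> Simp J)"
      "K \<subseteq> geo_simplex \<sigma> \<times> geo_simplex \<tau>"
    by (auto simp: cells2_def)
  then show "\<exists>C\<in>cells2 (Simp I \<times> Simp J). K \<subseteq> C"
    by blast
qed

lemma kification_realization3:
  "kification (prod_topology (realization (Simp I))
       (prod_topology (realization (Simp J)) (realization (Simp K)))) =
     coherent_topology (cells3 (Simp I \<times> Simp J \<times> Simp K))" (is "kification ?X = _")
proof (rule kification_eq_coherent)
  fix C assume "C \<in> cells3 (Simp I \<times> Simp J \<times> Simp K)"
  then obtain \<sigma> \<tau> \<upsilon> where C: "\<sigma> \<in> Simp I" "\<tau> \<in> Simp J" "\<upsilon> \<in> Simp K"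
    "C = geo_simplex \<sigma> \<times> geo_simplex \<tau> \<times> geo_simplex \<upsilon>"
    by (auto simp: cells3_def)
  show "compactin ?X C"
    using C by (simp add: compactin_Times geo_simplex_in_realization[OF simplicial_complex_Simp])
  show "subtopology ?X C = top_of_set C"
    using C by (simp add: subtopology_Times
        geo_simplex_in_realization[OF simplicial_complex_Simp])
next
  fix L assume L: "compactin ?X L" "L \<noteq> {}"
  have maps: "continuous_map ?X (realization (Simp I)) fst"
    "continuous_map ?X (realization (Simp J)) (fst \<circ> snd)"
    "continuous_map ?X (realization (Simp K)) (snd \<circ> snd)"
    by (auto intro: continuous_map_fst continuous_map_compose continuous_map_snd)
  then obtain \<sigma> \<tau> \<upsilon> where "\<sigma> \<in> Simp I" "fst ` L \<subseteq> geo_simplex \<sigma>"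
    "\<tau> \<in> Simp J" "(fst \<circ> snd) ` L \<subseteq> geo_simplex \<tau>"
    "\<upsilon> \<in> Simp K" "(snd \<circ> snd) ` L \<subseteq> geo_simplex \<upsilon>"
    using compactin_full_realization[OF image_compactin[OF L(1) maps(1)]]
      compactin_full_realization[OF image_compactin[OF L(1) maps(2)]]
      compactin_full_realization[OF image_compactin[OF L(1) maps(3)]] L(2) by (metis image_is_empty)
  then have "geo_simplex \<sigma> \<times> geo_simplex \<tau> \<times> geo_simplex \<upsilon> \<in> cells3 (Simp I \<times> Simp J \<times> Simp K)"
      "L \<subseteq> geo_simplex \<sigma> \<times> geo_simplex \<tau> \<times> geo_simplex \<upsilon>"
    by (auto simp: cells3_def image_subset_iff)
  then show "\<exists>C\<in>cells3 (Simp I \<times> Simp J \<times> Simp K). L \<subseteq> C"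
    by blast
qed

text \<open>A simplex of the full product meets a prod-complex in the union of those of its finitely many faces
  that belong to the prod-complex.\<close>

lemma realization2_eq_coherent_topology:
  assumes P: "prod_complex2 I J P"
  shows "realization2 I J P = coherent_topology (cells2 P)"
proof -
  have sub: "P \<subseteq> Simp I \<times> Simp J"
    using P by (simp add: prod_complex2_def)
  have "subtopology (coherent_topology (cells2 (Simp I \<times> Simp J))) (\<Union>(cells2 P)) =
      coherent_topology (cells2 P)"
  proof (rule subtopology_coherent_topology)
    show "cells2 P \<subseteq> cells2 (Simp I \<times> Simp J)"
      using sub by (auto simp: cells2_def)
    fix C assume "C \<in> cells2 (Simp I \<times> Simp J)"
    then obtain \<sigma> \<tau> where C: "\<sigma> \<in> Simp I" "\<tau> \<in> Simp J" "C = geo_simplex \<sigma> \<times> geo_simplex \<tau>"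
      by (auto simp: cells2_def)
    let ?F = "P \<inter> (Pow \<sigma> \<times> Pow \<tau>)"
    have "C \<inter> \<Union>(cells2 P) \<subseteq> \<Union>(cells2 ?F)"
    proof
      fix p assume p: "p \<in> C \<inter> \<Union>(cells2 P)"
      obtain x y where xyz: "p = (x, y)"
        by (metis surj_pair)
      then have "(x, y) \<in> \<Union>(cells2 P)" "x \<in> geo_simplex \<sigma>" "y \<in> geo_simplex \<tau>"
        using p C by auto
      then have "(x, y) \<in> \<Union>(cells2 ?F)"
        using C geo_simplexD(2)[of x \<sigma> I] geo_simplexD(2)[of y \<tau> J] unfolding points_of_cells2[OF P]
        by (auto simp: cells2_def in_geo_simplex_supp intro!: bexI[of _ "(supp x, supp y)"])
      then show "p \<in> \<Union>(cells2 ?F)"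
        by (simp only: xyz)
    qed
    moreover have "finite ?F" "cells2 ?F \<subseteq> cells2 P"
      using C by (auto simp: cells2_def finite_in_Simp)
    ultimately show "\<exists>\<F>\<subseteq>cells2 P. finite \<F> \<and> C \<inter> \<Union>(cells2 P) \<subseteq> \<Union>\<F>"
      by (intro exI[of _ "cells2 ?F"]) (simp add: cells2_def)
  qed (rule closed_cells2[OF sub])
  then show ?thesis
    by (simp add: realization2_def kification_realization2 cells2_def split_def)
qed

lemma realization3_eq_coherent_topology:
  assumes P: "prod_complex3 I J K P"
  shows "realization3 I J K P = coherent_topology (cells3 P)"
proof -
  have sub: "P \<subseteq> Simp I \<times> Simp J \<times> Simp K"
    using P by (simp add: prod_complex3_def)
  have "subtopology (coherent_topology (cells3 (Simp I \<times> Simp J \<times> Simp K))) (\<Union>(cells3 P)) =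
      coherent_topology (cells3 P)"
  proof (rule subtopology_coherent_topology)
    show "cells3 P \<subseteq> cells3 (Simp I \<times> Simp J \<times> Simp K)"
      using sub by (auto simp: cells3_def)
    fix C assume "C \<in> cells3 (Simp I \<times> Simp J \<times> Simp K)"
    then obtain \<sigma> \<tau> \<upsilon> where C: "\<sigma> \<in> Simp I" "\<tau> \<in> Simp J" "\<upsilon> \<in> Simp K"
      "C = geo_simplex \<sigma> \<times> geo_simplex \<tau> \<times> geo_simplex \<upsilon>"
      by (auto simp: cells3_def)
    let ?F = "P \<inter> (Pow \<sigma> \<times> Pow \<tau> \<times> Pow \<upsilon>)"
    have "C \<inter> \<Union>(cells3 P) \<subseteq> \<Union>(cells3 ?F)"
    proof
      fix p assume p: "p \<in> C \<inter> \<Union>(cells3 P)"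
      obtain x y z where xyz: "p = (x, y, z)"
        by (metis surj_pair)
      then have "(x, y, z) \<in> \<Union>(cells3 P)" "x \<in> geo_simplex \<sigma>" "y \<in> geo_simplex \<tau>" "z \<in> geo_simplex \<upsilon>"
        using p C by auto
      then have "(x, y, z) \<in> \<Union>(cells3 ?F)"
        using C geo_simplexD(2)[of x \<sigma> I] geo_simplexD(2)[of y \<tau> J] geo_simplexD(2)[of z \<upsilon> K]
        unfolding points_of_cells3[OF P]
        by (auto simp: cells3_def in_geo_simplex_supp
            intro!: bexI[of _ "(supp x, supp y, supp z)"])
      then show "p \<in> \<Union>(cells3 ?F)"
        by (simp only: xyz)
    qed
    moreover have "finite ?F" "cells3 ?F \<subseteq> cells3 P"
      using C by (auto simp: cells3_def finite_in_Simp)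
    ultimately show "\<exists>\<F>\<subseteq>cells3 P. finite \<F> \<and> C \<inter> \<Union>(cells3 P) \<subseteq> \<Union>\<F>"
      by (intro exI[of _ "cells3 ?F"]) (simp add: cells3_def)
  qed (rule closed_cells3[OF sub])
  then show ?thesis
    by (simp add: realization3_def kification_realization3 cells3_def split_def)
qed


section \<open>Maps that are continuous on each cell\<close>

text \<open>Continuity here refers to the topology of pointwise convergence, which is coarser than the topology of
  a realization. Confining the image of each cell to finitely many vertices makes up for the difference.\<close>

definition tame :: "'x::topological_space set set \<Rightarrow> ('x \<Rightarrow> 'a \<Rightarrow> real) \<Rightarrow> bool" where
  "tame \<C> f \<longleftrightarrow>
     (\<forall>C\<in>\<C>. continuous_on C f \<and> (\<exists>F. finite F \<and> (\<forall>x\<in>C. supp (f x) \<subseteq> F)))"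

lemma tameE:
  assumes "tame \<C> f" "C \<in> \<C>"
  obtains F where "finite F" "\<And>x. x \<in> C \<Longrightarrow> supp (f x) \<subseteq> F" "continuous_on C f"
  using assms by (auto simp: tame_def)

lemma tame_subset: "tame \<D> f \<Longrightarrow> \<C> \<subseteq> \<D> \<Longrightarrow> tame \<C> f"
  by (auto simp: tame_def)

lemma tame_compose:
  assumes f: "tame \<C> f" "\<And>x. x \<in> \<Union>\<C> \<Longrightarrow> barycentric (f x)"
    and u: "tame (geo_simplex ` Collect finite) u"
  shows "tame \<C> (\<lambda>x. u (f x))"
  unfolding tame_def
proof
  fix C assume C: "C \<in> \<C>"
  obtain F where F: "finite F" "\<And>x. x \<in> C \<Longrightarrow> supp (f x) \<subseteq> F" "continuous_on C f"
    using f(1) C by (rule tameE) blast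
  then have "geo_simplex F \<in> geo_simplex ` Collect finite"
    by blast
  then obtain G where G: "finite G" "\<And>x. x \<in> geo_simplex F \<Longrightarrow> supp (u x) \<subseteq> G"
    "continuous_on (geo_simplex F) u"
    using tameE[OF u] by metis
  have "f ` C \<subseteq> geo_simplex F"
    using F f(2)[OF UnionI[OF C]] by (simp add: geo_simplex_iff image_subset_iff)
  then show "continuous_on C (\<lambda>x. u (f x)) \<and> (\<exists>F. finite F \<and> (\<forall>x\<in>C. supp (u (f x)) \<subseteq> F))"
    using G(1,2) continuous_on_compose2[OF G(3) F(3)] by blast
qed

lemma tame_cell_coordinates2:
  assumes "P \<subseteq> Simp I \<times> Simp J"
  shows "tame (cells2 P) fst" "tame (cells2 P) snd"
proof -
  have "continuous_on C fst \<and> (\<exists>F. finite F \<and> (\<forall>v\<in>C. supp (fst v) \<subseteq> F)) \<and>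
      continuous_on C snd \<and> (\<exists>F. finite F \<and> (\<forall>v\<in>C. supp (snd v) \<subseteq> F))"
    if C: "C \<in> cells2 P" for C
  proof -
    obtain \<sigma> \<tau> where \<sigma>: "(\<sigma>, \<tau>) \<in> P" "C = geo_simplex \<sigma> \<times> geo_simplex \<tau>"
      using C by (auto simp: cells2_def)
    then have fin: "finite \<sigma>" "finite \<tau>"
      using assms \<sigma>(1) by (auto dest: finite_in_Simp)
    then have "\<forall>v\<in>C. supp (fst v) \<subseteq> \<sigma> \<and> supp (snd v) \<subseteq> \<tau>"
      by (simp add: \<sigma>(2) geo_simplex_iff)
    then show ?thesis
      unfolding \<sigma>(2) using fin by (intro conjI exI[of _ \<sigma>] exI[of _ \<tau>] continuous_intros) auto
  qed
  then show "tame (cells2 P) fst" "tame (cells2 P) snd"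
    unfolding tame_def by blast+
qed

lemma tame_cell_coordinates3:
  assumes "P \<subseteq> Simp I \<times> Simp J \<times> Simp K"
  shows "tame (cells3 P) fst" "tame (cells3 P) (\<lambda>v. fst (snd v))" "tame (cells3 P) (\<lambda>v. snd (snd v))"
proof -
  have "continuous_on C fst \<and> (\<exists>F. finite F \<and> (\<forall>v\<in>C. supp (fst v) \<subseteq> F)) \<and>
      continuous_on C (\<lambda>v. fst (snd v)) \<and> (\<exists>F. finite F \<and> (\<forall>v\<in>C. supp (fst (snd v)) \<subseteq> F)) \<and>
      continuous_on C (\<lambda>v. snd (snd v)) \<and> (\<exists>F. finite F \<and> (\<forall>v\<in>C. supp (snd (snd v)) \<subseteq> F))"
    if C: "C \<in> cells3 P" for C
  proof -
    obtain \<sigma> \<tau> \<upsilon> where \<sigma>: "(\<sigma>, \<tau>, \<upsilon>) \<in> P"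
      "C = geo_simplex \<sigma> \<times> geo_simplex \<tau> \<times> geo_simplex \<upsilon>"
      using C by (auto simp: cells3_def)
    then have fin: "finite \<sigma>" "finite \<tau>" "finite \<upsilon>"
      using assms \<sigma>(1) by (auto dest: finite_in_Simp)
    then have "\<forall>v\<in>C. supp (fst v) \<subseteq> \<sigma> \<and> supp (fst (snd v)) \<subseteq> \<tau> \<and> supp (snd (snd v)) \<subseteq> \<upsilon>"
      by (simp add: \<sigma>(2) geo_simplex_iff)
    then show ?thesis
      using fin by (intro conjI exI[of _ \<sigma>] exI[of _ \<tau>] exI[of _ \<upsilon>] continuous_intros) blast+
  qed
  then show "tame (cells3 P) fst" "tame (cells3 P) (\<lambda>v. fst (snd v))"
    "tame (cells3 P) (\<lambda>v. snd (snd v))"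
    unfolding tame_def by blast+
qed

lemma tame_id: "tame (geo_simplex ` Collect finite) (\<lambda>x. x)"
  unfolding tame_def
proof (clarify, intro conjI)
  fix F :: "'a set" assume "finite F"
  then show "\<exists>G. finite G \<and> (\<forall>x\<in>geo_simplex F. supp x \<subseteq> G)"
    by (intro exI[of _ F]) (simp add: geo_simplex_iff)
qed (rule continuous_on_id)

lemma geo_simplices_finite: "simplicial_complex A S \<Longrightarrow> geo_simplex ` S \<subseteq> geo_simplex ` Collect finite"
  using finite_simplex by blast

lemma continuous_map_into_realization:
  assumes S: "simplicial_complex A S" and "continuous_map Z euclidean f" and F: "finite F"
    and f: "\<And>z. z \<in> topspace Z \<Longrightarrow> barycentric (f z) \<and> supp (f z) \<in> S \<and> supp (f z) \<subseteq> F"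
  shows "continuous_map Z (realization S) f"
  unfolding realization_eq_coherent_topology
proof (rule continuous_map_into_coherent)
  show "f ` topspace Z \<subseteq> \<Union>(geo_simplex ` (S \<inter> Pow F))"
    using f in_geo_simplex_supp by fast
qed (use assms closed_geo_simplex finite_simplex[OF S] in auto)

lemma continuous_map_into_realization2:
  assumes P: "prod_complex2 I J P"
    and "continuous_map Z euclidean f" "continuous_map Z euclidean g" and F: "finite F" "finite G"
    and fg: "\<And>z. z \<in> topspace Z \<Longrightarrow> barycentric (f z) \<and> barycentric (g z) \<and>
      (supp (f z), supp (g z)) \<in> P \<and> supp (f z) \<subseteq> F \<and> supp (g z) \<subseteq> G"
  shows "continuous_map Z (realization2 I J P) (\<lambda>z. (f z, g z))"
  unfolding realization2_eq_coherent_topology[OF P]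
proof (rule continuous_map_into_coherent)
  show "closed C" if "C \<in> cells2 P" for C
    using closed_cells2[OF _ that] P unfolding prod_complex2_def by fast
  show "continuous_map Z euclidean (\<lambda>z. (f z, g z))"
    using continuous_map_pairedI[OF assms(2,3)] by simp
  show "(\<lambda>z. (f z, g z)) ` topspace Z \<subseteq> \<Union>(cells2 (P \<inter> (Pow F \<times> Pow G)))"
  proof clarify
    fix z assume "z \<in> topspace Z"
    then show "(f z, g z) \<in> \<Union>(cells2 (P \<inter> (Pow F \<times> Pow G)))"
      using fg[of z]
      by (auto simp: cells2_def in_geo_simplex_supp intro!: bexI[of _ "(supp (f z), supp (g z))"])
  qed
qed (use F in \<open>auto simp: cells2_def\<close>)

lemma continuous_map_into_realization3:
  assumes P: "prod_complex3 I J K P"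
    and "continuous_map Z euclidean f" "continuous_map Z euclidean g" "continuous_map Z euclidean h"
    and F: "finite F" "finite G" "finite H"
    and fgh: "\<And>z. z \<in> topspace Z \<Longrightarrow> barycentric (f z) \<and> barycentric (g z) \<and> barycentric (h z) \<and>
      (supp (f z), supp (g z), supp (h z)) \<in> P \<and>
      supp (f z) \<subseteq> F \<and> supp (g z) \<subseteq> G \<and> supp (h z) \<subseteq> H"
  shows "continuous_map Z (realization3 I J K P) (\<lambda>z. (f z, g z, h z))"
  unfolding realization3_eq_coherent_topology[OF P]
proof (rule continuous_map_into_coherent)
  show "closed C" if "C \<in> cells3 P" for C
    using closed_cells3[OF _ that] P unfolding prod_complex3_def by fast
  show "continuous_map Z euclidean (\<lambda>z. (f z, g z, h z))"
    using continuous_map_pairedI[OF assms(2) continuous_map_pairedI[OF assms(3,4)]] by simp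
  show "(\<lambda>z. (f z, g z, h z)) ` topspace Z \<subseteq> \<Union>(cells3 (P \<inter> (Pow F \<times> Pow G \<times> Pow H)))"
  proof clarify
    fix z assume "z \<in> topspace Z"
    then show "(f z, g z, h z) \<in> \<Union>(cells3 (P \<inter> (Pow F \<times> Pow G \<times> Pow H)))"
      using fgh[of z]
      by (auto simp: cells3_def in_geo_simplex_supp intro!: bexI[of _ "(supp (f z), supp (g z), supp (h z))"])
  qed
qed (use F in \<open>auto simp: cells3_def\<close>)

lemma tame_continuous_map:
  assumes S: "simplicial_complex A S" and f: "tame \<C> f"
    and points: "\<And>x. x \<in> \<Union>\<C> \<Longrightarrow> barycentric (f x) \<and> supp (f x) \<in> S"
  shows "continuous_map (coherent_topology \<C>) (realization S) f"
proof (rule continuous_map_from_coherent)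
  fix C assume C: "C \<in> \<C>"
  obtain F where "finite F" "\<And>x. x \<in> C \<Longrightarrow> supp (f x) \<subseteq> F" "continuous_on C f"
    using f C by (rule tameE) blast
  then show "continuous_map (top_of_set C) (realization S) f"
    using points C by (intro continuous_map_into_realization[OF S]) auto
qed

lemma tame_continuous_map2:
  assumes P: "prod_complex2 I J P" and f: "tame \<C> f" and g: "tame \<C> g"
    and points: "\<And>x. x \<in> \<Union>\<C> \<Longrightarrow>
      barycentric (f x) \<and> barycentric (g x) \<and> (supp (f x), supp (g x)) \<in> P"
  shows "continuous_map (coherent_topology \<C>) (realization2 I J P) (\<lambda>x. (f x, g x))"
proof (rule continuous_map_from_coherent)
  fix C assume C: "C \<in> \<C>"
  obtain F where "finite F" "\<And>x. x \<in> C \<Longrightarrow> supp (f x) \<subseteq> F" "continuous_on C f"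
    using f C by (rule tameE) blast
  moreover obtain G where "finite G" "\<And>x. x \<in> C \<Longrightarrow> supp (g x) \<subseteq> G" "continuous_on C g"
    using g C by (rule tameE) blast
  ultimately show "continuous_map (top_of_set C) (realization2 I J P) (\<lambda>x. (f x, g x))"
    using points[OF UnionI[OF C]] by (intro continuous_map_into_realization2[OF P, where F = F and G = G]) simp_all
qed

lemma tame_continuous_map3:
  assumes P: "prod_complex3 I J K P" and f: "tame \<C> f" and g: "tame \<C> g" and h: "tame \<C> h"
    and points: "\<And>x. x \<in> \<Union>\<C> \<Longrightarrow>
      barycentric (f x) \<and> barycentric (g x) \<and> barycentric (h x) \<and>
      (supp (f x), supp (g x), supp (h x)) \<in> P"
  shows "continuous_map (coherent_topology \<C>) (realization3 I J K P) (\<lambda>x. (f x, g x, h x))"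
proof (rule continuous_map_from_coherent)
  fix C assume C: "C \<in> \<C>"
  obtain F where "finite F" "\<And>x. x \<in> C \<Longrightarrow> supp (f x) \<subseteq> F" "continuous_on C f"
    using f C by (rule tameE) blast
  moreover obtain G where "finite G" "\<And>x. x \<in> C \<Longrightarrow> supp (g x) \<subseteq> G" "continuous_on C g"
    using g C by (rule tameE) blast
  moreover obtain H where "finite H" "\<And>x. x \<in> C \<Longrightarrow> supp (h x) \<subseteq> H" "continuous_on C h"
    using h C by (rule tameE) blast
  ultimately show "continuous_map (top_of_set C) (realization3 I J K P) (\<lambda>x. (f x, g x, h x))"
    using points[OF UnionI[OF C]] by (intro continuous_map_into_realization3[OF P, where F = F and G = G and H = H]) simp_all
qed

lemma barycentric_convex_combination:
  assumes x: "barycentric x" and y: "barycentric y" and t: "0 \<le> t" "t \<le> 1"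
  shows "barycentric (\<lambda>a. (1 - t) * x a + t * y a)"
proof (rule barycentricI)
  let ?F = "supp x \<union> supp y"
  show "finite ?F"
    using x y by (simp add: barycentricD)
  then show "(\<Sum>a\<in>?F. (1 - t) * x a + t * y a) = 1"
    using barycentric_sum[OF x, of ?F] barycentric_sum[OF y, of ?F]
    by (simp add: sum.distrib flip: sum_distrib_left)
  show "0 \<le> (1 - t) * x a + t * y a" for a
    using t by (simp add: barycentricD(1)[OF x] barycentricD(1)[OF y])
qed (auto simp: supp_def)

text \<open>The straight-line homotopy: the segment between \<open>f x\<close> and \<open>g x\<close> stays in the simplex that contains
  both points.\<close>

lemma tame_homotopic:
  assumes S: "simplicial_complex A S" and f: "tame (geo_simplex ` U) f" and g: "tame (geo_simplex ` U) g"
    and points: "\<And>x. x \<in> \<Union>(geo_simplex ` U) \<Longrightarrow> barycentric (f x) \<and> barycentric (g x)"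
    and joint: "\<And>x. x \<in> \<Union>(geo_simplex ` U) \<Longrightarrow> \<exists>\<sigma>\<in>S. supp (f x) \<subseteq> \<sigma> \<and> supp (g x) \<subseteq> \<sigma>"
  shows "homotopic_with (\<lambda>_. True) (realization U) (realization S) f g"
  unfolding homotopic_with_def realization_eq_coherent_topology[of U]
proof (intro exI conjI allI ballI)
  let ?h = "\<lambda>(t, x) a. (1 - t) * f x a + t * g x a"
  show "continuous_map (prod_topology (top_of_set {0..1}) (coherent_topology (geo_simplex ` U))) (realization S) ?h"
  proof (rule continuous_map_from_prod_coherent[OF neighbourhood_base_compact_interval])
    fix C assume C: "C \<in> geo_simplex ` U"
    obtain F where F: "finite F" "\<And>x. x \<in> C \<Longrightarrow> supp (f x) \<subseteq> F" "continuous_on C f"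
      using f C by (rule tameE) blast
    obtain G where G: "finite G" "\<And>x. x \<in> C \<Longrightarrow> supp (g x) \<subseteq> G" "continuous_on C g"
      using g C by (rule tameE) blast
    have supp_h: "supp (?h (t, x)) \<subseteq> supp (f x) \<union> supp (g x)" for t x
      by (auto simp: supp_def)
    show "continuous_map (prod_topology (top_of_set {0..1}) (top_of_set C)) (realization S) ?h"
    proof (rule continuous_map_into_realization[OF S])
      have "continuous_on ({0..1::real} \<times> C) (\<lambda>p. f (snd p))" "continuous_on ({0..1::real} \<times> C) (\<lambda>p. g (snd p))"
        by (rule continuous_on_compose2[OF F(3) continuous_on_snd[OF continuous_on_id]]
            continuous_on_compose2[OF G(3) continuous_on_snd[OF continuous_on_id]]; force)+
      then have "continuous_on ({0..1::real} \<times> C) (\<lambda>p. f (snd p) a)"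
        "continuous_on ({0..1::real} \<times> C) (\<lambda>p. g (snd p) a)" for a
        by (auto intro: continuous_on_product_then_coordinatewise[where i = a])
      then have "continuous_on ({0..1} \<times> C) ?h"
        unfolding split_def by (intro continuous_intros)
      then show "continuous_map (prod_topology (top_of_set {0..1}) (top_of_set C)) euclidean ?h"
        by simp
      show "finite (F \<union> G)"
        using F G by simp
      fix p assume "p \<in> topspace (prod_topology (top_of_set {0..1::real}) (top_of_set C))"
      then obtain t x where p: "p = (t, x)" "0 \<le> t" "t \<le> 1" "x \<in> C"
        by (cases p) auto
      then have "x \<in> \<Union>(geo_simplex ` U)"
        using C by blast
      then have b: "barycentric (?h p)"
        using p points barycentric_convex_combination[of "f x" "g x" t] by simp
      obtain \<sigma> where "\<sigma> \<in> S" "supp (f x) \<subseteq> \<sigma>" "supp (g x) \<subseteq> \<sigma>"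
        using joint[OF \<open>x \<in> \<Union>(geo_simplex ` U)\<close>] by blast
      then have "supp (?h p) \<in> S"
        using face_in_complex[OF S, of \<sigma> "supp (?h p)"] supp_h[of t x] barycentricD(3)[OF b] p by blast
      moreover have "supp (?h p) \<subseteq> F \<union> G"
        using supp_h[of t x] F(2)[OF p(4)] G(2)[OF p(4)] p(1) by blast
      ultimately show "barycentric (?h p) \<and> supp (?h p) \<in> S \<and> supp (?h p) \<subseteq> F \<union> G"
        using b by blast
    qed
  qed
qed auto


section \<open>Simplicial maps and product measures\<close>

lemma realization_map_apply:
  assumes "finite F" "supp z \<subseteq> F"
  shows "realization_map g z a = (\<Sum>c\<in>{c \<in> F. g c = a}. z c)"
proof -
  have "realization_map g z a = (\<Sum>c\<in>supp z. z c * \<epsilon> (g c) a)"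
    by (simp add: realization_map_def lin_ext_def supp_def)
  also have "\<dots> = (\<Sum>c\<in>F. z c * \<epsilon> (g c) a)"
    using assms by (intro sum_over_supp) auto
  also have "\<dots> = (\<Sum>c\<in>F. if g c = a then z c else 0)"
    by (intro sum.cong) (auto simp: vertex_def)
  also have "\<dots> = (\<Sum>c\<in>{c \<in> F. g c = a}. z c)"
    using assms(1) by (simp add: sum.inter_filter)
  finally show ?thesis .
qed

lemma supp_realization_map:
  assumes "barycentric z"
  shows "supp (realization_map g z) = g ` supp z"
proof -
  have "realization_map g z a = 0 \<longleftrightarrow> (\<forall>c\<in>{c \<in> supp z. g c = a}. z c = 0)" for a
    using barycentricD[OF assms] by (simp add: realization_map_apply sum_nonneg_eq_0_iff)
  then show ?thesis
    by (auto simp: supp_def)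
qed

lemma barycentric_realization_map:
  assumes "barycentric z"
  shows "barycentric (realization_map g z)"
proof (rule barycentricI)
  note z = barycentricD[OF assms]
  show "finite (g ` supp z)" "supp (realization_map g z) \<subseteq> g ` supp z"
    using z by (simp_all add: supp_realization_map[OF assms])
  show "0 \<le> realization_map g z a" for a
    using z by (simp add: realization_map_apply sum_nonneg)
  have "(\<Sum>a\<in>g ` supp z. realization_map g z a) = (\<Sum>c\<in>supp z. z c)"
    using z by (simp add: realization_map_apply flip: sum.image_gen)
  then show "(\<Sum>a\<in>g ` supp z. realization_map g z a) = 1"
    using assms by (simp add: barycentric_def)
qed

lemma realization_map_id: "finite (supp z) \<Longrightarrow> realization_map id z = z"
proof
  fix a assume "finite (supp z)"
  moreover have "{c \<in> supp z. id c = a} = (if z a = 0 then {} else {a})"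
    by (auto simp: supp_def)
  ultimately show "realization_map id z a = z a"
    by (simp add: realization_map_apply[of "supp z"])
qed

lemma realization_map_comp:
  assumes z: "barycentric z"
  shows "realization_map (g \<circ> f) z = realization_map g (realization_map f z)"
proof
  fix a
  let ?F = "supp z"
  have fin: "finite ?F"
    using z by (rule barycentricD)
  have "realization_map g (realization_map f z) a =
      (\<Sum>b\<in>{b \<in> f ` ?F. g b = a}. \<Sum>c\<in>{c \<in> ?F. f c = b}. z c)"
    using fin by (simp add: realization_map_apply[of "f ` ?F"] supp_realization_map[OF z]
        realization_map_apply[of ?F])
  also have "\<dots> = (\<Sum>b\<in>f ` {c \<in> ?F. g (f c) = a}. \<Sum>c\<in>{c \<in> {c \<in> ?F. g (f c) = a}. f c = b}. z c)"
    by (intro sum.cong) (auto intro!: sum.cong)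
  also have "\<dots> = (\<Sum>c\<in>{c \<in> ?F. g (f c) = a}. z c)"
    using fin sum.image_gen[of "{c \<in> ?F. g (f c) = a}" z f] by simp
  finally show "realization_map (g \<circ> f) z a = realization_map g (realization_map f z) a"
    using fin by (simp add: realization_map_apply[of ?F])
qed

lemma tame_realization_map: "tame (geo_simplex ` Collect finite) (realization_map g)"
  unfolding tame_def
proof (clarify, intro conjI)
  fix F :: "'a set" assume F: "finite F"
  have *: "realization_map g z = (\<lambda>a. \<Sum>c\<in>{c \<in> F. g c = a}. z c)" if "z \<in> geo_simplex F" for z
    using that F by (auto simp: geo_simplex_iff realization_map_apply)
  have "continuous_on (geo_simplex F) (\<lambda>z a. \<Sum>c\<in>{c \<in> F. g c = a}. z c)"
    by (intro continuous_intros)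
  then show "continuous_on (geo_simplex F) (realization_map g)"
    using * by (simp cong: continuous_on_cong)
  show "\<exists>G. finite G \<and> (\<forall>x\<in>geo_simplex F. supp (realization_map g x) \<subseteq> G)"
    using F by (intro exI[of _ "g ` F"]) (simp add: geo_simplex_iff supp_realization_map image_mono)
qed

lemma continuous_map_realization_map:
  assumes "simplicial_map A S B T g"
  shows "continuous_map (realization S) (realization T) (realization_map g)"
  unfolding realization_eq_coherent_topology[of S]
proof (rule tame_continuous_map)
  show T: "simplicial_complex B T"
    using assms by (simp add: simplicial_map_def)
  have S: "simplicial_complex A S"
    using assms by (simp add: simplicial_map_def)
  show "tame (geo_simplex ` S) (realization_map g)"
    using tame_realization_map geo_simplices_finite[OF S] by (rule tame_subset)
  show "barycentric (realization_map g x) \<and> supp (realization_map g x) \<in> T"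
    if "x \<in> \<Union>(geo_simplex ` S)" for x
    using that assms points_of_complex[OF S, of x] unfolding simplicial_map_def
    by (simp add: barycentric_realization_map supp_realization_map)
qed

text \<open>An element \<open>c\<close> stands for the pair \<open>(p c, q c)\<close>. Keeping the projections abstract covers pairs, pairs
  with the factors exchanged, and triples bracketed in either way; a block is then a product of sets,
  and \<open>tensor\<close> below a product measure.\<close>

definition block :: "('c \<Rightarrow> 'a) \<Rightarrow> ('c \<Rightarrow> 'b) \<Rightarrow> 'a set \<Rightarrow> 'b set \<Rightarrow> 'c set" where
  "block p q F G = {c. p c \<in> F \<and> q c \<in> G}"

definition tensor ::
  "('c \<Rightarrow> 'a) \<Rightarrow> ('c \<Rightarrow> 'b) \<Rightarrow> ('a \<Rightarrow> real) \<Rightarrow> ('b \<Rightarrow> real) \<Rightarrow> 'c \<Rightarrow> real" where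
  "tensor p q x y = (\<lambda>c. x (p c) * y (q c))"

lemma supp_tensor: "supp (tensor p q x y) = block p q (supp x) (supp y)"
  by (auto simp: supp_def tensor_def block_def)

context
  fixes p :: "'c \<Rightarrow> 'a" and q :: "'c \<Rightarrow> 'b"
  assumes bij: "bij (\<lambda>c. (p c, q c))"
begin

lemma bij_betw_block: "bij_betw (\<lambda>c. (p c, q c)) (block p q F G) (F \<times> G)"
proof -
  have "block p q F G = (\<lambda>c. (p c, q c)) -` (F \<times> G)"
    by (auto simp: block_def)
  then show ?thesis
    using bij by (auto simp: bij_betw_def surj_image_vimage_eq intro: inj_on_subset)
qed

lemma finite_block: "finite F \<Longrightarrow> finite G \<Longrightarrow> finite (block p q F G)"
  using bij_betw_finite[OF bij_betw_block] by (metis finite_cartesian_product)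

lemma image_block:
  "G \<noteq> {} \<Longrightarrow> p ` block p q F G = F" "F \<noteq> {} \<Longrightarrow> q ` block p q F G = G"
proof -
  have *: "(\<lambda>c. (p c, q c)) ` block p q F G = F \<times> G"
    using bij_betw_block by (rule bij_betw_imp_surj_on)
  have "p ` block p q F G = fst ` (F \<times> G)" "q ` block p q F G = snd ` (F \<times> G)"
    unfolding *[symmetric] by (simp_all add: image_image)
  then show "G \<noteq> {} \<Longrightarrow> p ` block p q F G = F" "F \<noteq> {} \<Longrightarrow> q ` block p q F G = G"
    by auto
qed

lemma sum_block: "(\<Sum>c\<in>block p q F G. x (p c) * y (q c)) = (\<Sum>a\<in>F. x a) * (\<Sum>b\<in>G. y b :: real)"
proof -
  have "(\<Sum>c\<in>block p q F G. x (p c) * y (q c)) = (\<Sum>(a, b)\<in>F \<times> G. x a * y b)"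
    using sum.reindex_bij_betw[OF bij_betw_block, of "\<lambda>(a, b). x a * y b"] by simp
  then show ?thesis
    by (simp add: sum_product sum.cartesian_product)
qed

lemma barycentric_tensor:
  assumes x: "barycentric x" and y: "barycentric y"
  shows "barycentric (tensor p q x y)"
proof (rule barycentricI)
  show "finite (block p q (supp x) (supp y))"
    using x y by (simp add: finite_block barycentricD)
  show "(\<Sum>c\<in>block p q (supp x) (supp y). tensor p q x y c) = 1"
    using x y by (simp add: tensor_def sum_block barycentric_def)
  show "0 \<le> tensor p q x y c" for c
    using x y by (simp add: tensor_def barycentricD(1))
qed (simp add: supp_tensor)

lemma realization_map_tensor1:
  assumes x: "barycentric x" and y: "barycentric y"
  shows "realization_map p (tensor p q x y) = x"
proof
  fix a
  let ?B = "block p q (supp x) (supp y)"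
  have "realization_map p (tensor p q x y) a = (\<Sum>c\<in>{c \<in> ?B. p c = a}. tensor p q x y c)"
    using x y by (intro realization_map_apply) (simp_all add: finite_block barycentricD supp_tensor)
  also have "\<dots> = (\<Sum>c\<in>{c \<in> ?B. p c = a}. x (p c) * y (q c))"
    by (simp only: tensor_def)
  also have "{c \<in> ?B. p c = a} = block p q (supp x \<inter> {a}) (supp y)"
    by (auto simp: block_def)
  also have "(\<Sum>c\<in>\<dots>. x (p c) * y (q c)) = (\<Sum>a\<in>supp x \<inter> {a}. x a)"
    using y by (simp add: sum_block barycentric_def)
  also have "\<dots> = x a"
    by (cases "a \<in> supp x") (auto simp: not_in_supp)
  finally show "realization_map p (tensor p q x y) a = x a" .
qed

lemma tame_tensor:
  assumes f: "tame \<C> f" and g: "tame \<C> g"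
  shows "tame \<C> (\<lambda>x. tensor p q (f x) (g x))"
  unfolding tame_def
proof
  fix C assume C: "C \<in> \<C>"
  obtain F where F: "finite F" "\<And>x. x \<in> C \<Longrightarrow> supp (f x) \<subseteq> F" "continuous_on C f"
    using f C by (rule tameE) blast
  obtain G where G: "finite G" "\<And>x. x \<in> C \<Longrightarrow> supp (g x) \<subseteq> G" "continuous_on C g"
    using g C by (rule tameE) blast
  have "continuous_on C (\<lambda>x. tensor p q (f x) (g x))"
    unfolding tensor_def
    by (intro continuous_on_coordinatewise_then_product continuous_on_mult
        continuous_on_product_then_coordinatewise[OF F(3)]
        continuous_on_product_then_coordinatewise[OF G(3)])
  moreover have "\<forall>x\<in>C. supp (tensor p q (f x) (g x)) \<subseteq> block p q F G"
    using F(2) G(2) by (fastforce simp: supp_tensor block_def)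
  ultimately show "continuous_on C (\<lambda>x. tensor p q (f x) (g x)) \<and>
      (\<exists>F. finite F \<and> (\<forall>x\<in>C. supp (tensor p q (f x) (g x)) \<subseteq> F))"
    using finite_block[OF F(1) G(1)] by blast
qed

end

lemma bij_swap_pair:
  assumes "bij (\<lambda>c. (p c, q c))"
  shows "bij (\<lambda>c. (q c, p c))"
proof -
  have "bij (prod.swap \<circ> (\<lambda>c. (p c, q c)))"
    using assms by (intro bij_comp) auto
  then show ?thesis
    by (simp add: o_def)
qed

lemma realization_map_tensor2:
  assumes "bij (\<lambda>c. (p c, q c))" "barycentric x" "barycentric y"
  shows "realization_map q (tensor p q x y) = y"
proof -
  have "tensor p q x y = tensor q p y x"
    by (simp add: tensor_def fun_eq_iff)
  then show ?thesis
    using realization_map_tensor1[OF bij_swap_pair[OF assms(1)] assms(3,2)] by simp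
qed


section \<open>The squashing maps\<close>

lemma squash2_eq: "squash2 z = (realization_map fst z, realization_map snd z)"
  by (simp add: squash2_def realization_map_def split_def)

lemma squash3_eq:
  "squash3 z = (realization_map proj_I z, realization_map (\<lambda>(i, j, k). j) z,
     realization_map (\<lambda>(i, j, k). k) z)"
  by (simp add: squash3_def realization_map_def split_def proj_I_def)

lemma simplicial_complex_of_prod_complex2:
  assumes P: "prod_complex2 I J P"
  shows "simplicial_complex (I \<times> J) {\<rho> \<in> Simp (I \<times> J). (fst ` \<rho>, snd ` \<rho>) \<in> P}"
  unfolding simplicial_complex_def
proof (intro conjI ballI impI)
  fix \<rho> \<tau> assume \<rho>: "\<rho> \<in> {\<rho> \<in> Simp (I \<times> J). (fst ` \<rho>, snd ` \<rho>) \<in> P}" and \<tau>: "\<tau> \<in> Simp (I \<times> J)" "\<tau> \<subseteq> \<rho>"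
  have "fst ` \<tau> \<in> Simp I" "snd ` \<tau> \<in> Simp J"
    using \<tau>(1) by (auto simp: Simp_def)
  then have "(fst ` \<tau>, snd ` \<tau>) \<in> P"
    using face_in_prod_complex2[OF P, of "fst ` \<rho>" "snd ` \<rho>"] \<rho> \<tau>(2) by (simp add: image_mono)
  then show "\<tau> \<in> {\<rho> \<in> Simp (I \<times> J). (fst ` \<rho>, snd ` \<rho>) \<in> P}"
    using \<tau> by blast
qed blast

lemma simplicial_complex_of_prod_complex3:
  assumes P: "prod_complex3 I J K P"
  shows "simplicial_complex (I \<times> J \<times> K)
    {\<rho> \<in> Simp (I \<times> J \<times> K). (fst ` \<rho>, fst ` snd ` \<rho>, snd ` snd ` \<rho>) \<in> P}" (is "simplicial_complex _ ?S")
  unfolding simplicial_complex_def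
proof (intro conjI ballI impI)
  fix \<rho> \<tau> assume \<rho>: "\<rho> \<in> ?S" and \<tau>: "\<tau> \<in> Simp (I \<times> J \<times> K)" "\<tau> \<subseteq> \<rho>"
  have "fst ` \<tau> \<in> Simp I" "fst ` snd ` \<tau> \<in> Simp J" "snd ` snd ` \<tau> \<in> Simp K"
    using \<tau>(1) by (auto simp: Simp_def)
  then have "(fst ` \<tau>, fst ` snd ` \<tau>, snd ` snd ` \<tau>) \<in> P"
    using face_in_prod_complex3[OF P, of "fst ` \<rho>" "fst ` snd ` \<rho>" "snd ` snd ` \<rho>"] \<rho> \<tau>(2)
    by (simp add: image_mono)
  then show "\<tau> \<in> ?S"
    using \<tau> by blast
qed blast

lemma bij_pair: "bij (\<lambda>c. (fst c, snd c))"
  by (simp add: bij_id[unfolded id_def])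

text \<open>The homotopy inverse of the squashing map is the product measure. A point and the product of
  its marginals lie in a common simplex, the full block spanned by the projections.\<close>

lemma squash2_homotopy_inverse:
  assumes P: "prod_complex2 I J P"
  defines "S \<equiv> {\<rho> \<in> Simp (I \<times> J). (fst ` \<rho>, snd ` \<rho>) \<in> P}"
  shows "homotopy_inverse (realization S) (realization2 I J P) squash2
    (\<lambda>v. tensor fst snd (fst v) (snd v))"
  unfolding homotopy_inverse_def
proof (intro conjI)
  have S: "simplicial_complex (I \<times> J) S"
    unfolding S_def using P by (rule simplicial_complex_of_prod_complex2)
  have points_S: "barycentric z \<and> supp z \<in> S" if "z \<in> \<Union>(geo_simplex ` S)" for z
    using that points_of_complex[OF S] by blast
  have sub: "P \<subseteq> Simp I \<times> Simp J"
    using P by (simp add: prod_complex2_def)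
  have block: "block fst snd \<sigma> \<tau> \<in> S" if "(\<sigma>, \<tau>) \<in> P" for \<sigma> \<tau>
  proof -
    have *: "\<sigma> \<in> Simp I" "\<tau> \<in> Simp J"
      using that sub by auto
    have "block fst snd \<sigma> \<tau> = \<sigma> \<times> \<tau>"
      by (auto simp: block_def)
    then show ?thesis
      using * that by (auto simp: S_def Simp_def)
  qed
  have tame_marginals: "tame (geo_simplex ` S) (realization_map fst)" "tame (geo_simplex ` S) (realization_map snd)"
    by (rule tame_subset[OF tame_realization_map geo_simplices_finite[OF S]])+
  show squash: "continuous_map (realization S) (realization2 I J P) squash2"
    unfolding realization_eq_coherent_topology[of S] squash2_eq[abs_def]
    using points_S tame_marginals
    by (intro tame_continuous_map2[OF P])
      (auto simp: barycentric_realization_map supp_realization_map S_def)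
  show tensor: "continuous_map (realization2 I J P) (realization S) (\<lambda>v. tensor fst snd (fst v) (snd v))"
    unfolding realization2_eq_coherent_topology[OF P]
  proof (intro tame_continuous_map[OF S] tame_tensor[OF bij_pair] tame_cell_coordinates2[OF sub])
    fix v assume "v \<in> \<Union>(cells2 P)"
    then have "barycentric (fst v)" "barycentric (snd v)" "(supp (fst v), supp (snd v)) \<in> P"
      using points_of_cells2[OF P, of "fst v" "snd v"] by auto
    then show "barycentric (tensor fst snd (fst v) (snd v)) \<and> supp (tensor fst snd (fst v) (snd v)) \<in> S"
      by (simp add: barycentric_tensor[OF bij_pair] supp_tensor block)
  qed
  show "homotopic_with (\<lambda>_. True) (realization S) (realization S)
      ((\<lambda>v. tensor fst snd (fst v) (snd v)) \<circ> squash2) id"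
    unfolding o_def squash2_eq fst_conv snd_conv id_def
  proof (rule tame_homotopic[OF S])
    show "tame (geo_simplex ` S) (\<lambda>z. tensor fst snd (realization_map fst z) (realization_map snd z))"
      using tame_marginals by (rule tame_tensor[OF bij_pair])
    show "tame (geo_simplex ` S) (\<lambda>z. z)"
      by (rule tame_subset[OF tame_id geo_simplices_finite[OF S]])
    fix z assume "z \<in> \<Union>(geo_simplex ` S)"
    then have z: "barycentric z" "supp z \<in> S"
      using points_S by blast+
    then show "barycentric (tensor fst snd (realization_map fst z) (realization_map snd z)) \<and> barycentric z"
      by (simp add: barycentric_tensor[OF bij_pair] barycentric_realization_map)
    have "supp z \<subseteq> block fst snd (fst ` supp z) (snd ` supp z)"
      by (auto simp: block_def)
    moreover have "block fst snd (fst ` supp z) (snd ` supp z) \<in> S"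
      using z(2) by (intro block) (simp add: S_def)
    ultimately show "\<exists>\<sigma>\<in>S. supp (tensor fst snd (realization_map fst z) (realization_map snd z)) \<subseteq> \<sigma> \<and>
        supp z \<subseteq> \<sigma>"
      using z(1) by (auto simp: supp_tensor supp_realization_map)
  qed
  show "homotopic_with (\<lambda>_. True) (realization2 I J P) (realization2 I J P)
      (squash2 \<circ> (\<lambda>v. tensor fst snd (fst v) (snd v))) id"
  proof (rule homotopic_with_equal)
    show "continuous_map (realization2 I J P) (realization2 I J P)
        (squash2 \<circ> (\<lambda>v. tensor fst snd (fst v) (snd v)))"
      using tensor squash by (rule continuous_map_compose)
    fix v assume "v \<in> topspace (realization2 I J P)"
    then have "barycentric (fst v)" "barycentric (snd v)"
      using points_of_cells2[OF P, of "fst v" "snd v"]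
      by (auto simp: realization2_eq_coherent_topology[OF P])
    then show "(squash2 \<circ> (\<lambda>v. tensor fst snd (fst v) (snd v))) v = id v"
      by (simp add: squash2_eq realization_map_tensor1[OF bij_pair] realization_map_tensor2[OF bij_pair])
  qed auto
qed

lemma squash3_homotopy_inverse:
  assumes P: "prod_complex3 I J K P"
  defines "S \<equiv> {\<rho> \<in> Simp (I \<times> J \<times> K). (fst ` \<rho>, fst ` snd ` \<rho>, snd ` snd ` \<rho>) \<in> P}"
  shows "homotopy_inverse (realization S) (realization3 I J K P) squash3
    (\<lambda>v. tensor fst snd (fst v) (tensor fst snd (fst (snd v)) (snd (snd v))))"
  (is "homotopy_inverse _ _ _ ?t")
  unfolding homotopy_inverse_def
proof (intro conjI)
  have S: "simplicial_complex (I \<times> J \<times> K) S"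
    unfolding S_def using P by (rule simplicial_complex_of_prod_complex3)
  have points_S: "barycentric z \<and> supp z \<in> S" if "z \<in> \<Union>(geo_simplex ` S)" for z
    using that points_of_complex[OF S] by blast
  have points_P: "barycentric (fst v) \<and> barycentric (fst (snd v)) \<and> barycentric (snd (snd v)) \<and>
      (supp (fst v), supp (fst (snd v)), supp (snd (snd v))) \<in> P" if "v \<in> \<Union>(cells3 P)" for v
    using that points_of_cells3[OF P, of "fst v" "fst (snd v)" "snd (snd v)"] by simp
  have sub: "P \<subseteq> Simp I \<times> Simp J \<times> Simp K"
    using P by (simp add: prod_complex3_def)
  let ?b = "\<lambda>\<sigma> \<tau> \<upsilon>. block fst snd \<sigma> (block fst snd \<tau> \<upsilon>)"
  have block: "?b \<sigma> \<tau> \<upsilon> \<in> S" if "(\<sigma>, \<tau>, \<upsilon>) \<in> P" for \<sigma> \<tau> \<upsilon>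
  proof -
    have *: "\<sigma> \<in> Simp I" "\<tau> \<in> Simp J" "\<upsilon> \<in> Simp K"
      using that sub by auto
    have "?b \<sigma> \<tau> \<upsilon> = \<sigma> \<times> \<tau> \<times> \<upsilon>"
      by (auto simp: block_def)
    then show ?thesis
      using * that by (auto simp: S_def Simp_def)
  qed
  define mj :: "('a \<times> 'b \<times> 'c \<Rightarrow> real) \<Rightarrow> 'b \<Rightarrow> real" where "mj = realization_map (\<lambda>(i, j, k). j)"
  define mk :: "('a \<times> 'b \<times> 'c \<Rightarrow> real) \<Rightarrow> 'c \<Rightarrow> real" where "mk = realization_map (\<lambda>(i, j, k). k)"
  define mi :: "('a \<times> 'b \<times> 'c \<Rightarrow> real) \<Rightarrow> 'a \<Rightarrow> real" where "mi = realization_map proj_I"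
  note m_defs = mi_def mj_def mk_def
  have squash_eq: "squash3 z = (mi z, mj z, mk z)" for z
    by (simp add: squash3_eq m_defs)
  have m_bary: "barycentric (mi z)" "barycentric (mj z)" "barycentric (mk z)" if "barycentric z" for z
    using that by (simp_all add: m_defs barycentric_realization_map)
  have m_supp: "supp (mi z) = fst ` supp z" "supp (mj z) = fst ` snd ` supp z"
    "supp (mk z) = snd ` snd ` supp z" if "barycentric z" for z
    using that by (simp_all add: m_defs supp_realization_map image_image split_def proj_I_def)
  have m_tame: "tame (geo_simplex ` S) mi" "tame (geo_simplex ` S) mj" "tame (geo_simplex ` S) mk"
    unfolding m_defs by (rule tame_subset[OF tame_realization_map geo_simplices_finite[OF S]])+
  show squash: "continuous_map (realization S) (realization3 I J K P) squash3"
    unfolding realization_eq_coherent_topology[of S] squash_eq[abs_def]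
    using points_S m_tame
    by (intro tame_continuous_map3[OF P]) (auto simp: m_bary m_supp S_def)
  show tensor: "continuous_map (realization3 I J K P) (realization S) ?t"
    unfolding realization3_eq_coherent_topology[OF P]
  proof (intro tame_continuous_map[OF S] tame_tensor[OF bij_pair] tame_cell_coordinates3[OF sub])
    fix v assume "v \<in> \<Union>(cells3 P)"
    then show "barycentric (?t v) \<and> supp (?t v) \<in> S"
      using points_P[of v] by (simp add: barycentric_tensor[OF bij_pair] supp_tensor block)
  qed
  show "homotopic_with (\<lambda>_. True) (realization S) (realization S) (?t \<circ> squash3) id"
    unfolding o_def squash_eq fst_conv snd_conv id_def
  proof (rule tame_homotopic[OF S])
    show "tame (geo_simplex ` S) (\<lambda>z. tensor fst snd (mi z) (tensor fst snd (mj z) (mk z)))"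
      using m_tame by (intro tame_tensor[OF bij_pair])
    show "tame (geo_simplex ` S) (\<lambda>z. z)"
      by (rule tame_subset[OF tame_id geo_simplices_finite[OF S]])
    fix z assume "z \<in> \<Union>(geo_simplex ` S)"
    then have z: "barycentric z" "supp z \<in> S"
      using points_S by blast+
    then show "barycentric (tensor fst snd (mi z) (tensor fst snd (mj z) (mk z))) \<and> barycentric z"
      by (simp add: barycentric_tensor[OF bij_pair] m_bary)
    have "supp z \<subseteq> ?b (fst ` supp z) (fst ` snd ` supp z) (snd ` snd ` supp z)"
      by (auto simp: block_def)
    moreover have "?b (fst ` supp z) (fst ` snd ` supp z) (snd ` snd ` supp z) \<in> S"
      using z(2) by (intro block) (simp add: S_def)
    ultimately show "\<exists>\<sigma>\<in>S. supp (tensor fst snd (mi z) (tensor fst snd (mj z) (mk z))) \<subseteq> \<sigma> \<and> supp z \<subseteq> \<sigma>"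
      using z(1) by (auto simp: supp_tensor m_supp)
  qed
  show "homotopic_with (\<lambda>_. True) (realization3 I J K P) (realization3 I J K P) (squash3 \<circ> ?t) id"
  proof (rule homotopic_with_equal)
    show "continuous_map (realization3 I J K P) (realization3 I J K P) (squash3 \<circ> ?t)"
      using tensor squash by (rule continuous_map_compose)
    fix v assume "v \<in> topspace (realization3 I J K P)"
    then have v: "barycentric (fst v)" "barycentric (fst (snd v))" "barycentric (snd (snd v))"
      using points_P[of v] by (auto simp: realization3_eq_coherent_topology[OF P])
    have maps: "(proj_I :: 'a \<times> 'b \<times> 'c \<Rightarrow> _) = fst"
      "(\<lambda>(i, j, k). j) = (fst \<circ> snd :: 'a \<times> 'b \<times> 'c \<Rightarrow> _)"
      "(\<lambda>(i, j, k). k) = (snd \<circ> snd :: 'a \<times> 'b \<times> 'c \<Rightarrow> _)"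
      by (auto simp: proj_I_def)
    show "(squash3 \<circ> ?t) v = id v"
      using v by (simp add: squash3_eq maps realization_map_comp barycentric_tensor[OF bij_pair]
          realization_map_tensor1[OF bij_pair] realization_map_tensor2[OF bij_pair])
  qed auto
qed


section \<open>Truncation and selection\<close>

text \<open>Any continuous positive threshold below the largest coordinate would do. Half the sum of squares is
  one: the sum of squares is an average of the coordinates, and it is a polynomial on each simplex.\<close>

definition threshold :: "('a \<Rightarrow> real) \<Rightarrow> real" where
  "threshold x = (\<Sum>a\<in>supp x. (x a)\<^sup>2) / 2"

definition truncate :: "('a \<Rightarrow> real) \<Rightarrow> 'a \<Rightarrow> real" where
  "truncate x a = max 0 (x a - threshold x) / (\<Sum>b\<in>supp x. max 0 (x b - threshold x))"

text \<open>The first factor vanishes unless \<open>\<sigma>\<close> is contained in the support of \<open>x\<close>, the second one unless every vertex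
  above the threshold lies in \<open>\<sigma>\<close>. The truncated terms are equal to 1 off the support, so the second
  product may be taken over any finite set that contains the support; this is what makes the weight
  continuous on a closed simplex, where the support varies.\<close>

definition weight :: "('a \<Rightarrow> real) \<Rightarrow> 'a set \<Rightarrow> real" where
  "weight x \<sigma> = (\<Prod>a\<in>\<sigma>. x a) * (\<Prod>a\<in>supp x - \<sigma>. max 0 (1 - x a / threshold x))"

definition select :: "('a set \<Rightarrow> 'b) \<Rightarrow> ('a \<Rightarrow> real) \<Rightarrow> 'b \<Rightarrow> real" where
  "select \<beta> x b = (\<Sum>\<sigma>\<in>{\<sigma> \<in> Pow (supp x). \<beta> \<sigma> = b}. weight x \<sigma>) / (\<Sum>\<sigma>\<in>Pow (supp x). weight x \<sigma>)"

lemma threshold_over: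
  assumes "finite F" "supp x \<subseteq> F"
  shows "threshold x = (\<Sum>a\<in>F. (x a)\<^sup>2) / 2"
  unfolding threshold_def using assms by (subst sum_over_supp[of F]) auto

text \<open>If all coordinates were at most the threshold \<open>c\<close>, their average \<open>2 c\<close> with respect to the weights \<open>x a\<close>
  would be at most \<open>c\<close>.\<close>

lemma threshold_bounds:
  assumes x: "barycentric x"
  shows "0 < threshold x" "\<exists>a. threshold x < x a"
proof -
  note x' = barycentricD[OF x]
  have "0 < (\<Sum>a\<in>supp x. (x a)\<^sup>2)"
    using x' by (intro sum_pos) (auto simp: supp_def)
  then show pos: "0 < threshold x"
    by (simp add: threshold_def)
  show "\<exists>a. threshold x < x a"
  proof (rule ccontr)
    assume "\<nexists>a. threshold x < x a"
    then have le: "x a \<le> threshold x" for a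
      by (simp add: not_less)
    have "2 * threshold x = (\<Sum>a\<in>supp x. x a * x a)"
      by (simp add: threshold_def power2_eq_square)
    also have "\<dots> \<le> (\<Sum>a\<in>supp x. x a * threshold x)"
      using x' le by (intro sum_mono mult_left_mono) auto
    also have "\<dots> = threshold x"
      using x by (simp add: barycentric_def flip: sum_distrib_right)
    finally show False
      using pos by simp
  qed
qed

lemma truncate_over:
  assumes "finite F" "supp x \<subseteq> F"
  shows "truncate x a = max 0 (x a - threshold x) / (\<Sum>b\<in>F. max 0 (x b - threshold x))"
proof -
  have "0 \<le> threshold x"
    by (simp add: threshold_def sum_nonneg)
  then have "(\<Sum>b\<in>supp x. max 0 (x b - threshold x)) = (\<Sum>b\<in>F. max 0 (x b - threshold x))"
    using assms by (intro sum_over_supp) auto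
  then show ?thesis
    by (simp add: truncate_def)
qed

lemma truncate_denominator_pos:
  assumes x: "barycentric x" and "finite F" "supp x \<subseteq> F"
  shows "0 < (\<Sum>b\<in>F. max 0 (x b - threshold x))"
proof -
  obtain a where a: "threshold x < x a"
    using threshold_bounds[OF x] by blast
  moreover have "a \<in> supp x"
    using a threshold_bounds(1)[OF x] by (auto simp: supp_def)
  ultimately show ?thesis
    using assms by (intro sum_pos2[of F a]) auto
qed

lemma supp_truncate:
  assumes x: "barycentric x"
  shows "supp (truncate x) = {a. threshold x < x a}" "supp (truncate x) \<subseteq> supp x"
proof -
  show *: "supp (truncate x) = {a. threshold x < x a}"
    using truncate_denominator_pos[OF x _ order_refl] barycentricD(2)[OF x]
    by (auto simp: supp_def truncate_def max_def)
  show "supp (truncate x) \<subseteq> supp x"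
    unfolding * using threshold_bounds(1)[OF x] by (auto simp: supp_def)
qed

lemma barycentric_truncate:
  assumes x: "barycentric x"
  shows "barycentric (truncate x)"
proof (rule barycentricI)
  have D: "0 < (\<Sum>b\<in>supp x. max 0 (x b - threshold x))"
    using truncate_denominator_pos[OF x _ order_refl] barycentricD(2)[OF x] by blast
  then show "(\<Sum>a\<in>supp x. truncate x a) = 1"
    by (simp add: truncate_def flip: sum_divide_distrib)
  show "0 \<le> truncate x a" for a
    using D by (simp add: truncate_def)
qed (use supp_truncate[OF x] barycentricD[OF x] in auto)

lemma tame_truncate: "tame (geo_simplex ` Collect finite) truncate"
  unfolding tame_def
proof (clarify, intro conjI)
  fix F :: "'a set" assume F: "finite F"
  have pos: "(\<Sum>b\<in>F. max 0 (x b - (\<Sum>a\<in>F. (x a)\<^sup>2) / 2)) \<noteq> 0" if "x \<in> geo_simplex F" for x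
    using that truncate_denominator_pos[of x F] F by (auto simp: geo_simplex_iff threshold_over[of F])
  have "continuous_on (geo_simplex F) (\<lambda>x a.
      max 0 (x a - (\<Sum>a\<in>F. (x a)\<^sup>2) / 2) / (\<Sum>b\<in>F. max 0 (x b - (\<Sum>a\<in>F. (x a)\<^sup>2) / 2)))"
    using pos by (intro continuous_on_coordinatewise_then_product continuous_on_divide continuous_on_max
        continuous_on_sum continuous_on_diff continuous_on_power continuous_on_coordinate
        continuous_on_const) auto
  moreover have "truncate x = (\<lambda>a.
      max 0 (x a - (\<Sum>a\<in>F. (x a)\<^sup>2) / 2) / (\<Sum>b\<in>F. max 0 (x b - (\<Sum>a\<in>F. (x a)\<^sup>2) / 2)))"
    if "x \<in> geo_simplex F" for x
    using that F by (auto simp: geo_simplex_iff truncate_over[of F] threshold_over[of F])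
  ultimately show "continuous_on (geo_simplex F) truncate"
    by (simp cong: continuous_on_cong)
  show "\<exists>G. finite G \<and> (\<forall>x\<in>geo_simplex F. supp (truncate x) \<subseteq> G)"
    using F supp_truncate(2) geo_simplex_iff[OF F] by (intro exI[of _ F]) blast
qed

lemma weight_over:
  assumes F: "finite F" "supp x \<subseteq> F" and "\<sigma> \<subseteq> F"
  shows "weight x \<sigma> = (\<Prod>a\<in>\<sigma>. x a) * (\<Prod>a\<in>F - \<sigma>. max 0 (1 - x a / threshold x))"
proof -
  have "(\<Prod>a\<in>supp x - \<sigma>. max 0 (1 - x a / threshold x)) = (\<Prod>a\<in>F - \<sigma>. max 0 (1 - x a / threshold x))"
    using F by (intro prod.mono_neutral_left) (auto simp: supp_def)
  then show ?thesis
    by (simp add: weight_def)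
qed

lemma weight_eq_0:
  assumes "finite \<sigma>" "\<not> \<sigma> \<subseteq> supp x"
  shows "weight x \<sigma> = 0"
  using assms by (auto simp: weight_def supp_def)

lemma weight_nonneg: "barycentric x \<Longrightarrow> 0 \<le> weight x \<sigma>"
  by (simp add: weight_def barycentricD prod_nonneg)

text \<open>With \<open>\<sigma> \<subseteq> supp x\<close>, this pins \<open>\<sigma>\<close> between two supports; it is the reason why a selected element \<open>\<beta> \<sigma>\<close>
  is related to all vertices of the truncated point.\<close>

lemma weight_nonzeroD:
  assumes x: "barycentric x" and w: "weight x \<sigma> \<noteq> 0"
  shows "supp (truncate x) \<subseteq> \<sigma>"
proof
  fix a assume a: "a \<in> supp (truncate x)"
  show "a \<in> \<sigma>"
  proof (rule ccontr)
    assume "a \<notin> \<sigma>"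
    then have "a \<in> supp x - \<sigma>" "max 0 (1 - x a / threshold x) = 0"
      using a supp_truncate[OF x] threshold_bounds(1)[OF x] by auto
    then show False
      using w barycentricD(2)[OF x] by (auto simp: weight_def)
  qed
qed

lemma weight_supp_pos:
  assumes "barycentric x"
  shows "0 < weight x (supp x)"
proof -
  have "0 < x a" if "a \<in> supp x" for a
    using that barycentricD(1)[OF assms, of a] by (simp add: supp_def)
  then show ?thesis
    by (simp add: weight_def prod_pos)
qed

lemma sum_weight_pos:
  assumes x: "barycentric x" and "finite F" "supp x \<subseteq> F"
  shows "0 < (\<Sum>\<sigma>\<in>Pow F. weight x \<sigma>)"
  using assms weight_supp_pos[OF x] weight_nonneg[OF x] by (intro sum_pos2[of _ "supp x"]) auto

lemma select_over:
  assumes F: "finite F" "supp x \<subseteq> F"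
  shows "select \<beta> x b = (\<Sum>\<sigma>\<in>{\<sigma> \<in> Pow F. \<beta> \<sigma> = b}. weight x \<sigma>) / (\<Sum>\<sigma>\<in>Pow F. weight x \<sigma>)"
proof -
  have "(\<Sum>\<sigma>\<in>{\<sigma> \<in> Pow (supp x). Q \<sigma>}. weight x \<sigma>) = (\<Sum>\<sigma>\<in>{\<sigma> \<in> Pow F. Q \<sigma>}. weight x \<sigma>)" for Q
    using F by (intro sum.mono_neutral_left) (auto intro!: weight_eq_0 intro: finite_subset)
  from this[of "\<lambda>\<sigma>. \<beta> \<sigma> = b"] this[of "\<lambda>_. True"] show ?thesis
    by (simp only: select_def simp_thms Collect_mem_eq)
qed

lemma barycentric_select:
  assumes x: "barycentric x"
  shows "barycentric (select \<beta> x)"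
proof (rule barycentricI)
  let ?P = "Pow (supp x)"
  have fin: "finite ?P"
    using barycentricD[OF x] by simp
  have pos: "0 < (\<Sum>\<sigma>\<in>?P. weight x \<sigma>)"
    using sum_weight_pos[OF x _ order_refl] barycentricD[OF x] by blast
  have "(\<Sum>b\<in>\<beta> ` ?P. \<Sum>\<sigma>\<in>{\<sigma> \<in> ?P. \<beta> \<sigma> = b}. weight x \<sigma>) = (\<Sum>\<sigma>\<in>?P. weight x \<sigma>)"
    using sum.image_gen[OF fin, of "weight x" \<beta>] by simp
  then show "(\<Sum>b\<in>\<beta> ` ?P. select \<beta> x b) = 1"
    using pos by (simp add: select_def flip: sum_divide_distrib)
  show "0 \<le> select \<beta> x b" for b
    unfolding select_def using pos weight_nonneg[OF x] by (intro divide_nonneg_pos sum_nonneg) auto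
  show "finite (\<beta> ` ?P)"
    using fin by simp
  show "supp (select \<beta> x) \<subseteq> \<beta> ` ?P"
  proof
    fix b assume "b \<in> supp (select \<beta> x)"
    then have "select \<beta> x b \<noteq> 0"
      by (simp add: supp_def)
    then have "{\<sigma> \<in> ?P. \<beta> \<sigma> = b} \<noteq> {}"
      unfolding select_def by (metis (no_types, lifting) div_0 sum.empty)
    then show "b \<in> \<beta> ` ?P"
      by blast
  qed
qed

lemma supp_selectD:
  assumes x: "barycentric x" and b: "b \<in> supp (select \<beta> x)"
  obtains \<sigma> where "b = \<beta> \<sigma>" "supp (truncate x) \<subseteq> \<sigma>" "\<sigma> \<subseteq> supp x"
proof -
  have "(\<Sum>\<sigma>\<in>{\<sigma> \<in> Pow (supp x). \<beta> \<sigma> = b}. weight x \<sigma>) \<noteq> 0"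
    using b by (auto simp: supp_def select_def)
  then obtain \<sigma> where "\<sigma> \<in> {\<sigma> \<in> Pow (supp x). \<beta> \<sigma> = b}" "weight x \<sigma> \<noteq> 0"
    by (rule sum.not_neutral_contains_not_neutral)
  then show ?thesis
    using that weight_nonzeroD[OF x] by blast
qed

lemma tame_select: "tame (geo_simplex ` Collect finite) (select \<beta>)"
  unfolding tame_def
proof (clarify, intro conjI)
  fix F :: "'a set" assume F: "finite F"
  define W where "W \<sigma> x = (\<Prod>a\<in>\<sigma>. x a) * (\<Prod>a\<in>F - \<sigma>. max 0 (1 - x a / ((\<Sum>a\<in>F. (x a)\<^sup>2) / 2)))"
    for \<sigma> and x :: "'a \<Rightarrow> real"
  have W: "weight x \<sigma> = W \<sigma> x" if "x \<in> geo_simplex F" "\<sigma> \<subseteq> F" for x \<sigma>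
    using that F by (simp add: W_def geo_simplex_iff weight_over[of F] threshold_over[of F])
  have "(\<Sum>a\<in>F. (x a)\<^sup>2) / 2 \<noteq> 0" if "x \<in> geo_simplex F" for x
    using that threshold_bounds(1)[of x] F by (auto simp: geo_simplex_iff threshold_over[of F])
  then have cont_W: "continuous_on (geo_simplex F) (W \<sigma>)" for \<sigma>
    unfolding W_def
    by (intro continuous_on_divide continuous_on_max continuous_on_mult continuous_on_prod
        continuous_on_sum continuous_on_diff continuous_on_power continuous_on_coordinate
        continuous_on_const) auto
  have sum_W: "(\<Sum>\<sigma>\<in>Pow F. W \<sigma> x) \<noteq> 0" if "x \<in> geo_simplex F" for x
    using that sum_weight_pos[of x F] F by (auto simp: geo_simplex_iff simp flip: W)
  have "continuous_on (geo_simplex F) (\<lambda>x b. (\<Sum>\<sigma>\<in>{\<sigma> \<in> Pow F. \<beta> \<sigma> = b}. W \<sigma> x) / (\<Sum>\<sigma>\<in>Pow F. W \<sigma> x))"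
    using sum_W by (intro continuous_on_coordinatewise_then_product continuous_on_divide
        continuous_on_sum cont_W) auto
  moreover have "select \<beta> x = (\<lambda>b. (\<Sum>\<sigma>\<in>{\<sigma> \<in> Pow F. \<beta> \<sigma> = b}. W \<sigma> x) / (\<Sum>\<sigma>\<in>Pow F. W \<sigma> x))"
    if "x \<in> geo_simplex F" for x
    using that F by (auto simp: fun_eq_iff geo_simplex_iff select_over[of F] W
        intro!: arg_cong2[where f = "(/)"] sum.cong)
  ultimately show "continuous_on (geo_simplex F) (select \<beta>)"
    by (simp cong: continuous_on_cong)
  show "\<exists>G. finite G \<and> (\<forall>x\<in>geo_simplex F. supp (select \<beta> x) \<subseteq> G)"
  proof (intro exI[of _ "\<beta> ` Pow F"] conjI ballI subsetI)
    fix x b assume "x \<in> geo_simplex F" "b \<in> supp (select \<beta> x)"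
    then obtain \<sigma> where "b = \<beta> \<sigma>" "\<sigma> \<subseteq> supp x" "supp x \<subseteq> F"
      using supp_selectD F by (metis geo_simplex_iff)
    then show "b \<in> \<beta> ` Pow F"
      by blast
  qed (use F in simp)
qed


section \<open>Projections that are homotopy equivalences\<close>

text \<open>The homotopy inverse \<open>s\<close> pairs the truncated point with the selected measure. The composite \<open>p \<circ> s\<close> is
  truncation, which moves a point within its own simplex. In the other direction a point \<open>z\<close> with
  marginals \<open>x\<close> and \<open>y\<close> moves in three straight lines: to the product of \<open>x\<close> and \<open>y\<close>, then truncating
  the first factor, then changing the second factor to the selected measure. The last step needs the
  truncation, since the selected elements are related only to the vertices that survive it.\<close>

lemma projection_homotopy_equivalence:
  fixes p :: "'c \<Rightarrow> 'a" and q :: "'c \<Rightarrow> 'b" and N :: "'a set \<Rightarrow> 'b set"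
  assumes bij: "bij (\<lambda>c. (p c, q c))"
    and S: "simplicial_complex A S" and T: "simplicial_complex B T"
    and T_iff: "\<And>\<rho>. finite \<rho> \<Longrightarrow> \<rho> \<in> T \<longleftrightarrow> p ` \<rho> \<in> S \<and> q ` \<rho> \<subseteq> N (p ` \<rho>)"
    and N: "\<And>\<sigma> \<tau>. \<sigma> \<in> S \<Longrightarrow> \<tau> \<in> S \<Longrightarrow> \<tau> \<subseteq> \<sigma> \<Longrightarrow> N \<sigma> \<subseteq> N \<tau>"
    and N_nonempty: "\<And>\<sigma>. \<sigma> \<in> S \<Longrightarrow> N \<sigma> \<noteq> {}"
  shows "\<exists>g. homotopy_inverse (realization T) (realization S) (realization_map p) g"
proof -
  define \<beta> where "\<beta> \<sigma> = (SOME b. b \<in> N \<sigma>)" for \<sigma>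
  have \<beta>: "\<beta> \<sigma> \<in> N \<sigma>" if "\<sigma> \<in> S" for \<sigma>
    using N_nonempty[OF that] unfolding \<beta>_def by (simp add: some_in_eq)
  define s where "s x = tensor p q (truncate x) (select \<beta> x)" for x
  have points_S: "barycentric x" "supp x \<in> S" if "x \<in> \<Union>(geo_simplex ` S)" for x
    using that points_of_complex[OF S] by blast+
  have points_T: "barycentric z" "supp z \<in> T" if "z \<in> \<Union>(geo_simplex ` T)" for z
    using that points_of_complex[OF T] by blast+
  have block: "block p q \<sigma> \<tau> \<in> T" if "\<sigma> \<in> S" "\<tau> \<subseteq> N \<sigma>" "finite \<tau>" "\<tau> \<noteq> {}" for \<sigma> \<tau>
  proof -
    have "finite \<sigma>" "\<sigma> \<noteq> {}"
      using that(1) S by (auto simp: simplicial_complex_def Simp_def)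
    then show ?thesis
      using that by (simp add: T_iff finite_block[OF bij] image_block[OF bij])
  qed
  have supp_truncate_S: "supp (truncate x) \<in> S" if "barycentric x" "supp x \<in> S" for x
    using face_in_complex[OF S that(2) supp_truncate(2)[OF that(1)]]
      barycentricD(3)[OF barycentric_truncate[OF that(1)]] .
  have supp_select_N: "supp (select \<beta> x) \<subseteq> N (supp (truncate x))" if x: "barycentric x" "supp x \<in> S" for x
  proof
    fix b assume "b \<in> supp (select \<beta> x)"
    then obtain \<sigma> where \<sigma>: "b = \<beta> \<sigma>" "supp (truncate x) \<subseteq> \<sigma>" "\<sigma> \<subseteq> supp x"
      by (rule supp_selectD[OF x(1)]) blast
    moreover have "\<sigma> \<in> S"
      using face_in_complex[OF S x(2) \<sigma>(3)] \<sigma>(2) barycentricD(3)[OF barycentric_truncate[OF x(1)]] by blast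
    ultimately show "b \<in> N (supp (truncate x))"
      using \<beta> N supp_truncate_S[OF x] by blast
  qed
  have tame_s: "tame (geo_simplex ` Collect finite) s"
    unfolding s_def using tame_truncate tame_select by (rule tame_tensor[OF bij])
  have bary_s: "barycentric (s x)" if "barycentric x" for x
    unfolding s_def using that
    by (intro barycentric_tensor[OF bij] barycentric_truncate barycentric_select)
  have cont_s: "continuous_map (realization S) (realization T) s"
    unfolding realization_eq_coherent_topology[of S]
  proof (rule tame_continuous_map[OF T tame_subset[OF tame_s geo_simplices_finite[OF S]]])
    fix x assume "x \<in> \<Union>(geo_simplex ` S)"
    note x = points_S[OF this]
    show "barycentric (s x) \<and> supp (s x) \<in> T"
      using bary_s[OF x(1)] barycentricD[OF barycentric_select[OF x(1), of \<beta>]]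
      by (simp add: s_def supp_tensor block supp_truncate_S[OF x] supp_select_N[OF x])
  qed
  have "p ` \<rho> \<in> S" if "\<rho> \<in> T" for \<rho>
    using that T_iff finite_simplex[OF T] by blast
  then have cont_p: "continuous_map (realization T) (realization S) (realization_map p)"
    unfolding realization_eq_coherent_topology[of T] using points_T
    by (intro tame_continuous_map[OF S] tame_subset[OF tame_realization_map geo_simplices_finite[OF T]])
      (auto simp: barycentric_realization_map supp_realization_map)
  have "homotopic_with (\<lambda>_. True) (realization S) (realization S) truncate (\<lambda>x. x)"
  proof (rule tame_homotopic[OF S])
    show "tame (geo_simplex ` S) truncate" "tame (geo_simplex ` S) (\<lambda>x. x)"
      by (rule tame_subset[OF tame_truncate geo_simplices_finite[OF S]]
          tame_subset[OF tame_id geo_simplices_finite[OF S]])+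
    fix x assume "x \<in> \<Union>(geo_simplex ` S)"
    note x = points_S[OF this]
    show "barycentric (truncate x) \<and> barycentric x"
      using x barycentric_truncate by blast
    show "\<exists>\<sigma>\<in>S. supp (truncate x) \<subseteq> \<sigma> \<and> supp x \<subseteq> \<sigma>"
      using x supp_truncate by blast
  qed
  then have "homotopic_with (\<lambda>_. True) (realization S) (realization S) truncate id"
    by (simp add: id_def)
  moreover have "homotopic_with (\<lambda>_. True) (realization S) (realization S) (realization_map p \<circ> s) truncate"
  proof (rule homotopic_with_equal)
    show "continuous_map (realization S) (realization S) (realization_map p \<circ> s)"
      using cont_s cont_p by (rule continuous_map_compose)
    fix x assume "x \<in> topspace (realization S)"
    then have "barycentric x"
      using points_S(1) by simp
    then show "(realization_map p \<circ> s) x = truncate x"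
      by (simp add: s_def realization_map_tensor1[OF bij] barycentric_truncate barycentric_select)
  qed auto
  ultimately have S_homotopy: "homotopic_with (\<lambda>_. True) (realization S) (realization S) (realization_map p \<circ> s) id"
    by (rule homotopic_with_trans[rotated])

  let ?p = "realization_map p" and ?q = "realization_map q"
  let ?T = "geo_simplex ` T"
  have tame_id_T: "tame ?T (\<lambda>z. z)" and tame_p: "tame ?T ?p" and tame_q: "tame ?T ?q"
    by (rule tame_subset[OF tame_id geo_simplices_finite[OF T]]
        tame_subset[OF tame_realization_map geo_simplices_finite[OF T]])+
  have bary_p: "barycentric (?p z)" if "z \<in> \<Union>?T" for z
    using points_T(1)[OF that] by (rule barycentric_realization_map)
  have bary_q: "barycentric (?q z)" if "z \<in> \<Union>?T" for z
    using points_T(1)[OF that] by (rule barycentric_realization_map)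
  have p_S: "supp (?p z) \<in> S" and q_N: "supp (?q z) \<subseteq> N (supp (?p z))" if "z \<in> \<Union>?T" for z
    using points_T[OF that] T_iff[of "supp z"] by (simp_all add: supp_realization_map barycentricD)
  have tame_truncate_p: "tame ?T (\<lambda>z. truncate (?p z))" and tame_select_p: "tame ?T (\<lambda>z. select \<beta> (?p z))"
    using tame_compose[OF tame_p bary_p] tame_truncate tame_select by blast+
  (* The three legs of the path from s (p z) to z, in reverse order. *)
  have H1: "homotopic_with (\<lambda>_. True) (realization T) (realization T)
      (\<lambda>z. tensor p q (?p z) (?q z)) (\<lambda>z. z)"
  proof (rule tame_homotopic[OF T tame_tensor[OF bij tame_p tame_q] tame_id_T])
    fix z assume z: "z \<in> \<Union>?T"
    show "barycentric (tensor p q (?p z) (?q z)) \<and> barycentric z"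
      using points_T(1)[OF z] barycentric_tensor[OF bij bary_p[OF z] bary_q[OF z]] by blast
    have "supp z \<subseteq> supp (tensor p q (?p z) (?q z))"
      using points_T(1)[OF z] by (auto simp: supp_tensor block_def supp_realization_map)
    moreover have "supp (tensor p q (?p z) (?q z)) \<in> T"
      unfolding supp_tensor using barycentricD[OF bary_q[OF z]] p_S[OF z] q_N[OF z] by (intro block)
    ultimately show "\<exists>\<sigma>\<in>T. supp (tensor p q (?p z) (?q z)) \<subseteq> \<sigma> \<and> supp z \<subseteq> \<sigma>"
      by blast
  qed
  have H2: "homotopic_with (\<lambda>_. True) (realization T) (realization T)
      (\<lambda>z. tensor p q (truncate (?p z)) (?q z)) (\<lambda>z. tensor p q (?p z) (?q z))"
  proof (rule tame_homotopic[OF T tame_tensor[OF bij tame_truncate_p tame_q] tame_tensor[OF bij tame_p tame_q]])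
    fix z assume z: "z \<in> \<Union>?T"
    show "barycentric (tensor p q (truncate (?p z)) (?q z)) \<and> barycentric (tensor p q (?p z) (?q z))"
      using bary_p[OF z] bary_q[OF z] by (simp add: barycentric_tensor[OF bij] barycentric_truncate)
    have "supp (tensor p q (truncate (?p z)) (?q z)) \<subseteq> supp (tensor p q (?p z) (?q z))"
      using supp_truncate(2)[OF bary_p[OF z]] by (auto simp: supp_tensor block_def)
    moreover have "supp (tensor p q (?p z) (?q z)) \<in> T"
      unfolding supp_tensor using barycentricD[OF bary_q[OF z]] p_S[OF z] q_N[OF z] by (intro block)
    ultimately show "\<exists>\<sigma>\<in>T. supp (tensor p q (truncate (?p z)) (?q z)) \<subseteq> \<sigma> \<and>
        supp (tensor p q (?p z) (?q z)) \<subseteq> \<sigma>"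
      by blast
  qed
  have H3: "homotopic_with (\<lambda>_. True) (realization T) (realization T)
      (\<lambda>z. s (?p z)) (\<lambda>z. tensor p q (truncate (?p z)) (?q z))"
    unfolding s_def
  proof (rule tame_homotopic[OF T tame_tensor[OF bij tame_truncate_p tame_select_p]
        tame_tensor[OF bij tame_truncate_p tame_q]])
    fix z assume z: "z \<in> \<Union>?T"
    note bary = bary_p[OF z] bary_q[OF z]
    show "barycentric (tensor p q (truncate (?p z)) (select \<beta> (?p z))) \<and>
        barycentric (tensor p q (truncate (?p z)) (?q z))"
      using bary by (simp add: barycentric_tensor[OF bij] barycentric_truncate barycentric_select)
    (* Both measures on the second factor live on the neighbours of the truncated point. *)
    let ?\<sigma> = "supp (truncate (?p z))" and ?\<tau> = "supp (select \<beta> (?p z)) \<union> supp (?q z)"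
    have "?\<sigma> \<in> S"
      using supp_truncate_S[OF bary(1) p_S[OF z]] .
    moreover have "?\<tau> \<subseteq> N ?\<sigma>"
      using supp_select_N[OF bary(1) p_S[OF z]] q_N[OF z]
        N[OF p_S[OF z] \<open>?\<sigma> \<in> S\<close> supp_truncate(2)[OF bary(1)]] by blast
    ultimately have "block p q ?\<sigma> ?\<tau> \<in> T"
      using barycentricD[OF bary(2)] barycentricD[OF barycentric_select[OF bary(1), of \<beta>]]
      by (intro block) auto
    then show "\<exists>\<sigma>\<in>T. supp (tensor p q (truncate (?p z)) (select \<beta> (?p z))) \<subseteq> \<sigma> \<and>
        supp (tensor p q (truncate (?p z)) (?q z)) \<subseteq> \<sigma>"
      by (intro bexI[of _ "block p q ?\<sigma> ?\<tau>"]) (auto simp: supp_tensor block_def)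
  qed
  have "homotopic_with (\<lambda>_. True) (realization T) (realization T) (s \<circ> ?p) id"
    using homotopic_with_trans[OF H3 homotopic_with_trans[OF H2 H1]]
    by (simp add: o_def id_def)
  then show ?thesis
    unfolding homotopy_inverse_def using cont_p cont_s S_homotopy by blast
qed


section \<open>Complexes of relations\<close>

lemma prod_complex2_dowker_prod2: "prod_complex2 I J (dowker_prod2 I J Q)"
proof -
  have "\<sigma>' \<times> \<tau>' \<subseteq> Q" if "\<sigma> \<times> \<tau> \<subseteq> Q" "\<sigma>' \<subseteq> \<sigma>" "\<tau>' \<subseteq> \<tau>" for \<sigma> \<tau> \<sigma>' \<tau>'
    using that by blast
  then show ?thesis
    by (auto simp: prod_complex2_def dowker_prod2_def)
qed

lemma prod_complex3_dowker_prod3: "prod_complex3 I J K (dowker_prod3 I J K R)"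
proof -
  have "\<sigma>' \<times> \<tau>' \<times> \<upsilon>' \<subseteq> R"
    if "\<sigma> \<times> \<tau> \<times> \<upsilon> \<subseteq> R" "\<sigma>' \<subseteq> \<sigma>" "\<tau>' \<subseteq> \<tau>" "\<upsilon>' \<subseteq> \<upsilon>" for \<sigma> \<tau> \<upsilon> \<sigma>' \<tau>' \<upsilon>'
    using that by blast
  then show ?thesis
    by (auto simp: prod_complex3_def dowker_prod3_def)
qed

lemma prod_complex2_del3: "prod_complex2 I J (del3 (dowker_prod3 I J K R))"
proof -
  have "(\<sigma>, \<tau>) \<in> del3 (dowker_prod3 I J K R) \<longleftrightarrow>
      \<sigma> \<in> Simp I \<and> \<tau> \<in> Simp J \<and> (\<exists>\<upsilon>\<in>Simp K. \<sigma> \<times> \<tau> \<times> \<upsilon> \<subseteq> R)" for \<sigma> \<tau>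
    by (auto simp: del3_def dowker_prod3_def image_iff)
  note iff = this
  show ?thesis
    unfolding prod_complex2_def
  proof (intro conjI)
    show "del3 (dowker_prod3 I J K R) \<subseteq> Simp I \<times> Simp J"
      using iff by auto
    show "\<forall>(\<sigma>, \<tau>)\<in>del3 (dowker_prod3 I J K R). \<forall>\<sigma>'\<in>Simp I. \<forall>\<tau>'\<in>Simp J.
        \<sigma>' \<subseteq> \<sigma> \<and> \<tau>' \<subseteq> \<tau> \<longrightarrow> (\<sigma>', \<tau>') \<in> del3 (dowker_prod3 I J K R)"
    proof clarify
      fix \<sigma> \<tau> \<sigma>' \<tau>'
      assume *: "(\<sigma>, \<tau>) \<in> del3 (dowker_prod3 I J K R)" "\<sigma>' \<in> Simp I" "\<tau>' \<in> Simp J" "\<sigma>' \<subseteq> \<sigma>" "\<tau>' \<subseteq> \<tau>"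
      then obtain \<upsilon> where "\<upsilon> \<in> Simp K" "\<sigma> \<times> \<tau> \<times> \<upsilon> \<subseteq> R"
        unfolding iff by blast
      moreover from this have "\<sigma>' \<times> \<tau>' \<times> \<upsilon> \<subseteq> R"
        using *(4,5) by blast
      ultimately show "(\<sigma>', \<tau>') \<in> del3 (dowker_prod3 I J K R)"
        using *(2,3) unfolding iff by blast
    qed
  qed
qed

lemma rel_JK_eq: "rel_JK R = R"
  by (auto simp: rel_JK_def)

lemma cuboid_eq:
  "cuboid I J K R = {\<rho> \<in> Simp (I \<times> J \<times> K). (fst ` \<rho>, fst ` snd ` \<rho>, snd ` snd ` \<rho>) \<in> dowker_prod3 I J K R}"
proof -
  have "fst ` \<rho> \<in> Simp I \<and> fst ` snd ` \<rho> \<in> Simp J \<and> snd ` snd ` \<rho> \<in> Simp K"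
    if "\<rho> \<in> Simp (I \<times> J \<times> K)" for \<rho>
    using that by (auto simp: Simp_def)
  then show ?thesis
    by (auto simp: cuboid_def dowker_prod3_def split_def image_image)
qed

lemma rect_eq: "rect I J Q = {\<rho> \<in> Simp (I \<times> J). (fst ` \<rho>, snd ` \<rho>) \<in> dowker_prod2 I J Q}"
proof -
  have "fst ` \<rho> \<in> Simp I \<and> snd ` \<rho> \<in> Simp J" if "\<rho> \<in> Simp (I \<times> J)" for \<rho>
    using that by (auto simp: Simp_def)
  then show ?thesis
    by (auto simp: rect_def dowker_prod2_def)
qed

lemma simplicial_complex_rect: "simplicial_complex (I \<times> J) (rect I J Q)"
  unfolding rect_eq using prod_complex2_dowker_prod2 by (rule simplicial_complex_of_prod_complex2)

lemma simplicial_complex_cuboid: "simplicial_complex (I \<times> J \<times> K) (cuboid I J K R)"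
  unfolding cuboid_eq using prod_complex3_dowker_prod3 by (rule simplicial_complex_of_prod_complex3)

lemma simplicial_complex_Collect:
  assumes "\<And>\<sigma> \<tau>. \<tau> \<subseteq> \<sigma> \<Longrightarrow> \<Phi> \<sigma> \<Longrightarrow> \<Phi> \<tau>"
  shows "simplicial_complex A {\<sigma> \<in> Simp A. \<Phi> \<sigma>}"
  unfolding simplicial_complex_def
proof (intro conjI ballI impI)
  fix \<sigma> \<tau> assume "\<sigma> \<in> {\<sigma> \<in> Simp A. \<Phi> \<sigma>}" "\<tau> \<in> Simp A" "\<tau> \<subseteq> \<sigma>"
  then show "\<tau> \<in> {\<sigma> \<in> Simp A. \<Phi> \<sigma>}"
    using assms[of \<tau> \<sigma>] by simp
qed blast

lemma simplicial_complex_dowker_left: "simplicial_complex A (dowker_left A B Q)"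
  unfolding dowker_left_def by (rule simplicial_complex_Collect) blast

lemma simplicial_complex_dowker_right: "simplicial_complex B (dowker_right A B Q)"
  unfolding dowker_right_def by (rule simplicial_complex_Collect) blast

lemma simplicial_complex_dowker_mod_K: "simplicial_complex (I \<times> J) (dowker_mod_K I J K R)"
  unfolding dowker_mod_K_def
proof (rule simplicial_complex_Collect)
  fix \<zeta> \<zeta>' assume "\<zeta>' \<subseteq> \<zeta>" and "\<exists>k\<in>K. fst ` \<zeta> \<times> snd ` \<zeta> \<times> {k} \<subseteq> R"
  then obtain k where "k \<in> K" and k: "fst ` \<zeta> \<times> snd ` \<zeta> \<times> {k} \<subseteq> R"
    by (elim bexE)
  have "fst ` \<zeta>' \<times> snd ` \<zeta>' \<times> {k} \<subseteq> fst ` \<zeta> \<times> snd ` \<zeta> \<times> {k}"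
    using \<open>\<zeta>' \<subseteq> \<zeta>\<close> by (intro Sigma_mono image_mono order_refl)
  then show "\<exists>k\<in>K. fst ` \<zeta>' \<times> snd ` \<zeta>' \<times> {k} \<subseteq> R"
    using \<open>k \<in> K\<close> subset_trans[OF _ k] by (intro bexI)
qed

lemma simplicial_complex_dowker_mod_I: "simplicial_complex (J \<times> K) (dowker_mod_I I J K R)"
  unfolding dowker_mod_I_def
proof (rule simplicial_complex_Collect)
  fix \<zeta> \<zeta>' assume "\<zeta>' \<subseteq> \<zeta>" and "\<exists>i\<in>I. {i} \<times> fst ` \<zeta> \<times> snd ` \<zeta> \<subseteq> R"
  then obtain i where "i \<in> I" and i: "{i} \<times> fst ` \<zeta> \<times> snd ` \<zeta> \<subseteq> R"
    by (elim bexE)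
  have "{i} \<times> fst ` \<zeta>' \<times> snd ` \<zeta>' \<subseteq> {i} \<times> fst ` \<zeta> \<times> snd ` \<zeta>"
    using \<open>\<zeta>' \<subseteq> \<zeta>\<close> by (intro Sigma_mono image_mono order_refl)
  then show "\<exists>i\<in>I. {i} \<times> fst ` \<zeta>' \<times> snd ` \<zeta>' \<subseteq> R"
    using \<open>i \<in> I\<close> subset_trans[OF _ i] by (intro bexI)
qed

lemma del2_dowker_prod2: "del2 (dowker_prod2 A B Q) = dowker_left A B Q"
proof (intro equalityI subsetI)
  fix \<sigma> assume "\<sigma> \<in> del2 (dowker_prod2 A B Q)"
  then show "\<sigma> \<in> dowker_left A B Q"
    by (fastforce simp: del2_def dowker_prod2_def dowker_left_def Simp_def)
next
  fix \<sigma> assume "\<sigma> \<in> dowker_left A B Q"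
  then obtain b where "\<sigma> \<in> Simp A" "b \<in> B" "\<sigma> \<times> {b} \<subseteq> Q"
    by (auto simp: dowker_left_def)
  then have "(\<sigma>, {b}) \<in> dowker_prod2 A B Q"
    by (simp add: dowker_prod2_def Simp_def)
  then show "\<sigma> \<in> del2 (dowker_prod2 A B Q)"
    by (force simp: del2_def)
qed

lemma del2_del3_dowker_prod3:
  "del2 (del3 (dowker_prod3 I J K R)) = dowker_left I (J \<times> K) (rel_JK R)"
  unfolding rel_JK_eq
proof (intro equalityI subsetI)
  fix \<sigma> assume "\<sigma> \<in> del2 (del3 (dowker_prod3 I J K R))"
  then obtain \<tau> \<upsilon> where *: "\<sigma> \<in> Simp I" "\<tau> \<in> Simp J" "\<upsilon> \<in> Simp K" "\<sigma> \<times> \<tau> \<times> \<upsilon> \<subseteq> R"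
    by (auto simp: del2_def del3_def dowker_prod3_def)
  then obtain j k where "j \<in> \<tau>" "k \<in> \<upsilon>" "j \<in> J" "k \<in> K"
    unfolding Simp_def by blast
  then have "(j, k) \<in> J \<times> K" "\<sigma> \<times> {(j, k)} \<subseteq> R"
    using *(4) by blast+
  then show "\<sigma> \<in> dowker_left I (J \<times> K) R"
    using *(1) unfolding dowker_left_def by blast
next
  fix \<sigma> assume "\<sigma> \<in> dowker_left I (J \<times> K) R"
  then obtain j k where "\<sigma> \<in> Simp I" "j \<in> J" "k \<in> K" "\<sigma> \<times> {(j, k)} \<subseteq> R"
    by (auto simp: dowker_left_def)
  then have "(\<sigma>, {j}, {k}) \<in> dowker_prod3 I J K R"
    by (auto simp: dowker_prod3_def Simp_def)
  then show "\<sigma> \<in> del2 (del3 (dowker_prod3 I J K R))"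
    by (force simp: del2_def del3_def)
qed

text \<open>Dowker duality, for the relation between \<open>A\<close> and \<open>B\<close> whose common neighbours are given by \<open>N\<close>. Stating
  it for \<open>N\<close> instead of a relation on \<open>A\<close> and \<open>B\<close> covers the complexes \<open>dowker_mod_K\<close> and \<open>dowker_mod_I\<close>,
  where \<open>N \<sigma>\<close> depends only on the block spanned by \<open>\<sigma>\<close> and is in general smaller than the set of
  common neighbours of the elements of \<open>\<sigma>\<close>.\<close>

lemma dowker_projection_homotopy_equivalence:
  fixes p :: "'c \<Rightarrow> 'a" and q :: "'c \<Rightarrow> 'b" and N :: "'a set \<Rightarrow> 'b set"
  assumes bij: "bij (\<lambda>c. (p c, q c))" and antitone: "\<And>\<sigma> \<tau>. \<tau> \<subseteq> \<sigma> \<Longrightarrow> N \<sigma> \<subseteq> N \<tau>"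
    and N_sub: "\<And>\<sigma>. N \<sigma> \<subseteq> B"
  shows "\<exists>g. homotopy_inverse (realization {\<rho> \<in> Simp (block p q A B). q ` \<rho> \<subseteq> N (p ` \<rho>)})
    (realization {\<sigma> \<in> Simp A. N \<sigma> \<noteq> {}}) (realization_map p) g"
proof (rule projection_homotopy_equivalence[OF bij])
  show "simplicial_complex A {\<sigma> \<in> Simp A. N \<sigma> \<noteq> {}}"
    using antitone by (intro simplicial_complex_Collect) blast
  show "simplicial_complex (block p q A B) {\<rho> \<in> Simp (block p q A B). q ` \<rho> \<subseteq> N (p ` \<rho>)}"
  proof (rule simplicial_complex_Collect)
    fix \<rho> \<rho>' assume "\<rho>' \<subseteq> \<rho>" "q ` \<rho> \<subseteq> N (p ` \<rho>)"
    then show "q ` \<rho>' \<subseteq> N (p ` \<rho>')"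
      using antitone[OF image_mono[of \<rho>' \<rho> p]] image_mono[of \<rho>' \<rho> q] by blast
  qed
  show "\<rho> \<in> {\<rho> \<in> Simp (block p q A B). q ` \<rho> \<subseteq> N (p ` \<rho>)} \<longleftrightarrow>
      p ` \<rho> \<in> {\<sigma> \<in> Simp A. N \<sigma> \<noteq> {}} \<and> q ` \<rho> \<subseteq> N (p ` \<rho>)" if "finite \<rho>" for \<rho>
  proof (cases "q ` \<rho> \<subseteq> N (p ` \<rho>)")
    case True
    then have "q ` \<rho> \<subseteq> B"
      using N_sub by blast
    then have "\<rho> \<subseteq> block p q A B \<longleftrightarrow> p ` \<rho> \<subseteq> A"
      by (auto simp: block_def)
    moreover have "\<rho> \<noteq> {} \<Longrightarrow> N (p ` \<rho>) \<noteq> {}"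
      using True by blast
    ultimately show ?thesis
      using that True by (auto simp: Simp_def)
  qed simp
qed (use antitone in auto)

lemma block_fst_snd: "block fst snd A B = A \<times> B"
  by (auto simp: block_def)

lemma rect_to_dowker_left:
  fixes A :: "'a set" and B :: "'b set"
  shows "\<exists>g. homotopy_inverse (realization (rect A B Q)) (realization (dowker_left A B Q)) (realization_map fst) g"
proof -
  define N where "N \<sigma> = {b \<in> B. \<sigma> \<times> {b} \<subseteq> Q}" for \<sigma> :: "'a set"
  have "\<And>\<sigma> \<tau>. \<tau> \<subseteq> \<sigma> \<Longrightarrow> N \<sigma> \<subseteq> N \<tau>" "\<And>\<sigma>. N \<sigma> \<subseteq> B"
    by (auto simp: N_def)
  note * = dowker_projection_homotopy_equivalence[OF bij_pair this, where A = A]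
  have "snd ` \<rho> \<subseteq> N (fst ` \<rho>) \<longleftrightarrow> fst ` \<rho> \<times> snd ` \<rho> \<subseteq> Q" if "\<rho> \<in> Simp (A \<times> B)" for \<rho>
  proof -
    have "snd ` \<rho> \<subseteq> B"
      using that by (auto simp: Simp_def)
    then show ?thesis
      unfolding N_def by blast
  qed
  then have "rect A B Q = {\<rho> \<in> Simp (block fst snd A B). snd ` \<rho> \<subseteq> N (fst ` \<rho>)}"
    unfolding rect_def block_fst_snd by (intro Collect_cong conj_cong) simp_all
  moreover have "dowker_left A B Q = {\<sigma> \<in> Simp A. N \<sigma> \<noteq> {}}"
    unfolding dowker_left_def N_def by blast
  ultimately show ?thesis
    using * by simp
qed

lemma rect_to_dowker_right:
  fixes A :: "'a set" and B :: "'b set"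
  shows "\<exists>g. homotopy_inverse (realization (rect A B Q)) (realization (dowker_right A B Q)) (realization_map snd) g"
proof -
  define N where "N \<tau> = {a \<in> A. {a} \<times> \<tau> \<subseteq> Q}" for \<tau> :: "'b set"
  have "\<And>\<sigma> \<tau>. \<tau> \<subseteq> \<sigma> \<Longrightarrow> N \<sigma> \<subseteq> N \<tau>" "\<And>\<sigma>. N \<sigma> \<subseteq> A"
    by (auto simp: N_def)
  note * = dowker_projection_homotopy_equivalence[OF bij_swap_pair[OF bij_pair] this, where A = B]
  have block: "block snd fst B A = A \<times> B"
    by (auto simp: block_def)
  have "fst ` \<rho> \<subseteq> N (snd ` \<rho>) \<longleftrightarrow> fst ` \<rho> \<times> snd ` \<rho> \<subseteq> Q" if "\<rho> \<in> Simp (A \<times> B)" for \<rho>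
  proof -
    have "fst ` \<rho> \<subseteq> A"
      using that by (auto simp: Simp_def)
    then show ?thesis
      unfolding N_def by blast
  qed
  then have "rect A B Q = {\<rho> \<in> Simp (block snd fst B A). fst ` \<rho> \<subseteq> N (snd ` \<rho>)}"
    unfolding rect_def block by (intro Collect_cong conj_cong) simp_all
  moreover have "dowker_right A B Q = {\<tau> \<in> Simp B. N \<tau> \<noteq> {}}"
    unfolding dowker_right_def N_def by blast
  ultimately show ?thesis
    using * by simp
qed

lemma cuboid_to_dowker_mod_K:
  fixes R :: "('a \<times> 'b \<times> 'c) set"
  shows "\<exists>g. homotopy_inverse (realization (cuboid I J K R)) (realization (dowker_mod_K I J K R))
     (realization_map proj_IJ) g"
proof -
  define N where "N \<zeta> = {k \<in> K. fst ` \<zeta> \<times> snd ` \<zeta> \<times> {k} \<subseteq> R}" for \<zeta> :: "('a \<times> 'b) set"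
  let ?q = "\<lambda>(i, j, k). k"
  have bij: "bij (\<lambda>c. (proj_IJ c, ?q c))"
    by (rule bij_betw_byWitness[where f' = "\<lambda>((i, j), k). (i, j, k)"]) (auto simp: proj_IJ_def)
  have N: "N \<sigma> \<subseteq> N \<tau>" if "\<tau> \<subseteq> \<sigma>" for \<sigma> \<tau>
    using image_mono[OF that, of fst] image_mono[OF that, of snd] unfolding N_def by blast
  have "N \<sigma> \<subseteq> K" for \<sigma>
    by (auto simp: N_def)
  note * = dowker_projection_homotopy_equivalence[OF bij N this, where A = "I \<times> J"]
  have block: "block proj_IJ ?q (I \<times> J) K = I \<times> J \<times> K"
    by (auto simp: block_def proj_IJ_def)
  have "?q ` \<rho> \<subseteq> N (proj_IJ ` \<rho>) \<longleftrightarrow>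
      (\<lambda>(i, j, k). i) ` \<rho> \<times> (\<lambda>(i, j, k). j) ` \<rho> \<times> (\<lambda>(i, j, k). k) ` \<rho> \<subseteq> R"
    if "\<rho> \<in> Simp (I \<times> J \<times> K)" for \<rho>
  proof -
    have "?q ` \<rho> \<subseteq> K"
      using that by (auto simp: Simp_def)
    moreover have "fst ` proj_IJ ` \<rho> = (\<lambda>(i, j, k). i) ` \<rho>" "snd ` proj_IJ ` \<rho> = (\<lambda>(i, j, k). j) ` \<rho>"
      by (auto simp: proj_IJ_def image_image split_def)
    moreover have "Z \<subseteq> {k \<in> K. X \<times> Y \<times> {k} \<subseteq> R} \<longleftrightarrow> X \<times> Y \<times> Z \<subseteq> R" if "Z \<subseteq> K" for X Y Z
      using that by blast
    ultimately show ?thesis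
      by (simp only: N_def)
  qed
  then have "cuboid I J K R = {\<rho> \<in> Simp (block proj_IJ ?q (I \<times> J) K). ?q ` \<rho> \<subseteq> N (proj_IJ ` \<rho>)}"
    unfolding cuboid_def block by (intro Collect_cong conj_cong) simp_all
  moreover have "dowker_mod_K I J K R = {\<zeta> \<in> Simp (I \<times> J). N \<zeta> \<noteq> {}}"
    unfolding dowker_mod_K_def N_def by blast
  ultimately show ?thesis
    using * by simp
qed

lemma cuboid_to_dowker_mod_I:
  fixes R :: "('a \<times> 'b \<times> 'c) set"
  shows "\<exists>g. homotopy_inverse (realization (cuboid I J K R)) (realization (dowker_mod_I I J K R))
     (realization_map proj_JK) g"
proof -
  define N where "N \<zeta> = {i \<in> I. {i} \<times> fst ` \<zeta> \<times> snd ` \<zeta> \<subseteq> R}" for \<zeta> :: "('b \<times> 'c) set"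
  have bij: "bij (\<lambda>c. (proj_JK c, proj_I c))"
    by (rule bij_betw_byWitness[where f' = "\<lambda>((j, k), i). (i, j, k)"]) (auto simp: proj_JK_def proj_I_def)
  have N: "N \<sigma> \<subseteq> N \<tau>" if "\<tau> \<subseteq> \<sigma>" for \<sigma> \<tau>
    using image_mono[OF that, of fst] image_mono[OF that, of snd] unfolding N_def by blast
  have "N \<sigma> \<subseteq> I" for \<sigma>
    by (auto simp: N_def)
  note * = dowker_projection_homotopy_equivalence[OF bij N this, where A = "J \<times> K"]
  have block: "block proj_JK proj_I (J \<times> K) I = I \<times> J \<times> K"
    by (auto simp: block_def proj_JK_def proj_I_def)
  have "proj_I ` \<rho> \<subseteq> N (proj_JK ` \<rho>) \<longleftrightarrow>
      (\<lambda>(i, j, k). i) ` \<rho> \<times> (\<lambda>(i, j, k). j) ` \<rho> \<times> (\<lambda>(i, j, k). k) ` \<rho> \<subseteq> R"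
    if "\<rho> \<in> Simp (I \<times> J \<times> K)" for \<rho>
  proof -
    have "proj_I ` \<rho> \<subseteq> I"
      using that by (auto simp: Simp_def proj_I_def)
    moreover have "fst ` proj_JK ` \<rho> = (\<lambda>(i, j, k). j) ` \<rho>" "snd ` proj_JK ` \<rho> = (\<lambda>(i, j, k). k) ` \<rho>"
      "(\<lambda>(i, j, k). i) ` \<rho> = proj_I ` \<rho>"
      by (auto simp: proj_JK_def proj_I_def image_image split_def)
    moreover have "X \<subseteq> {i \<in> I. {i} \<times> Y \<times> Z \<subseteq> R} \<longleftrightarrow> X \<times> Y \<times> Z \<subseteq> R" if "X \<subseteq> I" for X Y Z
      using that by blast
    ultimately show ?thesis
      by (simp only: N_def)
  qed
  then have "cuboid I J K R = {\<rho> \<in> Simp (block proj_JK proj_I (J \<times> K) I). proj_I ` \<rho> \<subseteq> N (proj_JK ` \<rho>)}"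
    unfolding cuboid_def block by (intro Collect_cong conj_cong) simp_all
  moreover have "dowker_mod_I I J K R = {\<zeta> \<in> Simp (J \<times> K). N \<zeta> \<noteq> {}}"
    unfolding dowker_mod_I_def N_def by blast
  ultimately show ?thesis
    using * by simp
qed


section \<open>The homotopy category\<close>

abbreviation homotopic :: "'a topology \<Rightarrow> 'b topology \<Rightarrow> ('a \<Rightarrow> 'b) \<Rightarrow> ('a \<Rightarrow> 'b) \<Rightarrow> bool" where
  "homotopic \<equiv> homotopic_with (\<lambda>_. True)"

lemma homotopic_compose_left:
  "homotopic X Y f g \<Longrightarrow> continuous_map Y Z h \<Longrightarrow> homotopic X Z (h \<circ> f) (h \<circ> g)"
  by (rule homotopic_with_compose_continuous_map_left[where p = "\<lambda>_. True"]) simp_all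

lemma homotopic_compose_right:
  "homotopic Y Z f g \<Longrightarrow> continuous_map X Y h \<Longrightarrow> homotopic X Z (f \<circ> h) (g \<circ> h)"
  by (rule homotopic_with_compose_continuous_map_right[where p = "\<lambda>_. True"]) simp_all

lemma homotopic_pointwise:
  "continuous_map X Y f \<Longrightarrow> (\<And>x. x \<in> topspace X \<Longrightarrow> f x = g x) \<Longrightarrow> homotopic X Y f g"
  by (simp add: homotopic_with_equal)

lemma homotopic_refl: "continuous_map X Y f \<Longrightarrow> homotopic X Y f f"
  by (rule homotopic_pointwise) auto

lemma hclass_eqI:
  assumes "homotopic X Y f g"
  shows "hclass X Y f = hclass X Y g"
proof -
  have "homotopic X Y f h \<longleftrightarrow> homotopic X Y g h" for h
    using assms homotopic_with_trans homotopic_with_symD by metis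
  then show ?thesis
    by (simp add: hclass_def)
qed

lemma hcomp_hclass:
  assumes f: "continuous_map X Y f" and g: "continuous_map Y Z g"
  shows "hclass Y Z g \<circ>\<^sub>h hclass X Y f = hclass X Z (g \<circ> f)"
proof -
  have "homotopic X Z (g \<circ> f) h" if "homotopic Y Z g g'" "homotopic X Y f f'" "homotopic X Z (g' \<circ> f') h"
    for g' f' h
  proof -
    have "homotopic X Z (g \<circ> f) (g' \<circ> f)"
      using that(1) f by (rule homotopic_compose_right)
    moreover have "homotopic X Z (g' \<circ> f) (g' \<circ> f')"
      using that(2) homotopic_with_imp_continuous_maps[OF that(1)] by (intro homotopic_compose_left) auto
    ultimately show ?thesis
      using that(3) homotopic_with_trans by meson
  qed
  then have "(\<exists>g'. homotopic Y Z g g' \<and> (\<exists>f'. homotopic X Y f f' \<and> homotopic X Z (g' \<circ> f') h)) \<longleftrightarrow>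
      homotopic X Z (g \<circ> f) h" for h
    using homotopic_refl[OF f] homotopic_refl[OF g] by metis
  then show ?thesis
    by (simp add: hclass_def)
qed

lemma homotopy_inverse_sym: "homotopy_inverse X Y f g \<Longrightarrow> homotopy_inverse Y X g f"
  by (simp add: homotopy_inverse_def)

lemma homotopy_inverse_cong:
  assumes "homotopy_inverse X Y f g" "homotopic X Y f f'"
  shows "homotopy_inverse X Y f' g"
proof -
  have f: "continuous_map X Y f" "continuous_map X Y f'" and g: "continuous_map Y X g"
    and gf: "homotopic X X (g \<circ> f) id" and fg: "homotopic Y Y (f \<circ> g) id"
    using assms(1) homotopic_with_imp_continuous_maps[OF assms(2)] by (auto simp: homotopy_inverse_def)
  have "homotopic X X (g \<circ> f') (g \<circ> f)" "homotopic Y Y (f' \<circ> g) (f \<circ> g)"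
    using homotopic_with_symD[OF assms(2)] g by (rule homotopic_compose_left homotopic_compose_right)+
  then show ?thesis
    using f g gf fg unfolding homotopy_inverse_def by (blast intro: homotopic_with_trans)
qed

lemma homotopy_inverse_unique:
  assumes g: "homotopy_inverse X Y f g" and h: "homotopy_inverse X Y f h"
  shows "homotopic Y X g h"
proof -
  have "homotopic Y X (g \<circ> (f \<circ> h)) (g \<circ> id)"
    using g h unfolding homotopy_inverse_def by (blast intro: homotopic_compose_left)
  moreover have "homotopic Y X ((g \<circ> f) \<circ> h) (id \<circ> h)"
    using g h unfolding homotopy_inverse_def by (blast intro: homotopic_compose_right)
  ultimately show ?thesis
    by (simp add: o_assoc) (meson homotopic_with_symD homotopic_with_trans)
qed

lemma hinv_hclass:
  assumes "homotopy_inverse X Y f g"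
  shows "hinv (hclass X Y f) = hclass Y X g"
proof -
  have "(\<exists>f'. homotopic X Y f f' \<and> homotopy_inverse X Y f' g') \<longleftrightarrow> homotopic Y X g g'" for g'
  proof
    assume "\<exists>f'. homotopic X Y f f' \<and> homotopy_inverse X Y f' g'"
    then have "homotopy_inverse X Y f g'"
      using homotopy_inverse_cong homotopic_with_symD by metis
    with assms show "homotopic Y X g g'"
      by (rule homotopy_inverse_unique)
  next
    assume "homotopic Y X g g'"
    then have "homotopy_inverse X Y f g'"
      using assms homotopy_inverse_cong homotopy_inverse_sym by metis
    then show "\<exists>f'. homotopic X Y f f' \<and> homotopy_inverse X Y f' g'"
      using homotopic_refl unfolding homotopy_inverse_def by blast
  qed
  then show ?thesis
    by (auto simp: hclass_def)
qed

lemma homotopy_inverse_compose: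
  assumes f: "homotopy_inverse X Y f f'" and g: "homotopy_inverse Y Z g g'"
  shows "homotopy_inverse X Z (g \<circ> f) (f' \<circ> g')"
proof -
  have cont: "continuous_map X Y f" "continuous_map Y X f'" "continuous_map Y Z g" "continuous_map Z Y g'"
    using f g by (auto simp: homotopy_inverse_def)
  have "homotopic X X (f' \<circ> ((g' \<circ> g) \<circ> f)) (f' \<circ> (id \<circ> f))"
    using g cont by (intro homotopic_compose_left homotopic_compose_right) (auto simp: homotopy_inverse_def)
  moreover have "homotopic Z Z (g \<circ> ((f \<circ> f') \<circ> g')) (g \<circ> (id \<circ> g'))"
    using f cont by (intro homotopic_compose_left homotopic_compose_right) (auto simp: homotopy_inverse_def)
  moreover have "homotopic X X (f' \<circ> f) id" "homotopic Z Z (g \<circ> g') id"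
    using f g by (auto simp: homotopy_inverse_def)
  ultimately show ?thesis
    unfolding homotopy_inverse_def using cont
    by (auto simp: o_assoc intro: continuous_map_compose homotopic_with_trans)
qed

lemma homotopy_inverse_two_of_three:
  assumes s: "homotopy_inverse W X s s'" and p: "homotopy_inverse W Y p p'"
    and f: "continuous_map X Y f" and fs: "\<And>w. w \<in> topspace W \<Longrightarrow> f (s w) = p w"
  shows "homotopy_inverse X Y f (s \<circ> p')"
proof -
  have cont: "continuous_map W X s" "continuous_map X W s'" "continuous_map W Y p"
    using s p by (auto simp: homotopy_inverse_def)
  have "homotopy_inverse X Y (p \<circ> s') (s \<circ> p')"
    by (rule homotopy_inverse_compose[OF homotopy_inverse_sym[OF s] p])
  moreover have "homotopic X Y (p \<circ> s') f"
  proof -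
    have "homotopic W Y p (f \<circ> s)"
      using cont fs by (intro homotopic_pointwise) auto
    then have "homotopic X Y (p \<circ> s') ((f \<circ> s) \<circ> s')"
      using cont(2) by (rule homotopic_compose_right)
    moreover have "homotopic X Y (f \<circ> (s \<circ> s')) (f \<circ> id)"
      using s f by (intro homotopic_compose_left) (auto simp: homotopy_inverse_def)
    ultimately show ?thesis
      by (simp add: o_assoc) (rule homotopic_with_trans)
  qed
  ultimately show ?thesis
    by (rule homotopy_inverse_cong)
qed

text \<open>Turns a square that starts at \<open>X\<close> into one that starts at the homotopy equivalent space \<open>X'\<close>.\<close>

lemma homotopic_compose_inverse:
  assumes k: "homotopy_inverse X X' p k" and a: "homotopic X Y a (b \<circ> p)" and b: "continuous_map X' Y b"
  shows "homotopic X' Y (a \<circ> k) b"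
proof -
  have "homotopic X' Y (a \<circ> k) ((b \<circ> p) \<circ> k)"
    using a k by (intro homotopic_compose_right) (auto simp: homotopy_inverse_def)
  moreover have "homotopic X' Y (b \<circ> (p \<circ> k)) (b \<circ> id)"
    using k b by (intro homotopic_compose_left) (auto simp: homotopy_inverse_def)
  ultimately show ?thesis
    by (simp add: o_assoc) (rule homotopic_with_trans)
qed

lemma realized_byI:
  assumes "continuous_map X Y f" "m = hclass X Y f"
    and "simplicial_map A S B T g"
    and s: "homotopy_inverse (realization S) X s s'" "\<phi> = hclass (realization S) X s"
    and t: "homotopy_inverse (realization T) Y t t'" "\<psi> = hclass (realization T) Y t"
    and square: "homotopic (realization S) Y (f \<circ> s) (t \<circ> realization_map g)"
  shows "realized_by X Y m A S \<phi> B T \<psi> g"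
proof -
  have "continuous_map (realization S) X s" "continuous_map (realization T) Y t"
    using s(1) t(1) by (auto simp: homotopy_inverse_def)
  then have "m \<circ>\<^sub>h \<phi> = \<psi> \<circ>\<^sub>h hclass (realization S) (realization T) (realization_map g)"
    using assms(1,2) s(2) t(2) continuous_map_realization_map[OF assms(3)] hclass_eqI[OF square]
    by (simp add: hcomp_hclass)
  then show ?thesis
    using assms unfolding realized_by_def hmorphism_def hiso_def by blast
qed


section \<open>The three maps and their realizations\<close>

lemma quot3_squash3: "barycentric z \<Longrightarrow> quot3 (squash3 z) = squash2 (realization_map proj_IJ z)"
  by (simp add: quot3_def squash3_eq squash2_eq o_def proj_IJ_def proj_I_def split_def
      flip: realization_map_comp)

lemma continuous_map_inclusion:
  assumes "simplicial_complex A S" "simplicial_complex B T" "S \<subseteq> T"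
  shows "continuous_map (realization S) (realization T) id"
  unfolding realization_eq_coherent_topology[of S] id_def
proof (rule tame_continuous_map[OF assms(2) tame_subset[OF tame_id geo_simplices_finite[OF assms(1)]]])
  fix x assume "x \<in> \<Union>(geo_simplex ` S)"
  then show "barycentric x \<and> supp x \<in> T"
    unfolding points_of_complex[OF assms(1)] using assms(3) by auto
qed

lemma proj_JK_eq_snd: "proj_JK = snd" and proj_I_eq_fst: "proj_I = fst"
  by (auto simp: proj_JK_def proj_I_def)

lemma simplicial_map_inclusion:
  "simplicial_complex A S \<Longrightarrow> simplicial_complex A T \<Longrightarrow> S \<subseteq> T \<Longrightarrow> simplicial_map A S A T id"
  by (auto simp: simplicial_map_def)

lemma cuboid_subset_rect: "cuboid I J K R \<subseteq> rect I (J \<times> K) (rel_JK R)"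
proof
  fix \<rho> assume "\<rho> \<in> cuboid I J K R"
  then have \<rho>: "\<rho> \<in> Simp (I \<times> J \<times> K)" "fst ` \<rho> \<times> fst ` snd ` \<rho> \<times> snd ` snd ` \<rho> \<subseteq> R"
    by (auto simp: cuboid_eq dowker_prod3_def)
  have "snd ` \<rho> \<subseteq> fst ` snd ` \<rho> \<times> snd ` snd ` \<rho>"
    by (rule subset_fst_snd)
  then have "fst ` \<rho> \<times> snd ` \<rho> \<subseteq> R"
    using \<rho>(2) by (meson Sigma_mono order_refl subset_trans)
  then show "\<rho> \<in> rect I (J \<times> K) (rel_JK R)"
    using \<rho>(1) by (simp add: rect_def rel_JK_eq)
qed

lemma dowker_mod_K_subset_rect: "dowker_mod_K I J K R \<subseteq> rect I J (rel_IJ R)"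
  unfolding dowker_mod_K_def rect_def rel_IJ_def by blast

lemma dowker_mod_I_subset_dowker_right: "dowker_mod_I I J K R \<subseteq> dowker_right I (J \<times> K) (rel_JK R)"
proof
  fix \<zeta> assume "\<zeta> \<in> dowker_mod_I I J K R"
  then obtain i where i: "\<zeta> \<in> Simp (J \<times> K)" "i \<in> I" "{i} \<times> fst ` \<zeta> \<times> snd ` \<zeta> \<subseteq> R"
    by (auto simp: dowker_mod_I_def)
  then have "{i} \<times> \<zeta> \<subseteq> R"
    using subset_fst_snd[of \<zeta>] by (meson Sigma_mono order_refl subset_trans)
  then show "\<zeta> \<in> dowker_right I (J \<times> K) (rel_JK R)"
    using i by (auto simp: dowker_right_def rel_JK_eq)
qed

lemma dowker_left_subset: "dowker_left I (J \<times> K) (rel_JK R) \<subseteq> dowker_left I J (rel_IJ R)"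
  unfolding dowker_left_def rel_JK_eq rel_IJ_def by blast

lemma proj_IJ_cuboid:
  assumes \<rho>: "\<rho> \<in> cuboid I J K R"
  shows "proj_IJ ` \<rho> \<in> dowker_mod_K I J K R"
proof -
  have "fst ` proj_IJ ` \<rho> = fst ` \<rho>" "snd ` proj_IJ ` \<rho> = fst ` snd ` \<rho>"
    by (auto simp: proj_IJ_def image_image split_def)
  moreover have "proj_IJ ` \<rho> \<in> Simp (I \<times> J)"
    using \<rho> by (auto simp: cuboid_eq Simp_def proj_IJ_def)
  moreover have "\<rho> \<noteq> {}" "snd ` snd ` \<rho> \<subseteq> K"
    using \<rho> by (auto simp: cuboid_eq Simp_def)
  then obtain k where "k \<in> snd ` snd ` \<rho>" "k \<in> K"
    by blast
  moreover have "fst ` \<rho> \<times> fst ` snd ` \<rho> \<times> snd ` snd ` \<rho> \<subseteq> R"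
    using \<rho> by (auto simp: cuboid_eq dowker_prod3_def)
  moreover from calculation have "fst ` \<rho> \<times> fst ` snd ` \<rho> \<times> {k} \<subseteq> R"
    by blast
  ultimately show ?thesis
    unfolding dowker_mod_K_def by auto
qed

lemma
  assumes \<rho>: "\<rho> \<in> rect A B Q"
  shows fst_rect: "fst ` \<rho> \<in> dowker_left A B Q" and snd_rect: "snd ` \<rho> \<in> dowker_right A B Q"
proof -
  have *: "\<rho> \<noteq> {}" "finite \<rho>" "fst ` \<rho> \<subseteq> A" "snd ` \<rho> \<subseteq> B" "fst ` \<rho> \<times> snd ` \<rho> \<subseteq> Q"
    using \<rho> by (auto simp: rect_def Simp_def)
  then obtain a b where ab: "a \<in> fst ` \<rho>" "b \<in> snd ` \<rho>"
    by blast
  then have "a \<in> A" "b \<in> B" "fst ` \<rho> \<times> {b} \<subseteq> Q" "{a} \<times> snd ` \<rho> \<subseteq> Q"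
    using * by blast+
  then show "fst ` \<rho> \<in> dowker_left A B Q" "snd ` \<rho> \<in> dowker_right A B Q"
    using *(1-4) unfolding dowker_left_def dowker_right_def Simp_def by simp_all blast+
qed

lemma squash3_cuboid:
  "\<exists>g. homotopy_inverse (realization (cuboid I J K R)) (sp_D I J K R) squash3 g"
  unfolding sp_D_def cuboid_eq using squash3_homotopy_inverse[OF prod_complex3_dowker_prod3] by blast

lemma squash2_rect:
  "\<exists>g. homotopy_inverse (realization (rect I J (rel_IJ R))) (sp_DIJ I J R) squash2 g"
  unfolding sp_DIJ_def rect_eq using squash2_homotopy_inverse[OF prod_complex2_dowker_prod2] by blast

lemma sp_D_JK_eq: "sp_D_JK I J K R = realization (dowker_left I (J \<times> K) (rel_JK R))"
  by (simp add: sp_D_JK_def del2_del3_dowker_prod3)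

lemma sp_DIJ_J_eq: "sp_DIJ_J I J R = realization (dowker_left I J (rel_IJ R))"
  by (simp add: sp_DIJ_J_def del2_dowker_prod2)

lemma continuous_map_quot3: "continuous_map (sp_D I J K R) (sp_D_K I J K R) quot3"
proof -
  have P: "prod_complex3 I J K (dowker_prod3 I J K R)" and P': "prod_complex2 I J (del3 (dowker_prod3 I J K R))"
    by (rule prod_complex3_dowker_prod3 prod_complex2_del3)+
  have sub: "dowker_prod3 I J K R \<subseteq> Simp I \<times> Simp J \<times> Simp K"
    by (auto simp: dowker_prod3_def)
  have "continuous_map (coherent_topology (cells3 (dowker_prod3 I J K R)))
      (realization2 I J (del3 (dowker_prod3 I J K R))) (\<lambda>v. (fst v, fst (snd v)))"
  proof (rule tame_continuous_map2[OF P' tame_cell_coordinates3(1,2)[OF sub]])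
    fix v assume "v \<in> \<Union>(cells3 (dowker_prod3 I J K R))"
    then show "barycentric (fst v) \<and> barycentric (fst (snd v)) \<and>
        (supp (fst v), supp (fst (snd v))) \<in> del3 (dowker_prod3 I J K R)"
      using points_of_cells3[OF P, of "fst v" "fst (snd v)" "snd (snd v)"] by (force simp: del3_def)
  qed
  then show ?thesis
    by (simp add: sp_D_def sp_D_K_def realization3_eq_coherent_topology[OF P] quot3_def split_def)
qed

lemma del3_subset: "del3 (dowker_prod3 I J K R) \<subseteq> dowker_prod2 I J (rel_IJ R)"
proof
  fix p assume "p \<in> del3 (dowker_prod3 I J K R)"
  then obtain \<sigma> \<tau> \<upsilon> where *: "p = (\<sigma>, \<tau>)" "\<sigma> \<in> Simp I" "\<tau> \<in> Simp J" "\<upsilon> \<noteq> {}" "\<sigma> \<times> \<tau> \<times> \<upsilon> \<subseteq> R"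
    by (auto simp: del3_def dowker_prod3_def Simp_def)
  then have "\<sigma> \<times> \<tau> \<subseteq> rel_IJ R"
    by (fastforce simp: rel_IJ_def)
  then show "p \<in> dowker_prod2 I J (rel_IJ R)"
    using * by (simp add: dowker_prod2_def)
qed

lemma continuous_map_incl_D_K: "continuous_map (sp_D_K I J K R) (sp_DIJ I J R) id"
proof -
  have P: "prod_complex2 I J (del3 (dowker_prod3 I J K R))" and P': "prod_complex2 I J (dowker_prod2 I J (rel_IJ R))"
    by (rule prod_complex2_dowker_prod2 prod_complex2_del3)+
  then have sub: "del3 (dowker_prod3 I J K R) \<subseteq> Simp I \<times> Simp J"
    by (simp add: prod_complex2_def)
  have "continuous_map (coherent_topology (cells2 (del3 (dowker_prod3 I J K R))))
      (realization2 I J (dowker_prod2 I J (rel_IJ R))) (\<lambda>v. (fst v, snd v))"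
  proof (rule tame_continuous_map2[OF P' tame_cell_coordinates2[OF sub]])
    fix v assume "v \<in> \<Union>(cells2 (del3 (dowker_prod3 I J K R)))"
    then show "barycentric (fst v) \<and> barycentric (snd v) \<and>
        (supp (fst v), supp (snd v)) \<in> dowker_prod2 I J (rel_IJ R)"
      using points_of_cells2[OF P, of "fst v" "snd v"] del3_subset[of I J K R] by auto
  qed
  then show ?thesis
    by (simp add: sp_DIJ_def sp_D_K_def realization2_eq_coherent_topology[OF P] id_def)
qed

lemma continuous_map_quot2:
  assumes P: "prod_complex2 I J P" and S: "simplicial_complex I (del2 P)"
  shows "continuous_map (realization2 I J P) (realization (del2 P)) quot2"
proof -
  have sub: "P \<subseteq> Simp I \<times> Simp J"
    using P by (simp add: prod_complex2_def)
  have "continuous_map (coherent_topology (cells2 P)) (realization (del2 P)) fst"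
  proof (rule tame_continuous_map[OF S tame_cell_coordinates2(1)[OF sub]])
    fix v assume "v \<in> \<Union>(cells2 P)"
    then show "barycentric (fst v) \<and> supp (fst v) \<in> del2 P"
      using points_of_cells2[OF P, of "fst v" "snd v"] by (force simp: del2_def)
  qed
  then show ?thesis
    by (simp add: realization2_eq_coherent_topology[OF P] quot2_def split_def)
qed

lemma continuous_map_quot2_D_K: "continuous_map (sp_D_K I J K R) (sp_D_JK I J K R) quot2"
  unfolding sp_D_K_def sp_D_JK_def
  by (rule continuous_map_quot2[OF prod_complex2_del3])
    (simp add: del2_del3_dowker_prod3 simplicial_complex_dowker_left)

lemma continuous_map_quot2_DIJ: "continuous_map (sp_DIJ I J R) (realization (dowker_left I J (rel_IJ R))) quot2"
  unfolding sp_DIJ_def del2_dowker_prod2[symmetric]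
  by (rule continuous_map_quot2[OF prod_complex2_dowker_prod2])
    (simp add: del2_dowker_prod2 simplicial_complex_dowker_left)

text \<open>The quotient map composed with the squashing map is the projection of the rectangle complex to the
  Dowker complex, and both of these are equivalences.\<close>

lemma quot2_DIJ:
  "\<exists>g. homotopy_inverse (sp_DIJ I J R) (realization (dowker_left I J (rel_IJ R))) quot2 g"
proof -
  obtain s' where s: "homotopy_inverse (realization (rect I J (rel_IJ R))) (sp_DIJ I J R) squash2 s'"
    using squash2_rect by blast
  obtain p' where p: "homotopy_inverse (realization (rect I J (rel_IJ R)))
      (realization (dowker_left I J (rel_IJ R))) (realization_map fst) p'"
    using rect_to_dowker_left by blast
  have "homotopy_inverse (sp_DIJ I J R) (realization (dowker_left I J (rel_IJ R))) quot2 (squash2 \<circ> p')"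
    using s p continuous_map_quot2_DIJ
    by (rule homotopy_inverse_two_of_three) (simp add: squash2_eq quot2_def)
  then show ?thesis
    by blast
qed

theorem proposition6p2p2:
  fixes I :: "'i set" and J :: "'j set" and K :: "'k set" and R :: "('i \<times> 'j \<times> 'k) set"
  assumes "R \<subseteq> I \<times> J \<times> K"
  shows
    "realized_by (sp_D I J K R) (sp_DIJ I J R) (map_D_DIJ I J K R)
       (I \<times> J \<times> K) (cuboid I J K R) (ident_cuboid I J K R)
       (I \<times> J) (rect I J (rel_IJ R)) (ident_rect_IJ I J R)
       proj_IJ \<and>
     realized_by (sp_D I J K R) (sp_DIJ I J R) (map_D_DIJ I J K R)
       (I \<times> J) (dowker_mod_K I J K R) (ident_dowker_mod_K I J K R)
       (I \<times> J) (rect I J (rel_IJ R)) (ident_rect_IJ I J R)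
       id \<and>
     realized_by (sp_D I J K R) (sp_D_JK I J K R) (map_D_D_JK I J K R)
       (I \<times> J \<times> K) (cuboid I J K R) (ident_cuboid I J K R)
       (I \<times> J \<times> K) (rect I (J \<times> K) (rel_JK R)) (ident_rect_JK I J K R)
       id \<and>
     realized_by (sp_D I J K R) (sp_D_JK I J K R) (map_D_D_JK I J K R)
       (I \<times> J \<times> K) (cuboid I J K R) (ident_cuboid I J K R)
       I (dowker_left I (J \<times> K) (rel_JK R)) (ident_dowker_I_JK I J K R)
       proj_I \<and>
     realized_by (sp_D I J K R) (sp_D_JK I J K R) (map_D_D_JK I J K R)
       (I \<times> J \<times> K) (cuboid I J K R) (ident_cuboid I J K R)
       (J \<times> K) (dowker_right I (J \<times> K) (rel_JK R)) (ident_dowker_JK I J K R)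
       proj_JK \<and>
     realized_by (sp_D I J K R) (sp_D_JK I J K R) (map_D_D_JK I J K R)
       (J \<times> K) (dowker_mod_I I J K R) (ident_dowker_mod_I I J K R)
       (J \<times> K) (dowker_right I (J \<times> K) (rel_JK R)) (ident_dowker_JK I J K R)
       id \<and>
     realized_by (sp_D_JK I J K R) (sp_DIJ I J R) (map_D_JK_DIJ I J K R)
       I (dowker_left I (J \<times> K) (rel_JK R)) (ident_dowker_I_JK I J K R)
       I (dowker_left I J (rel_IJ R)) (ident_dowker_I_IJ I J R)
       id"
proof -
  define C where "C = cuboid I J K R"
  define M where "M = dowker_mod_K I J K R"
  define M' where "M' = dowker_mod_I I J K R"
  define T where "T = rect I (J \<times> K) (rel_JK R)"
  define T' where "T' = rect I J (rel_IJ R)"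
  define L where "L = dowker_left I (J \<times> K) (rel_JK R)"
  define L' where "L' = dowker_left I J (rel_IJ R)"
  define D where "D = dowker_right I (J \<times> K) (rel_JK R)"
  note defs = C_def M_def M'_def T_def T'_def L_def L'_def D_def
  let ?X = "sp_D I J K R" and ?Y = "sp_DIJ I J R" and ?Z = "sp_D_JK I J K R"

  have complexes: "simplicial_complex (I \<times> J \<times> K) C" "simplicial_complex (I \<times> J) M"
    "simplicial_complex (J \<times> K) M'" "simplicial_complex (I \<times> J \<times> K) T" "simplicial_complex (I \<times> J) T'"
    "simplicial_complex I L" "simplicial_complex I L'" "simplicial_complex (J \<times> K) D"
    unfolding defs
    by (rule simplicial_complex_cuboid simplicial_complex_dowker_mod_K simplicial_complex_dowker_mod_I
        simplicial_complex_rect simplicial_complex_dowker_left simplicial_complex_dowker_right)+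
  have Z_eq: "?Z = realization L"
    by (simp add: sp_D_JK_eq L_def)
  have bary: "barycentric z" if "z \<in> topspace (realization C)" for z
    using that points_of_complex[OF complexes(1)] by simp

  have sub: "C \<subseteq> T" "M \<subseteq> T'" "M' \<subseteq> D" "L \<subseteq> L'"
    unfolding defs by (rule cuboid_subset_rect dowker_mod_K_subset_rect dowker_mod_I_subset_dowker_right
        dowker_left_subset)+
  have incl: "simplicial_map (I \<times> J \<times> K) C (I \<times> J \<times> K) T id" "simplicial_map (I \<times> J) M (I \<times> J) T' id"
    "simplicial_map (J \<times> K) M' (J \<times> K) D id" "simplicial_map I L I L' id"
    using sub complexes by (simp_all add: simplicial_map_inclusion)
  have proj: "simplicial_map (I \<times> J \<times> K) C (I \<times> J) T' proj_IJ"
    "simplicial_map (I \<times> J \<times> K) C I L proj_I" "simplicial_map (I \<times> J \<times> K) C (J \<times> K) D proj_JK"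
    using complexes proj_IJ_cuboid[of _ I J K R] dowker_mod_K_subset_rect[of I J K R] cuboid_subset_rect[of I J K R]
      fst_rect[of _ I "J \<times> K" "rel_JK R"] snd_rect[of _ I "J \<times> K" "rel_JK R"]
    unfolding simplicial_map_def proj_JK_eq_snd proj_I_eq_fst defs by (auto simp: proj_IJ_def)

  obtain s' where s: "homotopy_inverse (realization C) ?X squash3 s'"
    using squash3_cuboid unfolding defs by blast
  obtain t' where t: "homotopy_inverse (realization T') ?Y squash2 t'"
    using squash2_rect unfolding defs by blast
  obtain k where k: "homotopy_inverse (realization C) (realization M) (realization_map proj_IJ) k"
    using cuboid_to_dowker_mod_K unfolding defs by blast
  obtain i where i: "homotopy_inverse (realization C) (realization M') (realization_map proj_JK) i"
    using cuboid_to_dowker_mod_I unfolding defs by blast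
  obtain l where l: "homotopy_inverse (realization T) (realization L) (realization_map fst) l"
    using rect_to_dowker_left unfolding defs by blast
  obtain d where d: "homotopy_inverse (realization T) (realization D) (realization_map snd) d"
    using rect_to_dowker_right unfolding defs by blast
  obtain y where y: "homotopy_inverse ?Y (realization L') quot2 y"
    using quot2_DIJ unfolding defs by blast

  have cont: "continuous_map (realization C) ?X squash3" "continuous_map (realization T') ?Y squash2"
    "continuous_map (realization M) (realization C) k" "continuous_map (realization M') (realization C) i"
    "continuous_map (realization T) (realization L) (realization_map fst)"
    "continuous_map (realization D) (realization T) d" "continuous_map (realization L') ?Y y"
    using s t k i l d y by (simp_all add: homotopy_inverse_def)
  have cont_incl: "continuous_map (realization C) (realization T) id"
    "continuous_map (realization M) (realization T') id" "continuous_map (realization M') (realization D) id"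
    "continuous_map (realization L) (realization L') id"
    by (rule continuous_map_inclusion[OF complexes(1,4) sub(1)] continuous_map_inclusion[OF complexes(2,5) sub(2)]
        continuous_map_inclusion[OF complexes(3,8) sub(3)] continuous_map_inclusion[OF complexes(6,7) sub(4)])+
  have f: "continuous_map ?X ?Y quot3"
    using continuous_map_compose[OF continuous_map_quot3 continuous_map_incl_D_K] by (simp add: id_comp)
  have g: "continuous_map ?X ?Z (quot2 \<circ> quot3)"
    by (rule continuous_map_compose[OF continuous_map_quot3 continuous_map_quot2_D_K])
  have h: "continuous_map ?Z ?Y y"
    using continuous_map_compose[OF cont_incl(4) cont(7)] by (simp add: Z_eq)

  have map_XY: "map_D_DIJ I J K R = hclass ?X ?Y quot3"
    by (simp add: map_D_DIJ_def hcomp_hclass continuous_map_quot3 continuous_map_incl_D_K)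
  have map_XZ: "map_D_D_JK I J K R = hclass ?X ?Z (quot2 \<circ> quot3)"
    by (simp add: map_D_D_JK_def hcomp_hclass continuous_map_quot3 continuous_map_quot2_D_K)
  have map_ZY: "map_D_JK_DIJ I J K R = hclass ?Z ?Y y"
    using hinv_hclass[OF y] hcomp_hclass[OF cont_incl(4) cont(7)]
    by (simp add: map_D_JK_DIJ_def sp_DIJ_J_eq Z_eq flip: L'_def)
  have id_C: "ident_cuboid I J K R = hclass (realization C) ?X squash3"
    by (simp add: ident_cuboid_def C_def)
  have id_T': "ident_rect_IJ I J R = hclass (realization T') ?Y squash2"
    by (simp add: ident_rect_IJ_def T'_def)
  have id_M: "ident_dowker_mod_K I J K R = hclass (realization M) ?X (squash3 \<circ> k)"
    by (simp add: ident_dowker_mod_K_def id_C hinv_hclass[OF k] hcomp_hclass cont flip: C_def M_def)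
  have id_M': "ident_dowker_mod_I I J K R = hclass (realization M') ?X (squash3 \<circ> i)"
    by (simp add: ident_dowker_mod_I_def id_C hinv_hclass[OF i] hcomp_hclass cont flip: C_def M'_def)
  have id_L: "ident_dowker_I_JK I J K R = hclass (realization L) ?Z id"
    by (simp add: ident_dowker_I_JK_def L_def)
  have id_T: "ident_rect_JK I J K R = hclass (realization T) ?Z (realization_map fst)"
    by (simp add: ident_rect_JK_def id_L Z_eq hcomp_hclass cont flip: T_def L_def)
  have id_D: "ident_dowker_JK I J K R = hclass (realization D) ?Z (realization_map fst \<circ> d)"
    by (simp add: ident_dowker_JK_def id_T Z_eq hinv_hclass[OF d] hcomp_hclass cont flip: T_def D_def)
  have id_L': "ident_dowker_I_IJ I J R = hclass (realization L') ?Y y"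
    by (simp add: ident_dowker_I_IJ_def hinv_hclass[OF y] flip: L'_def)

  note equiv_M = homotopy_inverse_compose[OF homotopy_inverse_sym[OF k] s]
  note equiv_M' = homotopy_inverse_compose[OF homotopy_inverse_sym[OF i] s]
  have equiv_L: "homotopy_inverse (realization L) ?Z id id"
    by (simp add: Z_eq homotopy_inverse_def homotopic_refl)
  note equiv_T = l[folded Z_eq]
  note equiv_D = homotopy_inverse_compose[OF homotopy_inverse_sym[OF d] equiv_T]
  note equiv_L' = homotopy_inverse_sym[OF y]

  have id_points: "realization_map id z = z"
    if "z \<in> topspace (realization U)" "simplicial_complex A U" for z :: "'v \<Rightarrow> real" and A U
    using that points_of_complex[OF that(2), of z] by (simp add: realization_map_id barycentricD)
  (* A subcomplex inclusion is realized by realization_map id, which is the identity only on points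
     with finite support. *)
  have restrict: "homotopic (realization U) W a (b \<circ> realization_map id)"
    if "homotopic (realization U) W a b" "simplicial_complex A U" for U A W and a b :: "('v \<Rightarrow> real) \<Rightarrow> 'w"
  proof -
    have "homotopic (realization U) W b (b \<circ> realization_map id)"
      using homotopic_with_imp_continuous_maps[OF that(1)] id_points[OF _ that(2)]
      by (intro homotopic_pointwise) auto
    with that(1) show ?thesis
      by (rule homotopic_with_trans)
  qed

  have sq_C_T': "homotopic (realization C) ?Y (quot3 \<circ> squash3) (squash2 \<circ> realization_map proj_IJ)"
    using continuous_map_compose[OF cont(1) f] bary by (intro homotopic_pointwise) (auto simp: quot3_squash3)
  have "continuous_map (realization M) ?Y squash2"
    using continuous_map_compose[OF cont_incl(2) cont(2)] by simp
  from homotopic_compose_inverse[OF k sq_C_T' this]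
  have sq_M_T': "homotopic (realization M) ?Y (quot3 \<circ> (squash3 \<circ> k)) (squash2 \<circ> realization_map id)"
    using complexes(2) unfolding o_assoc by (rule restrict)

  have sq_C_L: "homotopic (realization C) ?Z ((quot2 \<circ> quot3) \<circ> squash3) (realization_map fst)"
    using continuous_map_compose[OF cont(1) g]
    by (rule homotopic_pointwise) (simp add: quot2_def quot3_def squash3_eq proj_I_eq_fst)
  then have sq_C_T: "homotopic (realization C) ?Z ((quot2 \<circ> quot3) \<circ> squash3)
      (realization_map fst \<circ> realization_map id)"
    using complexes(1) by (rule restrict)
  have fst_Z: "continuous_map (realization T) ?Z (realization_map fst)"
    using cont(5) by (simp add: Z_eq)
  (* On the rectangle complex, passing to the Dowker complex of J \<times> K and back by d is homotopic to the
     identity; restricted to the cuboid complex, this replaces fst by fst \<circ> d \<circ> proj_JK. *)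
  have "homotopic (realization T) ?Z (realization_map fst \<circ> (d \<circ> realization_map snd)) (realization_map fst \<circ> id)"
    using d fst_Z by (intro homotopic_compose_left) (auto simp: homotopy_inverse_def)
  then have "homotopic (realization C) ?Z ((realization_map fst \<circ> (d \<circ> realization_map snd)) \<circ> id)
      ((realization_map fst \<circ> id) \<circ> id)"
    using cont_incl(1) by (rule homotopic_compose_right)
  then have "homotopic (realization C) ?Z (realization_map fst) ((realization_map fst \<circ> d) \<circ> realization_map snd)"
    by (simp add: o_assoc homotopic_with_symD)
  with sq_C_L have sq_C_D: "homotopic (realization C) ?Z ((quot2 \<circ> quot3) \<circ> squash3)
      ((realization_map fst \<circ> d) \<circ> realization_map proj_JK)"
    unfolding proj_JK_eq_snd by (rule homotopic_with_trans)
  have "continuous_map (realization M') ?Z (realization_map fst \<circ> d)"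
    using continuous_map_compose[OF cont_incl(3) continuous_map_compose[OF cont(6) fst_Z]] by simp
  from homotopic_compose_inverse[OF i sq_C_D this]
  have sq_M'_D: "homotopic (realization M') ?Z ((quot2 \<circ> quot3) \<circ> (squash3 \<circ> i))
      ((realization_map fst \<circ> d) \<circ> realization_map id)"
    using complexes(3) unfolding o_assoc by (rule restrict)

  have sq_L_L': "homotopic (realization L) ?Y (y \<circ> id) (y \<circ> realization_map id)"
    using h complexes(6) by (intro restrict) (simp_all add: Z_eq homotopic_refl)
  have sq_C_L_id: "homotopic (realization C) ?Z ((quot2 \<circ> quot3) \<circ> squash3) (id \<circ> realization_map proj_I)"
    using sq_C_L by (simp add: proj_I_eq_fst)

  show ?thesis
    unfolding C_def[symmetric] M_def[symmetric] M'_def[symmetric] T_def[symmetric] T'_def[symmetric]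
      L_def[symmetric] L'_def[symmetric] D_def[symmetric]
    using realized_byI[OF f map_XY proj(1) s id_C t id_T' sq_C_T']
      realized_byI[OF f map_XY incl(2) equiv_M id_M t id_T' sq_M_T']
      realized_byI[OF g map_XZ incl(1) s id_C equiv_T id_T sq_C_T]
      realized_byI[OF g map_XZ proj(2) s id_C equiv_L id_L sq_C_L_id]
      realized_byI[OF g map_XZ proj(3) s id_C equiv_D id_D sq_C_D]
      realized_byI[OF g map_XZ incl(3) equiv_M' id_M' equiv_D id_D sq_M'_D]
      realized_byI[OF h map_ZY incl(4) equiv_L id_L equiv_L' id_L' sq_L_L']
    by (intro conjI)
qed

end
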